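(* Let $\mathcal{M}$ be a type II$_1$ factor, $\mathcal{A}$ a masa in $\mathcal{M}$ and let $E:\mathcal M\to\mathcal A$ denote the trace preserving conditional expectation onto $\mathcal A$. If $\mathbf{A}=(A_1,\dots,A_n)$ is an $n$-tuple of positive contractions in $\mathcal{A}$ and $\varepsilon >0$, then there is an $n$-tuple $\mathbf{P}=(P_1,\dots,P_n)$ of commuting projections in $\mathcal M$ such that $$\| E(\mathbf{P}) - \mathbf{A}\|\leq \varepsilon .$$
   Context: A masa is a maximal abelian self-adjoint subalgebra. Maps act on tuples entrywise, $E(\mathbf P)=(E(P_1),\dots,E(P_n))$, and $\|\mathbf S\|=\max_i\|S_i\|$ (operator norm). Projections are orthogonal projections; "commuting" means that the entries of the tuple commute pairwise. *)

theory Defs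
  imports "HOL-Analysis.Analysis"
begin

section \<open>Complex Hilbert spaces\<close>

text \<open>The real inner product of \<^class>\<open>real_inner\<close> is the real part of the complex one, so norm,
  metric and completeness are the usual ones of a complex Hilbert space. The complex inner product
  is linear in its first argument.\<close>

class complex_hilbert_space = real_inner + banach +
  fixes scaleC :: "complex \<Rightarrow> 'a \<Rightarrow> 'a"
    and cinner :: "'a \<Rightarrow> 'a \<Rightarrow> complex"
  assumes scaleC_of_real: "scaleC (complex_of_real r) x = scaleR r x"
    and scaleC_add_right: "scaleC c (x + y) = scaleC c x + scaleC c y"
    and scaleC_add_left: "scaleC (c + d) x = scaleC c x + scaleC d x"
    and scaleC_scaleC: "scaleC c (scaleC d x) = scaleC (c * d) x"
    and cinner_commute: "cinner x y = cnj (cinner y x)"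
    and cinner_add_left: "cinner (x + y) z = cinner x z + cinner y z"
    and cinner_scaleC_left: "cinner (scaleC c x) y = c * cinner x y"
    and Re_cinner: "Re (cinner x y) = inner x y"
begin

lemma cinner_scaleC_right: "cinner x (scaleC c y) = cnj c * cinner x y"
  by (metis cinner_commute cinner_scaleC_left complex_cnj_cnj complex_cnj_mult)

lemma cinner_self: "cinner x x = complex_of_real ((norm x)\<^sup>2)"
proof (rule complex_eqI)
  show "Re (cinner x x) = Re (complex_of_real ((norm x)\<^sup>2))"
    by (simp add: Re_cinner power2_norm_eq_inner)
  have "Im (cinner x x) = - Im (cinner x x)"
    using arg_cong[OF cinner_commute[of x x], of Im] by simp
  then show "Im (cinner x x) = Im (complex_of_real ((norm x)\<^sup>2))" by simp
qed

lemma norm_scaleC: "norm (scaleC c x) = cmod c * norm x"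
proof -
  have "complex_of_real ((norm (scaleC c x))\<^sup>2) = complex_of_real ((cmod c * norm x)\<^sup>2)"
    unfolding cinner_self[symmetric] cinner_scaleC_left cinner_scaleC_right
    by (simp add: cinner_self power_mult_distrib mult.assoc[symmetric] complex_norm_square
        del: of_real_power)
  then show ?thesis
    by (simp only: of_real_eq_iff) (simp add: power2_eq_iff_nonneg)
qed

end

lemma cinner_eq_if_inner_eq:
  fixes a b c d :: "'a::complex_hilbert_space"
  assumes "inner a b = inner c d" and "inner (scaleC \<i> a) b = inner (scaleC \<i> c) d"
  shows "cinner a b = cinner c d"
  using assms unfolding Re_cinner[symmetric] cinner_scaleC_left
  by (auto intro: complex_eqI)


section \<open>Bounded operators\<close>

text \<open>An operator on the Hilbert space is a complex-linear element of the type of bounded real-linear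
  maps. The norm of that type is the operator norm.\<close>

definition bounded_operators :: "('h::complex_hilbert_space \<Rightarrow>\<^sub>L 'h) set" where
  "bounded_operators = {T. \<forall>c x. blinfun_apply T (scaleC c x) = scaleC c (blinfun_apply T x)}"

lift_definition scaleC_op ::
    "complex \<Rightarrow> ('h::complex_hilbert_space \<Rightarrow>\<^sub>L 'h) \<Rightarrow> ('h \<Rightarrow>\<^sub>L 'h)"
  is "\<lambda>c T x. scaleC c (T x)"
proof -
  fix c :: complex and T :: "'h \<Rightarrow> 'h"
  assume "bounded_linear T"
  moreover have "bounded_linear (scaleC c :: 'h \<Rightarrow> 'h)"
    by (rule bounded_linear_intro[where K = "cmod c"])
      (simp_all add: scaleC_add_right norm_scaleC mult.commute scaleC_scaleC
        flip: scaleC_of_real)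
  ultimately show "bounded_linear (\<lambda>x. scaleC c (T x))"
    by (rule bounded_linear_compose[rotated])
qed

definition adj :: "('h::complex_hilbert_space \<Rightarrow>\<^sub>L 'h) \<Rightarrow> ('h \<Rightarrow>\<^sub>L 'h)" where
  "adj T = (THE S. \<forall>x y. cinner (blinfun_apply T x) y = cinner x (blinfun_apply S y))"

definition positive_op :: "('h::complex_hilbert_space \<Rightarrow>\<^sub>L 'h) \<Rightarrow> bool" where
  "positive_op T \<longleftrightarrow> T \<in> bounded_operators \<and> (\<forall>x. cinner (blinfun_apply T x) x \<in> \<real>\<^sub>\<ge>\<^sub>0)"

definition projection_op :: "('h::complex_hilbert_space \<Rightarrow>\<^sub>L 'h) \<Rightarrow> bool" where
  "projection_op P \<longleftrightarrow> P \<in> bounded_operators \<and> adj P = P \<and> P o\<^sub>L P = P"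

text \<open>The description operator in \<^const>\<open>adj\<close> is well defined: the Riesz representation theorem gives
  existence and uniqueness of the adjoint.\<close>

lemma riesz_representation:
  fixes f :: "'a::{real_inner,banach} \<Rightarrow> real"
  assumes f: "bounded_linear f"
  obtains y where "\<And>x. f x = inner x y"
proof -
  interpret f: bounded_linear f by fact
  obtain K where K: "\<And>x. \<bar>f x\<bar> \<le> norm x * K"
    using f.bounded by (auto simp: mult.commute)
  define q where "q x = (norm x)\<^sup>2 / 2 - f x" for x
  have low: "- K\<^sup>2 / 2 \<le> q x" for x
  proof -
    have "f x \<le> norm x * K" using K[of x] by linarith
    moreover have "0 \<le> (norm x - K)\<^sup>2" by simp
    ultimately show ?thesis
      unfolding q_def by (simp add: power2_diff algebra_simps)
  qed
  have bdd: "bdd_below (range q)" using low by (meson bdd_belowI2)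
  define m where "m = Inf (range q)"
  have m_le: "m \<le> q x" for x unfolding m_def using bdd by (simp add: cINF_lower)
  have par: "(norm (x - y))\<^sup>2 \<le> 4 * (q x - m) + 4 * (q y - m)" for x y
  proof -
    have "q ((1/2) *\<^sub>R (x + y)) = q x / 2 + q y / 2 - (norm (x - y))\<^sup>2 / 8"
      unfolding q_def f.scaleR f.add power2_norm_eq_inner
      by (simp add: inner_add_left inner_add_right inner_diff_left inner_diff_right
          inner_commute[of y x] field_simps)
    with m_le[of "(1/2) *\<^sub>R (x + y)"] show ?thesis by argo
  qed
  have "\<exists>x. q x < m + 1 / Suc n" for n
    using cInf_lessD[of "range q" "m + 1 / Suc n"] unfolding m_def by auto
  then obtain X where X: "\<And>n. q (X n) < m + 1 / Suc n" by metis
  have "Cauchy X"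
  proof (rule metric_CauchyI)
    fix e :: real assume e: "0 < e"
    then obtain N where N: "1 / Suc N < e\<^sup>2 / 8"
      by (metis divide_pos_pos nat_approx_posE zero_less_numeral zero_less_power)
    have "dist (X k) (X l) < e" if "k \<ge> N" "l \<ge> N" for k l
    proof -
      have bound: "q (X j) - m < e\<^sup>2 / 8" if "j \<ge> N" for j
      proof -
        have "1 / real (Suc j) \<le> 1 / Suc N" using that by (simp add: frac_le)
        then show ?thesis using X[of j] N by linarith
      qed
      have "(norm (X k - X l))\<^sup>2 < e\<^sup>2"
        using par[of "X k" "X l"] bound[OF that(1)] bound[OF that(2)] by argo
      then show ?thesis using e by (simp add: dist_norm power_less_imp_less_base)
    qed
    then show "\<exists>N. \<forall>k\<ge>N. \<forall>l\<ge>N. dist (X k) (X l) < e" by blast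
  qed
  then obtain y where y: "X \<longlonglongrightarrow> y" using Cauchy_convergent convergentD by blast
  have "(\<lambda>n. q (X n)) \<longlonglongrightarrow> q y"
    unfolding q_def by (intro tendsto_intros f.tendsto y) simp
  moreover have "(\<lambda>n. m + 1 / Suc n) \<longlonglongrightarrow> m + 0"
    by (intro tendsto_intros LIMSEQ_Suc[OF lim_1_over_n])
  ultimately have qy: "q y \<le> m"
    using X by (intro LIMSEQ_le[where Y = "\<lambda>n. m + 1 / Suc n"]) (auto intro: less_imp_le)
  have "f x = inner x y" for x
  proof -
    define d where "d = inner x y - f x"
    define s where "s = (norm x)\<^sup>2"
    have key: "0 \<le> t * d + t\<^sup>2 * s / 2" for t
    proof -
      have "q (y + t *\<^sub>R x) = q y + (t * d + t\<^sup>2 * s / 2)"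
        unfolding q_def d_def s_def f.scaleR f.add power2_norm_eq_inner
        by (simp add: inner_add_left inner_add_right inner_commute[of y x] field_simps
            power2_eq_square)
      with m_le[of "y + t *\<^sub>R x"] qy show ?thesis by linarith
    qed
    have "d = 0"
    proof (rule ccontr)
      assume d: "d \<noteq> 0"
      define u where "u = s + 1"
      have u: "0 < u" "s = u - 1" by (simp_all add: u_def s_def add_nonneg_pos)
      have "0 \<le> (- d / u) * d + (- d / u)\<^sup>2 * s / 2" by (rule key)
      also have "\<dots> = - (d\<^sup>2 * (u + 1) / (2 * u\<^sup>2))"
        using u(1) unfolding u(2) by (simp add: field_simps power2_eq_square)
      also have "\<dots> < 0" using d u(1) by (simp add: zero_less_divide_iff zero_less_mult_iff)
      finally show False by simp
    qed
    then show ?thesis by (simp add: d_def)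
  qed
  then show ?thesis by (rule that)
qed

lemma cinner_adj:
  assumes T: "T \<in> bounded_operators"
  shows "cinner (blinfun_apply T x) y = cinner x (blinfun_apply (adj T) y)"
proof -
  have ex: "\<exists>z. \<forall>x. inner (blinfun_apply T x) y = inner x z" for y
  proof -
    have "bounded_linear (\<lambda>x. inner (blinfun_apply T x) y)"
      by (intro bounded_linear_intros)
    then show ?thesis by (rule riesz_representation) blast
  qed
  then obtain g where g: "\<And>x y. inner (blinfun_apply T x) y = inner x (g y)" by metis
  have ext: "u = v" if "\<And>x. inner x u = inner x v" for u v :: 'a
    using that[of "u - v"] by (metis inner_diff_right inner_eq_zero_iff right_minus_eq)
  have "bounded_linear g"
  proof (rule bounded_linear_intro[where K = "norm T"])
    show "g (a + b) = g a + g b" for a b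
      by (rule ext) (simp add: inner_add_right flip: g)
    show "g (r *\<^sub>R a) = r *\<^sub>R g a" for r a
      by (rule ext) (simp flip: g)
    show "norm (g a) \<le> norm a * norm T" for a
    proof (cases "g a = 0")
      case False
      have "norm (g a) * norm (g a) = inner (blinfun_apply T (g a)) a"
        unfolding g by (metis norm_eq_sqrt_inner real_sqrt_mult_self abs_of_nonneg inner_ge_zero)
      also have "\<dots> \<le> norm (blinfun_apply T (g a)) * norm a" by (rule norm_cauchy_schwarz)
      also have "\<dots> \<le> (norm T * norm (g a)) * norm a"
        by (intro mult_right_mono norm_blinfun) simp
      finally show ?thesis using False by (simp add: mult.commute mult.left_commute)
    qed simp
  qed
  then have Sapp: "blinfun_apply (Blinfun g) = g" by (rule bounded_linear_Blinfun_apply)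
  have S: "cinner (blinfun_apply T x) y = cinner x (blinfun_apply (Blinfun g) y)" for x y
    unfolding Sapp
  proof (rule cinner_eq_if_inner_eq)
    show "inner (blinfun_apply T x) y = inner x (g y)" by (rule g)
    show "inner (scaleC \<i> (blinfun_apply T x)) y = inner (scaleC \<i> x) (g y)"
      using T g[of "scaleC \<i> x" y] by (simp add: bounded_operators_def)
  qed
  have uniq: "S' = Blinfun g"
    if "\<forall>x y. cinner (blinfun_apply T x) y = cinner x (blinfun_apply S' y)" for S'
  proof (rule blinfun_eqI, rule ext)
    fix y x
    show "inner x (blinfun_apply S' y) = inner x (blinfun_apply (Blinfun g) y)"
      using that S by (metis Re_cinner)
  qed
  have "\<forall>x y. cinner (blinfun_apply T x) y = cinner x (blinfun_apply (adj T) y)"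
    unfolding adj_def by (rule theI[where a = "Blinfun g"]) (use S uniq in blast)+
  then show ?thesis by blast
qed


section \<open>Von Neumann algebras\<close>

definition abelian :: "('h::complex_hilbert_space \<Rightarrow>\<^sub>L 'h) set \<Rightarrow> bool" where
  "abelian A \<longleftrightarrow> (\<forall>S\<in>A. \<forall>T\<in>A. S o\<^sub>L T = T o\<^sub>L S)"

definition star_subalgebra :: "('h::complex_hilbert_space \<Rightarrow>\<^sub>L 'h) set \<Rightarrow> bool" where
  "star_subalgebra A \<longleftrightarrow> A \<subseteq> bounded_operators \<and> 0 \<in> A \<and>
     (\<forall>S\<in>A. \<forall>T\<in>A. S + T \<in> A) \<and> (\<forall>c. \<forall>T\<in>A. scaleC_op c T \<in> A) \<and>
     (\<forall>S\<in>A. \<forall>T\<in>A. S o\<^sub>L T \<in> A) \<and> (\<forall>T\<in>A. adj T \<in> A)"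

definition commutant ::
    "('h::complex_hilbert_space \<Rightarrow>\<^sub>L 'h) set \<Rightarrow> ('h \<Rightarrow>\<^sub>L 'h) set" where
  "commutant M = {T \<in> bounded_operators. \<forall>S\<in>M. S o\<^sub>L T = T o\<^sub>L S}"

definition von_neumann_algebra :: "('h::complex_hilbert_space \<Rightarrow>\<^sub>L 'h) set \<Rightarrow> bool" where
  "von_neumann_algebra M \<longleftrightarrow> star_subalgebra M \<and> commutant (commutant M) = M"

definition factor :: "('h::complex_hilbert_space \<Rightarrow>\<^sub>L 'h) set \<Rightarrow> bool" where
  "factor M \<longleftrightarrow> von_neumann_algebra M \<and> id_blinfun \<noteq> (0 :: 'h \<Rightarrow>\<^sub>L 'h) \<and>
     M \<inter> commutant M = range (\<lambda>c. scaleC_op c id_blinfun)"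

definition abelian_projection ::
    "('h::complex_hilbert_space \<Rightarrow>\<^sub>L 'h) set \<Rightarrow> ('h \<Rightarrow>\<^sub>L 'h) \<Rightarrow> bool" where
  "abelian_projection M P \<longleftrightarrow> P \<in> M \<and> projection_op P \<and> abelian ((\<lambda>T. P o\<^sub>L T o\<^sub>L P) ` M)"

definition finite_algebra :: "('h::complex_hilbert_space \<Rightarrow>\<^sub>L 'h) set \<Rightarrow> bool" where
  "finite_algebra M \<longleftrightarrow>
     (\<forall>V\<in>M. adj V o\<^sub>L V = id_blinfun \<longrightarrow> V o\<^sub>L adj V = id_blinfun)"

text \<open>Murray--von Neumann type: no nonzero abelian projection, and the identity is a finite
  projection.\<close>

definition type_II1_factor :: "('h::complex_hilbert_space \<Rightarrow>\<^sub>L 'h) set \<Rightarrow> bool" where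
  "type_II1_factor M \<longleftrightarrow> factor M \<and> finite_algebra M \<and> (\<forall>P. abelian_projection M P \<longrightarrow> P = 0)"

definition masa ::
    "('h::complex_hilbert_space \<Rightarrow>\<^sub>L 'h) set \<Rightarrow> ('h \<Rightarrow>\<^sub>L 'h) set \<Rightarrow> bool" where
  "masa A M \<longleftrightarrow> star_subalgebra A \<and> abelian A \<and> A \<subseteq> M \<and>
     (\<forall>B. star_subalgebra B \<and> abelian B \<and> A \<subseteq> B \<and> B \<subseteq> M \<longrightarrow> B = A)"


section \<open>Trace and conditional expectation\<close>

text \<open>Functionals and maps on \<open>M\<close> are total functions of which only the values on \<open>M\<close> matter.\<close>

definition linear_functional_on ::
    "('h::complex_hilbert_space \<Rightarrow>\<^sub>L 'h) set \<Rightarrow> (('h \<Rightarrow>\<^sub>L 'h) \<Rightarrow> complex) \<Rightarrow> bool" where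
  "linear_functional_on M \<tau> \<longleftrightarrow> (\<forall>S\<in>M. \<forall>T\<in>M. \<tau> (S + T) = \<tau> S + \<tau> T) \<and>
     (\<forall>c. \<forall>T\<in>M. \<tau> (scaleC_op c T) = c * \<tau> T)"

text \<open>Normality: the value at the least upper bound \<open>T\<close> of an upward directed set \<open>D\<close> of
  self-adjoint elements of \<open>M\<close> is the supremum of the values on \<open>D\<close>. The order is
  \<open>S \<le> T\<close> iff \<open>T - S\<close> is positive; positive functionals are real on self-adjoint elements.\<close>

definition normal_functional_on ::
    "('h::complex_hilbert_space \<Rightarrow>\<^sub>L 'h) set \<Rightarrow> (('h \<Rightarrow>\<^sub>L 'h) \<Rightarrow> complex) \<Rightarrow> bool" where
  "normal_functional_on M \<tau> \<longleftrightarrow>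
     (\<forall>D T. D \<noteq> {} \<and> D \<subseteq> {S\<in>M. adj S = S} \<and>
        (\<forall>R\<in>D. \<forall>S\<in>D. \<exists>U\<in>D. positive_op (U - R) \<and> positive_op (U - S)) \<and>
        T \<in> M \<and> adj T = T \<and> (\<forall>S\<in>D. positive_op (T - S)) \<and>
        (\<forall>U\<in>M. adj U = U \<and> (\<forall>S\<in>D. positive_op (U - S)) \<longrightarrow> positive_op (U - T))
        \<longrightarrow> Re (\<tau> T) = (SUP S\<in>D. Re (\<tau> S)))"

definition faithful_normal_tracial_state ::
    "('h::complex_hilbert_space \<Rightarrow>\<^sub>L 'h) set \<Rightarrow> (('h \<Rightarrow>\<^sub>L 'h) \<Rightarrow> complex) \<Rightarrow> bool" where
  "faithful_normal_tracial_state M \<tau> \<longleftrightarrow> linear_functional_on M \<tau> \<and>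
     (\<forall>T\<in>M. positive_op T \<longrightarrow> \<tau> T \<in> \<real>\<^sub>\<ge>\<^sub>0) \<and> \<tau> id_blinfun = 1 \<and>
     (\<forall>S\<in>M. \<forall>T\<in>M. \<tau> (S o\<^sub>L T) = \<tau> (T o\<^sub>L S)) \<and>
     (\<forall>T\<in>M. positive_op T \<and> \<tau> T = 0 \<longrightarrow> T = 0) \<and>
     normal_functional_on M \<tau>"

definition conditional_expectation ::
    "('h::complex_hilbert_space \<Rightarrow>\<^sub>L 'h) set \<Rightarrow> ('h \<Rightarrow>\<^sub>L 'h) set \<Rightarrow>
      (('h \<Rightarrow>\<^sub>L 'h) \<Rightarrow> ('h \<Rightarrow>\<^sub>L 'h)) \<Rightarrow> bool" where
  "conditional_expectation M A E \<longleftrightarrow>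
     (\<forall>T\<in>M. E T \<in> A) \<and>
     (\<forall>S\<in>M. \<forall>T\<in>M. E (S + T) = E S + E T) \<and>
     (\<forall>c. \<forall>T\<in>M. E (scaleC_op c T) = scaleC_op c (E T)) \<and>
     (\<forall>T\<in>M. positive_op T \<longrightarrow> positive_op (E T)) \<and>
     (\<forall>T\<in>A. E T = T) \<and>
     (\<forall>R\<in>A. \<forall>T\<in>M. \<forall>S\<in>A. E (R o\<^sub>L T o\<^sub>L S) = R o\<^sub>L E T o\<^sub>L S)"

definition trace_preserving ::
    "('h::complex_hilbert_space \<Rightarrow>\<^sub>L 'h) set \<Rightarrow> (('h \<Rightarrow>\<^sub>L 'h) \<Rightarrow> complex) \<Rightarrow>
      (('h \<Rightarrow>\<^sub>L 'h) \<Rightarrow> ('h \<Rightarrow>\<^sub>L 'h)) \<Rightarrow> bool" where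
  "trace_preserving M \<tau> E \<longleftrightarrow> (\<forall>T\<in>M. \<tau> (E T) = \<tau> T)"


section \<open>Tuples\<close>

text \<open>An \<open>n\<close>-tuple is a function of which only the values on \<open>{1..n}\<close> matter.\<close>

definition tuple_norm :: "nat \<Rightarrow> (nat \<Rightarrow> ('h::complex_hilbert_space \<Rightarrow>\<^sub>L 'h)) \<Rightarrow> real" where
  "tuple_norm n S = Max ((\<lambda>i. norm (S i)) ` {1..n})"

definition commuting_tuple :: "nat \<Rightarrow> (nat \<Rightarrow> ('h::complex_hilbert_space \<Rightarrow>\<^sub>L 'h)) \<Rightarrow> bool" where
  "commuting_tuple n S \<longleftrightarrow> (\<forall>i\<in>{1..n}. \<forall>j\<in>{1..n}. S i o\<^sub>L S j = S j o\<^sub>L S i)"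

end

(*
  Every masa A of a II_1 factor has no minimal projections: a minimal one would make its corner of M
  commute with A, hence lie in A, hence be abelian. So A contains N orthogonal projections of equal trace
  below any given projection, and projections of equal trace are equivalent in the factor.
  This gives N x N matrix units whose diagonal lies in A and which commute with any prescribed finite set of
  projections q of A. A rank one projection onto a row of a Hadamard matrix has all diagonal entries
  1/N, and E kills the off-diagonal matrix units, so the N rows give orthogonal projections p_k with
  E(p_k) = 1/N. Finally A_i is within 1/N of (1/N) (q_1 + ... + q_(N-1)) for suitable spectral
  projections q_k, and P_i = p_1 q_1 + ... + p_(N-1) q_(N-1) has exactly this expectation.
*)
theory Submission
  imports Defs
begin

section \<open>Real adjoints and commutants\<close>

text \<open>All entries of the tuple share one family \<open>p_k\<close>, so the spectral
  projections of all \<open>A_i\<close> are fixed before the matrix units are built: the units have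
  to commute with finitely many projections only. Equal diagonal entries make \<open>E(p_k)\<close>
  a scalar, and the module property of \<open>E\<close> then gives
  \<open>E(p_k q_k) = q_k / N\<close> for every \<open>q_k\<close> in \<open>A\<close>. The number
  \<open>N - 1\<close> arises because \<open>N A_i\<close> lies between \<open>0\<close> and
  \<open>N\<close>, and each subtracted projection lowers the upper bound by one until the remainder
  lies between \<open>0\<close> and \<open>1\<close>. \<open>N\<close> is a power of two, where
  doubling yields a real Hadamard matrix. The obstacle on the analytic side is to stay inside
  \<open>M\<close> and \<open>A\<close>: square roots, inverses and spectral projections are
  constructed in the bicommutant of the operator they come from, and strong limits of chains of
  partial isometries remain in bicommutants.\<close>

text \<open>Working over the underlying real Hilbert space, the adjoint is defined for every bounded operator.
  Multiplication by the imaginary unit is just one more operator in the algebra, so that the real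
  commutants agree with the complex ones.\<close>

definition radj :: "('h::{real_inner,banach} \<Rightarrow>\<^sub>L 'h) \<Rightarrow> ('h \<Rightarrow>\<^sub>L 'h)" where
  "radj T = (SOME S. \<forall>x y. inner (T x) y = inner x (blinfun_apply S y))"

lemma inner_eqI:
  fixes u v :: "'a::real_inner"
  assumes "\<And>x. inner x u = inner x v"
  shows "u = v"
  using assms[of "u - v"] by (metis inner_diff_right inner_eq_zero_iff right_minus_eq)

lemma inner_radj: "inner (blinfun_apply T x) y = inner x (radj T y)"
proof -
  have "\<exists>z. \<forall>x. inner (T x) y = inner x z" for y
  proof -
    have "bounded_linear (\<lambda>x. inner (T x) y)"
      by (intro bounded_linear_intros)
    then show ?thesis by (rule riesz_representation) blast
  qed
  then obtain g where g: "\<And>x y. inner (T x) y = inner x (g y)" by metis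
  have "bounded_linear g"
  proof (rule bounded_linear_intro[where K = "norm T"])
    show "g (a + b) = g a + g b" for a b
      by (rule inner_eqI) (simp add: inner_add_right flip: g)
    show "g (r *\<^sub>R a) = r *\<^sub>R g a" for r a
      by (rule inner_eqI) (simp flip: g)
    show "norm (g a) \<le> norm a * norm T" for a
    proof (cases "g a = 0")
      case False
      have "norm (g a) * norm (g a) = inner (T (g a)) a"
        unfolding g by (metis norm_eq_sqrt_inner real_sqrt_mult_self abs_of_nonneg inner_ge_zero)
      also have "\<dots> \<le> norm (T (g a)) * norm a" by (rule norm_cauchy_schwarz)
      also have "\<dots> \<le> (norm T * norm (g a)) * norm a"
        by (intro mult_right_mono norm_blinfun) simp
      finally show ?thesis using False by (simp add: mult.commute mult.left_commute)
    qed simp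
  qed
  then have "\<forall>x y. inner (T x) y = inner x (Blinfun g y)"
    by (simp add: bounded_linear_Blinfun_apply g)
  then have "\<forall>x y. inner (T x) y = inner x (radj T y)"
    unfolding radj_def by (rule someI[where P = "\<lambda>S. \<forall>x y. inner (T x) y = inner x (blinfun_apply S y)"])
  then show ?thesis by blast
qed

lemma inner_radj': "inner (radj T x) y = inner x (blinfun_apply T y)"
  using inner_radj[of T y x] by (simp add: inner_commute)

lemma radj_eqI:
  assumes "\<And>x y. inner (blinfun_apply T x) y = inner x (blinfun_apply S y)"
  shows "radj T = S"
proof (rule blinfun_eqI, rule inner_eqI)
  show "inner x (radj T y) = inner x (S y)" for x y
    using inner_radj[of T x y] assms[of x y] by simp
qed

lemma radj_radj [simp]: "radj (radj T) = T"
  by (rule radj_eqI) (rule inner_radj')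

lemma radj_id [simp]: "radj id_blinfun = id_blinfun"
  by (rule radj_eqI) simp

lemma radj_0 [simp]: "radj 0 = 0"
  by (rule radj_eqI) simp

lemma radj_add [simp]: "radj (S + T) = radj S + radj T"
  by (rule radj_eqI) (simp add: blinfun.bilinear_simps inner_radj algebra_simps)

lemma radj_diff [simp]: "radj (S - T) = radj S - radj T"
  by (rule radj_eqI) (simp add: blinfun.bilinear_simps inner_radj algebra_simps)

lemma radj_minus [simp]: "radj (- T) = - radj T"
  by (rule radj_eqI) (simp add: blinfun.bilinear_simps inner_radj algebra_simps)

lemma radj_scaleR [simp]: "radj (c *\<^sub>R T) = c *\<^sub>R radj T"
  by (rule radj_eqI) (simp add: blinfun.bilinear_simps inner_radj)

lemma radj_compose [simp]: "radj (S o\<^sub>L T) = radj T o\<^sub>L radj S"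
  by (rule radj_eqI) (simp add: inner_radj)

lemma radj_sum [simp]: "radj (sum f I) = (\<Sum>i\<in>I. radj (f i))"
  by (induction I rule: infinite_finite_induct) simp_all

lemma radj_eq_self_iff:
  "radj T = T \<longleftrightarrow> (\<forall>x y. inner (blinfun_apply T x) y = inner x (blinfun_apply T y))"
  by (metis inner_radj radj_eqI)

section \<open>Algebra of composition, and commutants\<close>

lemma blinfun_compose_assoc: "(R o\<^sub>L S) o\<^sub>L T = R o\<^sub>L (S o\<^sub>L T)"
  by (rule blinfun_eqI) simp

lemma blinfun_compose_id [simp]: "id_blinfun o\<^sub>L T = T" "T o\<^sub>L id_blinfun = T"
  by (auto intro: blinfun_eqI)

interpretation blinfun_compose: bounded_bilinear "(o\<^sub>L)"
  by (rule bounded_bilinear_blinfun_compose)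

lemmas compose_simps = blinfun_compose.add_left blinfun_compose.add_right
  blinfun_compose.diff_left blinfun_compose.diff_right blinfun_compose.minus_left
  blinfun_compose.minus_right blinfun_compose.scaleR_left blinfun_compose.scaleR_right
  blinfun_compose.sum_left blinfun_compose.sum_right

lemma applyI: "S o\<^sub>L T = U \<Longrightarrow> blinfun_apply S (blinfun_apply T x) = blinfun_apply U x"
  by auto

lemma adj_compose_eq_0_iff: "radj T o\<^sub>L T = 0 \<longleftrightarrow> T = 0"
proof
  assume "radj T o\<^sub>L T = 0"
  then have "inner (T x) (T x) = 0" for x
    by (metis applyI blinfun.zero_left inner_radj inner_zero_right)
  then show "T = 0" by (intro blinfun_eqI) simp
qed simp

text \<open>For \<open>S\<close> closed under adjoints, the bicommutant
  \<open>rcomm (rcomm S)\<close> plays the role of the von Neumann algebra generated by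
  \<open>S\<close>. An operator built canonically from \<open>T\<close> is shown to lie in
  \<open>rcomm (rcomm {T})\<close>, which transfers membership in \<open>M\<close> or
  \<open>A\<close> from \<open>T\<close> to it.\<close>

definition rcomm :: "('h::real_normed_vector \<Rightarrow>\<^sub>L 'h) set \<Rightarrow> ('h \<Rightarrow>\<^sub>L 'h) set" where
  "rcomm S = {T. \<forall>U\<in>S. U o\<^sub>L T = T o\<^sub>L U}"

lemma rcommI: "(\<And>U. U \<in> S \<Longrightarrow> U o\<^sub>L T = T o\<^sub>L U) \<Longrightarrow> T \<in> rcomm S"
  by (simp add: rcomm_def)

lemma rcommD: "T \<in> rcomm S \<Longrightarrow> U \<in> S \<Longrightarrow> U o\<^sub>L T = T o\<^sub>L U"
  by (simp add: rcomm_def)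

lemma rcomm_antimono: "S \<subseteq> T \<Longrightarrow> rcomm T \<subseteq> rcomm S"
  by (auto simp: rcomm_def)

lemma subset_rcomm_rcomm: "S \<subseteq> rcomm (rcomm S)"
  by (auto simp: rcomm_def)

lemma rcomm_rcomm_rcomm: "rcomm (rcomm (rcomm S)) = rcomm S"
  by (simp add: rcomm_antimono subset_antisym subset_rcomm_rcomm)

lemma rcomm_id [simp]: "id_blinfun \<in> rcomm S"
  and rcomm_0 [simp]: "0 \<in> rcomm S"
  by (auto simp: rcomm_def)

lemma rcomm_add: "T \<in> rcomm S \<Longrightarrow> U \<in> rcomm S \<Longrightarrow> T + U \<in> rcomm S"
  and rcomm_diff: "T \<in> rcomm S \<Longrightarrow> U \<in> rcomm S \<Longrightarrow> T - U \<in> rcomm S"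
  and rcomm_minus: "T \<in> rcomm S \<Longrightarrow> - T \<in> rcomm S"
  and rcomm_scaleR: "T \<in> rcomm S \<Longrightarrow> c *\<^sub>R T \<in> rcomm S"
  by (auto simp: rcomm_def compose_simps)

lemma rcomm_compose:
  assumes "T \<in> rcomm S" "U \<in> rcomm S"
  shows "T o\<^sub>L U \<in> rcomm S"
proof (rule rcommI)
  fix V assume "V \<in> S"
  then show "V o\<^sub>L (T o\<^sub>L U) = (T o\<^sub>L U) o\<^sub>L V"
    using assms by (metis blinfun_compose_assoc rcommD)
qed

lemma rcomm_sum: "(\<And>i. i \<in> I \<Longrightarrow> f i \<in> rcomm S) \<Longrightarrow> sum f I \<in> rcomm S"
  by (induction I rule: infinite_finite_induct) (auto intro: rcomm_add)

text \<open>The second alternative allows a skew-adjoint operator, such as multiplication by the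
  imaginary unit, to be adjoined to a set closed under adjoints.\<close>

lemma rcomm_radj:
  assumes "\<And>U. U \<in> S \<Longrightarrow> radj U \<in> S \<or> radj U = - U" and "T \<in> rcomm S"
  shows "radj T \<in> rcomm S"
proof (rule rcommI)
  fix U assume U: "U \<in> S"
  then have "radj U o\<^sub>L T = T o\<^sub>L radj U"
    using assms by (metis blinfun_compose.minus_left blinfun_compose.minus_right rcommD)
  then show "U o\<^sub>L radj T = radj T o\<^sub>L U"
    by (metis radj_compose radj_radj)
qed

lemmas rcomm_intros = rcomm_id rcomm_0 rcomm_add rcomm_diff rcomm_minus rcomm_scaleR rcomm_compose
  rcomm_sum

lemma closed_rcomm: "closed (rcomm S)"
  unfolding rcomm_def Collect_ball_eq
  by (intro closed_INT ballI closed_Collect_eq continuous_intros)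

section \<open>Projections and positive operators\<close>

definition isproj :: "('h::{real_inner,banach} \<Rightarrow>\<^sub>L 'h) \<Rightarrow> bool" where
  "isproj P \<longleftrightarrow> radj P = P \<and> P o\<^sub>L P = P"

lemma isproj_0 [simp]: "isproj 0" and isproj_id [simp]: "isproj id_blinfun"
  by (simp_all add: isproj_def)

lemma isproj_radj: "isproj P \<Longrightarrow> radj P = P"
  and isproj_idem: "isproj P \<Longrightarrow> P o\<^sub>L P = P"
  by (simp_all add: isproj_def)

lemma isproj_compl: "isproj P \<Longrightarrow> isproj (id_blinfun - P)"
  by (simp add: isproj_def compose_simps)

lemma isproj_compose: "isproj P \<Longrightarrow> isproj Q \<Longrightarrow> P o\<^sub>L Q = Q o\<^sub>L P \<Longrightarrow> isproj (P o\<^sub>L Q)"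
  by (metis isproj_def blinfun_compose_assoc radj_compose)

lemma isproj_orth_sym: "isproj P \<Longrightarrow> isproj Q \<Longrightarrow> P o\<^sub>L Q = 0 \<Longrightarrow> Q o\<^sub>L P = 0"
  by (metis isproj_radj radj_0 radj_compose)

lemma isproj_le_sym: "isproj P \<Longrightarrow> isproj Q \<Longrightarrow> P o\<^sub>L Q = P \<Longrightarrow> Q o\<^sub>L P = P"
  by (metis isproj_radj radj_compose)

lemma isproj_add: "isproj P \<Longrightarrow> isproj Q \<Longrightarrow> P o\<^sub>L Q = 0 \<Longrightarrow> isproj (P + Q)"
  using isproj_orth_sym[of P Q] by (simp add: isproj_def compose_simps)

lemma isproj_diff: "isproj P \<Longrightarrow> isproj Q \<Longrightarrow> P o\<^sub>L Q = P \<Longrightarrow> isproj (Q - P)"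
  using isproj_le_sym[of P Q] by (simp add: isproj_def compose_simps)

text \<open>A minimising sequence for the distance from \<open>x\<close> to \<open>K\<close> is
  Cauchy by the parallelogram law. At its limit no variation inside \<open>K\<close> lowers the
  distance, so the residual is orthogonal to \<open>K\<close>.\<close>

lemma exists_orthogonal_projection_point:
  fixes K :: "'h::{real_inner,banach} set"
  assumes K: "subspace K" "closed K"
  shows "\<exists>k\<in>K. \<forall>z\<in>K. inner (x - k) z = 0"
proof -
  define q where "q z = (norm (x - z))\<^sup>2" for z
  define m where "m = Inf (q ` K)"
  have bdd: "bdd_below (q ` K)" by (rule bdd_belowI2[of _ 0]) (simp add: q_def)
  have m_le: "m \<le> q z" if "z \<in> K" for z
    unfolding m_def using bdd that by (simp add: cINF_lower)
  have par: "(norm (y - z))\<^sup>2 \<le> 2 * (q y - m) + 2 * (q z - m)" if "y \<in> K" "z \<in> K" for y z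
  proof -
    have "(1/2) *\<^sub>R (y + z) \<in> K" using K that by (simp add: subspace_add subspace_scale)
    moreover have "q ((1/2) *\<^sub>R (y + z)) = q y / 2 + q z / 2 - (norm (y - z))\<^sup>2 / 4"
      unfolding q_def power2_norm_eq_inner
      by (simp add: inner_add_left inner_add_right inner_diff_left inner_diff_right
          inner_commute[of y x] inner_commute[of z x] inner_commute[of z y] field_simps)
    ultimately show ?thesis using m_le by fastforce
  qed
  have "\<exists>z\<in>K. q z < m + 1 / Suc n" for n
    using cInf_lessD[of "q ` K" "m + 1 / Suc n"] subspace_0[OF K(1)] unfolding m_def by auto
  then obtain X where X: "\<And>n. X n \<in> K" "\<And>n. q (X n) < m + 1 / Suc n" by metis
  have "Cauchy X"
  proof (rule metric_CauchyI)
    fix e :: real assume e: "0 < e"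
    then obtain N where N: "1 / Suc N < e\<^sup>2 / 4"
      by (metis divide_pos_pos nat_approx_posE zero_less_numeral zero_less_power)
    have "dist (X k) (X l) < e" if "k \<ge> N" "l \<ge> N" for k l
    proof -
      have bound: "q (X j) - m < e\<^sup>2 / 4" if "j \<ge> N" for j
      proof -
        have "1 / real (Suc j) \<le> 1 / Suc N" using that by (simp add: frac_le)
        then show ?thesis using X(2)[of j] N by linarith
      qed
      have "(norm (X k - X l))\<^sup>2 < e\<^sup>2"
        using par[OF X(1) X(1), of k l] bound[OF that(1)] bound[OF that(2)] by argo
      then show ?thesis using e by (simp add: dist_norm power_less_imp_less_base)
    qed
    then show "\<exists>N. \<forall>k\<ge>N. \<forall>l\<ge>N. dist (X k) (X l) < e" by blast
  qed
  then obtain y where y: "X \<longlonglongrightarrow> y" using Cauchy_convergent convergentD by blast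
  have yK: "y \<in> K" using K(2) X(1) y by (metis closed_sequentially)
  have "(\<lambda>n. q (X n)) \<longlonglongrightarrow> q y"
    unfolding q_def by (intro tendsto_intros y)
  moreover have "(\<lambda>n. m + 1 / Suc n) \<longlonglongrightarrow> m + 0"
    by (intro tendsto_intros LIMSEQ_Suc[OF lim_1_over_n])
  ultimately have qy: "q y \<le> m"
    using X by (intro LIMSEQ_le[where Y = "\<lambda>n. m + 1 / Suc n"]) (auto intro: less_imp_le)
  have "inner (x - y) z = 0" if z: "z \<in> K" for z
  proof (cases "z = 0")
    case False
    \<comment> \<open>The step along \<open>z\<close> that minimises the quadratic
      \<open>q (y + t *\<^sub>R z)\<close>.\<close>
    define t where "t = inner (x - y) z / inner z z"
    have "q (y + t *\<^sub>R z) = q y - 2 * t * inner (x - y) z + t\<^sup>2 * inner z z"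
      unfolding q_def power2_norm_eq_inner
      by (simp add: inner_add_left inner_add_right inner_diff_left inner_diff_right
          inner_commute[of y x] inner_commute[of z x] inner_commute[of z y] algebra_simps power2_eq_square)
    also have "\<dots> = q y - (inner (x - y) z)\<^sup>2 / inner z z"
      using False by (simp add: t_def field_simps power2_eq_square)
    finally have "(inner (x - y) z)\<^sup>2 / inner z z \<le> 0"
      using m_le[of "y + t *\<^sub>R z"] qy K yK z by (simp add: subspace_add subspace_scale)
    moreover have "inner z z > 0" using False by simp
    ultimately show ?thesis by (simp add: divide_le_0_iff)
  qed simp
  with yK show ?thesis by blast
qed

lemma exists_projection_onto:
  fixes K :: "'h::{real_inner,banach} set"
  assumes K: "subspace K" "closed K"
  obtains P :: "'h \<Rightarrow>\<^sub>L 'h" where "isproj P" "\<And>x. blinfun_apply P x \<in> K"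
    "\<And>x. x \<in> K \<Longrightarrow> blinfun_apply P x = x"
proof -
  obtain g where gK: "\<And>x. g x \<in> K" and g: "\<And>x z. z \<in> K \<Longrightarrow> inner (x - g x) z = 0"
    using exists_orthogonal_projection_point[OF K] by metis
  have uniq: "u = v" if "u \<in> K" "v \<in> K" "\<And>z. z \<in> K \<Longrightarrow> inner u z = inner v z" for u v
    using that(3)[of "u - v"] that K(1)
    by (metis inner_diff_left inner_eq_zero_iff right_minus_eq subspace_diff)
  have g': "inner (g x) z = inner x z" if "z \<in> K" for x z
    using g[OF that, of x] by (simp add: inner_diff_left)
  have "bounded_linear g"
  proof (rule bounded_linear_intro[where K = 1])
    show "g (a + b) = g a + g b" for a b
      by (rule uniq) (simp_all add: gK K subspace_add g' inner_add_left)
    show "g (r *\<^sub>R a) = r *\<^sub>R g a" for r a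
      by (rule uniq) (simp_all add: gK K subspace_scale g')
    show "norm (g a) \<le> norm a * 1" for a
    proof (cases "g a = 0")
      case False
      have "norm (g a) * norm (g a) = inner a (g a)"
        using g'[OF gK, of a a] by (metis power2_eq_square power2_norm_eq_inner)
      also have "\<dots> \<le> norm a * norm (g a)" by (rule norm_cauchy_schwarz)
      finally show ?thesis using False by simp
    qed simp
  qed
  then have app: "blinfun_apply (Blinfun g) = g" by (rule bounded_linear_Blinfun_apply)
  have gid: "g x = x" if "x \<in> K" for x
    by (rule uniq) (simp_all add: gK that g')
  have "inner (g x) y = inner x (g y)" for x y
    using g'[OF gK, of x y] g'[OF gK, of y x] by (metis inner_commute)
  then have "radj (Blinfun g) = Blinfun g"
    by (intro radj_eqI) (simp add: app)
  then have "isproj (Blinfun g)"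
    unfolding isproj_def by (auto intro!: blinfun_eqI simp: app gid gK)
  then show ?thesis
    by (rule that) (simp_all add: app gK gid)
qed

text \<open>Invariance under \<open>T\<close> gives \<open>P T P = T P\<close>; invariance under the
  adjoint gives, after taking adjoints, \<open>P T P = P T\<close>.\<close>

lemma projection_onto_invariant_commutes:
  assumes P: "isproj P" "\<And>x. blinfun_apply P x \<in> K" "\<And>x. x \<in> K \<Longrightarrow> blinfun_apply P x = x"
    and T: "\<And>x. x \<in> K \<Longrightarrow> blinfun_apply T x \<in> K" "\<And>x. x \<in> K \<Longrightarrow> radj T x \<in> K"
  shows "P o\<^sub>L T = T o\<^sub>L P"
proof -
  have 1: "P o\<^sub>L (T o\<^sub>L P) = T o\<^sub>L P" using P T by (intro blinfun_eqI) simp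
  have 2: "P o\<^sub>L (radj T o\<^sub>L P) = radj T o\<^sub>L P" using P T by (intro blinfun_eqI) simp
  have "radj (P o\<^sub>L (radj T o\<^sub>L P)) = P o\<^sub>L (T o\<^sub>L P)"
    using P(1) by (simp add: isproj_radj blinfun_compose_assoc)
  moreover have "radj (P o\<^sub>L (radj T o\<^sub>L P)) = P o\<^sub>L T"
    unfolding 2 using P(1) by (simp add: isproj_radj)
  ultimately show ?thesis using 1 by simp
qed

section \<open>Positive operators and norm bounds\<close>

definition pos :: "('h::{real_inner,banach} \<Rightarrow>\<^sub>L 'h) \<Rightarrow> bool" where
  "pos T \<longleftrightarrow> radj T = T \<and> (\<forall>x. inner (blinfun_apply T x) x \<ge> 0)"

lemma pos_radj: "pos T \<Longrightarrow> radj T = T"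
  by (simp add: pos_def)

lemma pos_inner: "pos T \<Longrightarrow> inner (blinfun_apply T x) x \<ge> 0"
  by (simp add: pos_def)

lemma pos_id [simp]: "pos id_blinfun"
  by (simp add: pos_def)

lemma pos_add: "pos S \<Longrightarrow> pos T \<Longrightarrow> pos (S + T)"
  by (simp add: pos_def blinfun.bilinear_simps inner_add_left)

lemma pos_scaleR: "pos T \<Longrightarrow> c \<ge> 0 \<Longrightarrow> pos (c *\<^sub>R T)"
  by (simp add: pos_def blinfun.bilinear_simps)

lemma pos_conj: "pos T \<Longrightarrow> pos (radj S o\<^sub>L T o\<^sub>L S)"
  by (auto simp: pos_def blinfun_compose_assoc inner_radj')

lemma pos_adj_compose: "pos (radj S o\<^sub>L S)"
  by (simp add: pos_def inner_radj')

lemma pos_isproj: "isproj P \<Longrightarrow> pos P"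
  by (metis isproj_def pos_adj_compose)

text \<open>Self-adjointness allows polarisation: the mixed values \<open>inner (T y) z\<close> are
  controlled by the diagonal ones through the parallelogram law.\<close>

lemma norm_selfadjoint_le:
  fixes T :: "'h::{real_inner,banach} \<Rightarrow>\<^sub>L 'h"
  assumes T: "radj T = T" and c: "c \<ge> 0" "\<And>x. \<bar>inner (blinfun_apply T x) x\<bar> \<le> c * (norm x)\<^sup>2"
  shows "norm T \<le> c"
proof (rule norm_blinfun_bound[OF c(1)])
  fix x
  have sym: "inner (T y) z = inner (T z) y" for y z
    by (metis T inner_commute inner_radj)
  have pol: "2 * inner (T y) z \<le> c * ((norm y)\<^sup>2 + (norm z)\<^sup>2)" for y z
  proof -
    have "4 * inner (T y) z = inner (T (y + z)) (y + z) - inner (T (y - z)) (y - z)"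
      using sym[of z y]
      by (simp add: blinfun.bilinear_simps inner_add_left inner_add_right inner_diff_left inner_diff_right)
    also have "\<dots> \<le> c * (norm (y + z))\<^sup>2 + c * (norm (y - z))\<^sup>2"
      using c(2)[of "y + z"] c(2)[of "y - z"] by linarith
    also have "\<dots> = 2 * (c * ((norm y)\<^sup>2 + (norm z)\<^sup>2))"
      unfolding power2_norm_eq_inner
      by (simp add: inner_add_left inner_add_right inner_diff_left inner_diff_right
          inner_commute[of z y] algebra_simps)
    finally show ?thesis by simp
  qed
  show "norm (T x) \<le> c * norm x"
  proof (cases "T x = 0 \<or> x = 0")
    case False
    \<comment> \<open>The direction of \<open>T x\<close>, rescaled to the length of
      \<open>x\<close>: the two squares in the polarised bound then agree and no constant is
      lost.\<close>
    define z where "z = (norm x / norm (T x)) *\<^sub>R T x"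
    have nz: "norm z = norm x" using False by (simp add: z_def)
    have "inner (T x) z = norm x / norm (T x) * (norm (T x))\<^sup>2"
      by (simp add: z_def power2_norm_eq_inner)
    also have "\<dots> = norm x * norm (T x)" using False by (simp add: power2_eq_square)
    finally have "2 * (norm x * norm (T x)) \<le> c * (2 * (norm x)\<^sup>2)"
      using pol[of x z] nz by simp
    then have "norm x * norm (T x) \<le> norm x * (c * norm x)"
      by (simp add: power2_eq_square algebra_simps)
    then show ?thesis using False by simp
  qed (use c in auto)
qed

lemma norm_le_1_if_pos:
  assumes "pos T" "pos (id_blinfun - T)"
  shows "norm T \<le> 1"
proof (rule norm_selfadjoint_le)
  show "radj T = T" using assms by (simp add: pos_def)
  show "\<bar>inner (blinfun_apply T x) x\<bar> \<le> 1 * (norm x)\<^sup>2" for x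
    using pos_inner[OF assms(1), of x] pos_inner[OF assms(2), of x]
    by (simp add: blinfun.bilinear_simps inner_diff_left power2_norm_eq_inner)
qed simp

lemma pos_norm_diff:
  assumes "radj T = T" "norm T \<le> c"
  shows "pos (c *\<^sub>R id_blinfun - T)"
  unfolding pos_def
proof (intro conjI allI)
  fix x
  have "inner (T x) x \<le> norm (T x) * norm x" by (rule norm_cauchy_schwarz)
  also have "\<dots> \<le> (c * norm x) * norm x"
    by (intro mult_right_mono order_trans[OF norm_blinfun] assms) auto
  finally show "0 \<le> inner ((c *\<^sub>R id_blinfun - T) x) x"
    by (simp add: blinfun.bilinear_simps inner_diff_left power2_norm_eq_inner[symmetric]
        power2_eq_square)
qed (use assms in simp)

section \<open>Square roots, inverses and spectral projections\<close>

lemma closed_selfadjoint: "closed {T :: 'h::{real_inner,banach} \<Rightarrow>\<^sub>L 'h. radj T = T}"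
  unfolding radj_eq_self_iff
  by (intro closed_Collect_all closed_Collect_eq continuous_intros)

text \<open>If \<open>y\<close> solves this equation, then \<open>(1 - y)\<^sup>2 = 1 - x\<close>. The increments of the iteration are dominated
  by those of the scalar iteration for \<open>x = 1\<close>, which increases and is bounded by \<open>1\<close>.\<close>

lemma sqrt_iteration:
  fixes x :: "'h::banach \<Rightarrow>\<^sub>L 'h"
  assumes C: "closed C" "0 \<in> C" "\<And>y. y \<in> C \<Longrightarrow> (1/2) *\<^sub>R (x + (y o\<^sub>L y)) \<in> C"
    and x: "norm x \<le> 1"
  obtains y where "y \<in> C" "norm y \<le> 1" "y = (1/2) *\<^sub>R (x + (y o\<^sub>L y))"
proof -
  define f :: "('h \<Rightarrow>\<^sub>L 'h) \<Rightarrow> ('h \<Rightarrow>\<^sub>L 'h)" where "f y = (1/2) *\<^sub>R (x + (y o\<^sub>L y))" for y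
  define Y where "Y = rec_nat 0 (\<lambda>_. f)"
  define t :: "nat \<Rightarrow> real" where "t = rec_nat 0 (\<lambda>_ t. (1 + t * t) / 2)"
  have Y: "Y 0 = 0" "Y (Suc n) = f (Y n)" for n by (simp_all add: Y_def)
  have t: "t 0 = 0" "t (Suc n) = (1 + t n * t n) / 2" for n by (simp_all add: t_def)
  have t01: "0 \<le> t n \<and> t n \<le> 1" for n
  proof (induction n)
    case (Suc n)
    then have "t n * t n \<le> 1 * 1" by (intro mult_mono) auto
    then show ?case by (simp add: t)
  qed (simp add: t)
  have tinc: "t n \<le> t (Suc n)" for n
  proof -
    have "0 \<le> (1 - t n) * (1 - t n)" by simp
    then show ?thesis unfolding t by (simp add: algebra_simps)
  qed
  have YC: "Y n \<in> C" for n
    by (induction n) (use C in \<open>auto simp: Y f_def\<close>)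
  have Yt: "norm (Y n) \<le> t n" for n
  proof (induction n)
    case (Suc n)
    have "norm (Y n o\<^sub>L Y n) \<le> t n * t n"
      using Suc t01[of n] by (intro order_trans[OF norm_blinfun_compose] mult_mono) auto
    then have "norm (x + (Y n o\<^sub>L Y n)) \<le> 1 + t n * t n"
      using x norm_triangle_ineq[of x "Y n o\<^sub>L Y n"] by linarith
    then show ?case by (simp add: Y f_def t)
  qed (simp add: Y t)
  have step: "norm (Y (Suc n) - Y n) \<le> t (Suc n) - t n" for n
  proof (induction n)
    case 0
    then show ?case using x by (simp add: Y f_def t)
  next
    case (Suc n)
    let ?D = "Y (Suc n) - Y n" and ?d = "t (Suc n) - t n"
    \<comment> \<open>The difference of two squares, written without commuting \<open>u\<close> and
      \<open>v\<close>.\<close>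
    have "f u - f v = (1/2) *\<^sub>R ((u o\<^sub>L (u - v)) + ((u - v) o\<^sub>L v))" for u v
      unfolding f_def scaleR_diff_right[symmetric] by (simp add: compose_simps)
    from this[of "Y (Suc n)" "Y n"]
    have "Y (Suc (Suc n)) - Y (Suc n) = (1/2) *\<^sub>R ((Y (Suc n) o\<^sub>L ?D) + (?D o\<^sub>L Y n))"
      by (simp only: Y(2))
    moreover have "norm ((Y (Suc n) o\<^sub>L ?D) + (?D o\<^sub>L Y n)) \<le> t (Suc n) * ?d + ?d * t n"
      using Suc Yt[of n] Yt[of "Suc n"] t01[of n] t01[of "Suc n"] tinc[of n]
      by (intro norm_triangle_mono order_trans[OF norm_blinfun_compose] mult_mono) auto
    moreover have "(r * (r - q) + (r - q) * q) / 2 = (1 + r * r) / 2 - (1 + q * q) / 2" for q r :: real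
      by (simp add: field_simps)
    from this[of "t (Suc n)" "t n"]
    have "(t (Suc n) * ?d + ?d * t n) / 2 = t (Suc (Suc n)) - t (Suc n)"
      unfolding t(2)[symmetric] .
    ultimately show ?case by simp
  qed
  obtain L where "t \<longlonglongrightarrow> L"
    using incseq_convergent[of t 1] incseq_SucI[of t] tinc t01 by blast
  then have "summable (\<lambda>n. t (Suc n) - t n)"
    by (rule telescope_summable)
  then have "summable (\<lambda>n. Y (Suc n) - Y n)"
    by (rule summable_comparison_test') (rule step)
  then have "convergent (\<lambda>n. \<Sum>k<n. Y (Suc k) - Y k)"
    by (simp add: summable_iff_convergent)
  then obtain y where y: "Y \<longlonglongrightarrow> y"
    using Y(1) unfolding sum_lessThan_telescope convergent_def by auto
  have "y \<in> C" using C(1) YC y by (metis closed_sequentially)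
  moreover have "norm y \<le> 1"
    by (rule LIMSEQ_le_const2[OF tendsto_norm[OF y]]) (meson Yt order_trans t01)
  moreover have "(\<lambda>n. Y (Suc n)) \<longlonglongrightarrow> f y"
    unfolding Y f_def by (intro tendsto_intros y)
  then have "y = f y" using LIMSEQ_Suc[OF y] LIMSEQ_unique by blast
  ultimately show ?thesis using that by (simp add: f_def)
qed

text \<open>After division by \<open>c\<close>, the operator \<open>x = 1 - a / c\<close> is a
  contraction, and the solution \<open>y\<close> of the iteration satisfies
  \<open>(1 - y)(1 - y) = a / c\<close>. Running the iteration inside a closed set makes the root
  self-adjoint and puts it in the bicommutant.\<close>

lemma pos_sqrt:
  fixes a :: "'h::{real_inner,banach} \<Rightarrow>\<^sub>L 'h"
  assumes a: "pos a"
  obtains s where "pos s" "s o\<^sub>L s = a" "s \<in> rcomm (rcomm {a})"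
proof -
  \<comment> \<open>The summand \<open>1\<close> keeps \<open>c\<close> positive when
    \<open>a = 0\<close>.\<close>
  define c where "c = norm a + 1"
  have c: "c > 0" by (simp add: c_def add_nonneg_pos)
  define x where "x = id_blinfun - (1/c) *\<^sub>R a"
  have "x = (1/c) *\<^sub>R (c *\<^sub>R id_blinfun - a)"
    using c by (simp add: x_def algebra_simps)
  then have "pos x"
    using c a by (auto intro!: pos_scaleR pos_norm_diff simp: pos_radj c_def)
  moreover have "pos (id_blinfun - x)" using a c by (simp add: x_def pos_scaleR)
  ultimately have nx: "norm x \<le> 1" by (rule norm_le_1_if_pos)
  define C where "C = {T. radj T = T} \<inter> rcomm (rcomm {a})"
  have a'': "a \<in> rcomm (rcomm {a})" using subset_rcomm_rcomm by blast
  have xC: "x \<in> C"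
    using a'' by (auto simp: C_def pos_radj[OF a] x_def intro!: rcomm_intros)
  obtain y where y: "y \<in> C" "norm y \<le> 1" "y = (1/2) *\<^sub>R (x + (y o\<^sub>L y))"
  proof (rule sqrt_iteration[of C x])
    show "closed C" unfolding C_def by (intro closed_Int closed_selfadjoint closed_rcomm)
    show "(1/2) *\<^sub>R (x + (y o\<^sub>L y)) \<in> C" if "y \<in> C" for y
      using that xC by (auto simp: C_def intro!: rcomm_intros)
  qed (use nx in \<open>auto simp: C_def\<close>)
  have yy: "y o\<^sub>L y = 2 *\<^sub>R y - x"
    by (subst (3) y(3)) simp
  define s where "s = sqrt c *\<^sub>R (id_blinfun - y)"
  have "pos (1 *\<^sub>R id_blinfun - y)" using y by (intro pos_norm_diff) (auto simp: C_def)
  then have "pos s" using c by (simp add: s_def pos_scaleR)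
  moreover have "s o\<^sub>L s = c *\<^sub>R (id_blinfun - x)"
    using c by (simp add: s_def compose_simps yy scaleR_2 algebra_simps)
  then have "s o\<^sub>L s = a" using c by (simp add: x_def)
  moreover have "s \<in> rcomm (rcomm {a})" using y by (auto simp: s_def C_def intro!: rcomm_intros)
  ultimately show ?thesis by (rule that)
qed

text \<open>The Neumann series in the form of a fixed point: \<open>k = 1 + x k\<close> with
  \<open>x = 1 - a / c\<close> says that \<open>a k / c = 1\<close>. The contraction acts on the
  bicommutant, which is complete because it is closed.\<close>

lemma pos_inverse:
  fixes a :: "'h::{real_inner,banach} \<Rightarrow>\<^sub>L 'h"
  assumes a: "pos a" and \<delta>: "\<delta> > 0" "pos (a - \<delta> *\<^sub>R id_blinfun)"
  obtains u where "pos u" "a o\<^sub>L u = id_blinfun" "u \<in> rcomm (rcomm {a})"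
proof -
  \<comment> \<open>Exceeding \<open>norm a\<close> bounds \<open>a\<close> above by
    \<open>c\<close>; exceeding \<open>\<delta>\<close> puts the contraction constant
    \<open>1 - \<delta> / c\<close> between \<open>0\<close> and \<open>1\<close>.\<close>
  define c where "c = norm a + \<delta> + 1"
  have c: "c > 0" "c > \<delta>" using \<delta> by (simp_all add: c_def add_nonneg_pos add_pos_pos)
  define x where "x = id_blinfun - (1/c) *\<^sub>R a"
  have upper: "pos (c *\<^sub>R id_blinfun - a)"
    using a \<delta> by (intro pos_norm_diff) (auto simp: pos_radj c_def)
  have nx: "norm x \<le> 1 - \<delta> / c"
  proof (rule norm_selfadjoint_le)
    fix v
    have "inner (a v) v \<le> c * (norm v)\<^sup>2" "\<delta> * (norm v)\<^sup>2 \<le> inner (a v) v"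
      using pos_inner[OF upper, of v] pos_inner[OF \<delta>(2), of v]
      by (simp_all add: blinfun.bilinear_simps inner_diff_left power2_norm_eq_inner)
    then have "inner (a v) v / c \<le> (norm v)\<^sup>2" "\<delta> * (norm v)\<^sup>2 / c \<le> inner (a v) v / c"
      using c by (simp_all add: field_simps divide_right_mono)
    moreover have "inner (x v) v = (norm v)\<^sup>2 - inner (a v) v / c"
      by (simp add: x_def blinfun.bilinear_simps inner_diff_left power2_norm_eq_inner)
    moreover have "(1 - \<delta> / c) * (norm v)\<^sup>2 = (norm v)\<^sup>2 - \<delta> * (norm v)\<^sup>2 / c"
      by (simp add: algebra_simps)
    ultimately show "\<bar>inner (x v) v\<bar> \<le> (1 - \<delta> / c) * (norm v)\<^sup>2" by linarith
  qed (use a c in \<open>auto simp: x_def pos_radj\<close>)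
  have a'': "a \<in> rcomm (rcomm {a})" using subset_rcomm_rcomm by blast
  have "\<exists>!k\<in>rcomm (rcomm {a}). id_blinfun + (x o\<^sub>L k) = k"
  proof (rule Banach_fix[where c = "1 - \<delta> / c"])
    show "complete (rcomm (rcomm {a}))"
      by (simp add: closed_rcomm complete_eq_closed)
    show "(\<lambda>k. id_blinfun + (x o\<^sub>L k)) ` rcomm (rcomm {a}) \<subseteq> rcomm (rcomm {a})"
      using a'' by (auto simp: x_def intro!: rcomm_intros)
    show "dist (id_blinfun + (x o\<^sub>L k)) (id_blinfun + (x o\<^sub>L l)) \<le> (1 - \<delta> / c) * dist k l" for k l
    proof -
      have "norm (x o\<^sub>L (k - l)) \<le> (1 - \<delta> / c) * norm (k - l)"
        using nx by (intro order_trans[OF norm_blinfun_compose] mult_right_mono) auto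
      then show ?thesis by (simp add: dist_norm compose_simps)
    qed
    show "rcomm (rcomm {a}) \<noteq> {}" using a'' by blast
  qed (use \<delta> c in auto)
  then obtain k where k: "k \<in> rcomm (rcomm {a})" "id_blinfun + (x o\<^sub>L k) = k" by blast
  define u where "u = (1/c) *\<^sub>R k"
  have u'': "u \<in> rcomm (rcomm {a})" using k by (simp add: u_def rcomm_scaleR)
  have au: "a o\<^sub>L u = id_blinfun"
    using k(2) by (simp add: u_def x_def compose_simps)
  have ra: "radj a = a" using a by (rule pos_radj)
  have "radj (a o\<^sub>L u) = id_blinfun" by (simp only: au radj_id)
  then have "radj u o\<^sub>L a = id_blinfun" by (simp add: ra)
  then have "radj u = u" by (metis au blinfun_compose_assoc blinfun_compose_id)
  moreover have "inner (u v) v \<ge> 0" for v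
    using pos_inner[OF a, of "u v"] applyI[OF au, of v] by (simp add: inner_commute)
  ultimately have "pos u" by (simp add: pos_def)
  then show ?thesis using au u'' by (rule that)
qed

text \<open>With \<open>s\<close> the absolute value of \<open>b\<close>, the operators
  \<open>g\<close> and \<open>h\<close> are twice the positive and the negative part of
  \<open>b\<close>. The complement \<open>p\<close> of \<open>q\<close> projects onto the kernel of
  \<open>g\<close>, which contains the range of \<open>h\<close> since \<open>g h = 0\<close>; so
  \<open>b\<close> agrees with \<open>s\<close> under \<open>q\<close> and with \<open>- s\<close>
  under \<open>p\<close>. That kernel is invariant under everything commuting with \<open>b\<close>,
  which places \<open>q\<close> in the bicommutant.\<close>

lemma spectral_projection:
  fixes b :: "'h::{real_inner,banach} \<Rightarrow>\<^sub>L 'h"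
  assumes b: "radj b = b"
  obtains q where "isproj q" "q \<in> rcomm (rcomm {b})" "pos (b o\<^sub>L q)"
    "pos (- (b o\<^sub>L (id_blinfun - q)))"
proof -
  obtain s where s: "pos s" "s o\<^sub>L s = b o\<^sub>L b" "s \<in> rcomm (rcomm {b o\<^sub>L b})"
    using pos_sqrt[of "b o\<^sub>L b"] pos_adj_compose[of b] b by metis
  have b'': "b \<in> rcomm (rcomm {b})" using subset_rcomm_rcomm by blast
  have "b o\<^sub>L b \<in> rcomm (rcomm {b})" using b'' by (intro rcomm_intros)
  then have "rcomm (rcomm {b o\<^sub>L b}) \<subseteq> rcomm (rcomm {b})"
    by (metis bot.extremum insert_subset rcomm_antimono rcomm_rcomm_rcomm)
  then have s'': "s \<in> rcomm (rcomm {b})" using s by blast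
  have sb: "s o\<^sub>L b = b o\<^sub>L s"
    using rcommD[OF s''] by (metis rcommI singletonD)
  define g h where "g = s + b" and "h = s - b"
  have gh: "g o\<^sub>L h = 0" "h o\<^sub>L g = 0"
    by (simp_all add: g_def h_def compose_simps s sb)
  have rh: "radj h = h" and rg: "radj g = g" using b s by (simp_all add: h_def g_def pos_radj)
  define K where "K = {v. g v = 0}"
  have "subspace K" by (auto simp: K_def subspace_def blinfun.bilinear_simps)
  moreover have "closed K" unfolding K_def by (intro closed_Collect_eq continuous_intros)
  ultimately obtain p where p: "isproj p" "\<And>v. p v \<in> K" "\<And>v. v \<in> K \<Longrightarrow> p v = v"
    using exists_projection_onto by blast
  have p'': "p \<in> rcomm (rcomm {b})"
  proof (rule rcommI)
    fix T assume T: "T \<in> rcomm {b}"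
    have T': "radj T \<in> rcomm {b}" using T b by (intro rcomm_radj) auto
    have "U v \<in> K" if "U \<in> rcomm {b}" "v \<in> K" for U v
    proof -
      have "g \<in> rcomm (rcomm {b})" using s'' b'' by (simp add: g_def rcomm_add)
      then have "U o\<^sub>L g = g o\<^sub>L U" using that(1) by (rule rcommD)
      then have "g (U v) = U (g v)" by (metis blinfun_apply_blinfun_compose)
      then show ?thesis using that by (simp add: K_def blinfun.bilinear_simps)
    qed
    then show "T o\<^sub>L p = p o\<^sub>L T"
      using projection_onto_invariant_commutes[OF p, of T] T T' by simp
  qed
  define q where "q = id_blinfun - p"
  have q: "isproj q" using p by (simp add: q_def isproj_compl)
  have q'': "q \<in> rcomm (rcomm {b})" using p'' by (simp add: q_def rcomm_diff)
  have gp: "g o\<^sub>L p = 0" using p by (intro blinfun_eqI) (simp add: K_def)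
  have "h v \<in> K" for v using applyI[OF gh(1)] by (simp add: K_def)
  then have ph: "p o\<^sub>L h = h" using p by (intro blinfun_eqI) simp
  have hp: "h o\<^sub>L p = h"
    using arg_cong[OF ph, of radj] p rh by (simp add: isproj_radj)
  have pg: "p o\<^sub>L g = 0"
    using arg_cong[OF gp, of radj] p rg by (simp add: isproj_radj)
  have bsg: "b = (1/2) *\<^sub>R (g - h)" "s = (1/2) *\<^sub>R (g + h)"
    by (simp_all add: g_def h_def scaleR_2[symmetric])
  have "b o\<^sub>L q = radj q o\<^sub>L s o\<^sub>L q"
    using q unfolding bsg by (simp add: isproj_radj) (simp add: q_def compose_simps gp hp ph pg scaleR_diff_right)
  moreover have "- (b o\<^sub>L (id_blinfun - q)) = radj p o\<^sub>L s o\<^sub>L p"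
    using p unfolding bsg by (simp add: isproj_radj) (simp add: q_def compose_simps gp hp ph pg scaleR_diff_right)
  ultimately show ?thesis
    using that[of q] q pos_conj[OF s(1), of q] pos_conj[OF s(1), of p]
    by (simp add: q'')
qed

section \<open>Partial isometries\<close>

definition pisom :: "('h::{real_inner,banach} \<Rightarrow>\<^sub>L 'h) \<Rightarrow> bool" where
  "pisom V \<longleftrightarrow> V o\<^sub>L radj V o\<^sub>L V = V"

lemma pisom_0 [simp]: "pisom 0"
  by (simp add: pisom_def)

lemma pisom_radj: "pisom V \<Longrightarrow> pisom (radj V)"
  by (metis pisom_def blinfun_compose_assoc radj_compose radj_radj)

lemma isproj_pisom: "isproj P \<Longrightarrow> pisom P"
  by (simp add: isproj_def pisom_def)

lemma pisom_initial: "pisom V \<Longrightarrow> isproj (radj V o\<^sub>L V)"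
  by (simp add: isproj_def pisom_def blinfun_compose_assoc)

lemma pisom_final: "pisom V \<Longrightarrow> isproj (V o\<^sub>L radj V)"
  using pisom_initial[OF pisom_radj] by simp

text \<open>The defect \<open>D\<close> of the defining equation satisfies
  \<open>radj D o\<^sub>L D = 0\<close>, because \<open>radj V o\<^sub>L V\<close> is
  idempotent.\<close>

lemma pisom_if_initial:
  assumes "isproj (radj V o\<^sub>L V)"
  shows "pisom V"
proof -
  define D where "D = (V o\<^sub>L radj V o\<^sub>L V) - V"
  have eq: "radj V o\<^sub>L (V o\<^sub>L (radj V o\<^sub>L V)) = radj V o\<^sub>L V"
    using assms by (simp add: isproj_def blinfun_compose_assoc)
  have eq': "radj V o\<^sub>L (V o\<^sub>L (radj V o\<^sub>L (V o\<^sub>L (radj V o\<^sub>L V)))) = radj V o\<^sub>L V"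
    using eq by (metis blinfun_compose_assoc)
  have "radj D o\<^sub>L D = 0"
    by (simp add: D_def compose_simps blinfun_compose_assoc eq eq')
  then have "D = 0" by (simp only: adj_compose_eq_0_iff)
  then show ?thesis by (simp add: D_def pisom_def)
qed

lemma pisom_norm_le:
  assumes "pisom V"
  shows "norm (blinfun_apply V x) \<le> norm x"
proof -
  let ?p = "radj V o\<^sub>L V"
  have p: "isproj ?p" using assms by (rule pisom_initial)
  have "(norm (V x))\<^sup>2 = inner (?p x) x"
    by (simp add: inner_radj' power2_norm_eq_inner)
  moreover have "0 \<le> inner ((id_blinfun - ?p) x) x"
    using p by (intro pos_inner pos_isproj isproj_compl)
  ultimately have "(norm (V x))\<^sup>2 \<le> (norm x)\<^sup>2"
    by (simp add: blinfun.bilinear_simps inner_diff_left power2_norm_eq_inner)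
  then show ?thesis by simp
qed

text \<open>Elements of the commutant are continuous, so commuting with them survives pointwise
  limits. As \<open>M\<close> and \<open>A\<close> equal their bicommutants, they contain such
  limits.\<close>

lemma strong_limit_in_bicommutant:
  assumes "\<And>n. V n \<in> rcomm (rcomm S)" "\<And>x. (\<lambda>n. blinfun_apply (V n) x) \<longlonglongrightarrow> blinfun_apply v x"
  shows "v \<in> rcomm (rcomm S)"
proof (rule rcommI, rule blinfun_eqI)
  fix U x assume U: "U \<in> rcomm S"
  have "(\<lambda>n. U (V n x)) \<longlonglongrightarrow> U (v x)"
    by (intro tendsto_intros assms)
  moreover have "U (V n x) = V n (U x)" for n
    using rcommD[OF assms(1) U, of n] by (metis blinfun_apply_blinfun_compose)
  ultimately show "(U o\<^sub>L v) x = (v o\<^sub>L U) x"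
    using assms(2)[of "U x"] LIMSEQ_unique by fastforce
qed

text \<open>The two orthogonality conditions separate the final and the initial space of the
  increment from those of \<open>V n\<close>. Being symmetric, they make the adjoints a chain as
  well. Increasing sequences of projections are treated as a special case.\<close>

locale pisom_chain =
  fixes V W :: "nat \<Rightarrow> ('h::{real_inner,banach} \<Rightarrow>\<^sub>L 'h)"
  assumes pisom: "pisom (V n)"
    and Suc: "V (Suc n) = V n + W n"
    and orth: "radj (V n) o\<^sub>L W n = 0" "V n o\<^sub>L radj (W n) = 0"
begin

lemma radj_chain: "pisom_chain (\<lambda>n. radj (V n)) (\<lambda>n. radj (W n))"
proof
  show "pisom (radj (V n))" for n by (rule pisom_radj[OF pisom])
qed (simp_all add: Suc orth)

text \<open>A later increment is orthogonal to \<open>V m\<close>, hence also to the earlier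
  \<open>V n\<close>, which by induction is \<open>V m\<close> cut down by a projection.\<close>

lemma extends:
  assumes "n \<le> m"
  shows "V m o\<^sub>L (radj (V n) o\<^sub>L V n) = V n \<and> radj (V m) o\<^sub>L (V n o\<^sub>L radj (V n)) = radj (V n)"
  using assms
proof (induction m rule: dec_induct)
  case base
  show ?case using pisom[of n] pisom_radj[OF pisom[of n]] by (simp add: pisom_def blinfun_compose_assoc)
next
  case (step m)
  have o: "W m o\<^sub>L radj (V m) = 0" "radj (W m) o\<^sub>L V m = 0"
    using arg_cong[OF orth(1)[of m], of radj] arg_cong[OF orth(2)[of m], of radj] by simp_all
  have "W m o\<^sub>L radj (V n) = 0"
    using step.IH o(1) by (metis blinfun_compose_assoc blinfun_compose_zero(1))
  then have 1: "W m o\<^sub>L (radj (V n) o\<^sub>L V n) = 0"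
    by (metis blinfun_compose_assoc blinfun_compose_zero(1))
  have "radj (W m) o\<^sub>L V n = 0"
    using step.IH o(2) by (metis blinfun_compose_assoc blinfun_compose_zero(1))
  then have 2: "radj (W m) o\<^sub>L (V n o\<^sub>L radj (V n)) = 0"
    by (metis blinfun_compose_assoc blinfun_compose_zero(1))
  show ?case using step.IH 1 2 by (simp add: Suc compose_simps)
qed

lemma radj_compose_extends:
  assumes "n \<le> m"
  shows "radj (V m) o\<^sub>L V n = radj (V n) o\<^sub>L V n"
proof -
  have "V n = (V n o\<^sub>L radj (V n)) o\<^sub>L V n" using pisom[of n] by (simp add: pisom_def)
  then show ?thesis using extends[OF assms] by (metis blinfun_compose_assoc)
qed

text \<open>By Pythagoras the squared distance of \<open>V m x\<close> and \<open>V n x\<close> is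
  the difference of their squared norms; these increase and are bounded by the squared norm of
  \<open>x\<close>.\<close>

lemma strong_limit_exists: "\<exists>v. \<forall>x. (\<lambda>n. blinfun_apply (V n) x) \<longlonglongrightarrow> blinfun_apply v x"
proof -
  have diff: "(norm (V m x - V n x))\<^sup>2 = (norm (V m x))\<^sup>2 - (norm (V n x))\<^sup>2" if "n \<le> m" for m n x
  proof -
    have "inner (V m x) (V n x) = inner x ((radj (V m) o\<^sub>L V n) x)"
      by (simp add: inner_radj)
    also have "\<dots> = inner (V n x) (V n x)"
      unfolding radj_compose_extends[OF that] by (simp add: inner_radj)
    finally show ?thesis
      unfolding power2_norm_eq_inner
      by (simp add: inner_diff_left inner_diff_right inner_commute[of "V n x" "V m x"])
  qed
  have Cauchy: "Cauchy (\<lambda>n. V n x)" for x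
  proof -
    define s where "s n = (norm (V n x))\<^sup>2" for n
    have "incseq s"
      by (intro incseq_SucI) (metis diff le_add2 plus_1_eq_Suc s_def diff_ge_0_iff_ge zero_le_power2)
    moreover have "s n \<le> (norm x)\<^sup>2" for n
      using pisom_norm_le[OF pisom] by (simp add: s_def power_mono)
    ultimately obtain L where "s \<longlonglongrightarrow> L" using incseq_convergent[of s "(norm x)\<^sup>2"] by blast
    then have "Cauchy s" by (rule LIMSEQ_imp_Cauchy)
    show ?thesis
    proof (rule CauchyI')
      fix e :: real assume e: "e > 0"
      then obtain N where N: "\<And>m n. m \<ge> N \<Longrightarrow> n \<ge> N \<Longrightarrow> norm (s m - s n) < e\<^sup>2"
        using CauchyD[OF \<open>Cauchy s\<close>, of "e\<^sup>2"] by auto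
      have "dist (V m x) (V n x) < e" if "m \<ge> N" "n > m" for m n
      proof -
        have "(norm (V n x - V m x))\<^sup>2 < e\<^sup>2"
          using N[of n m] diff[of m n x] that by (simp add: s_def)
        then show ?thesis using e by (simp add: dist_norm norm_minus_commute power_less_imp_less_base)
      qed
      then show "\<exists>M. \<forall>m\<ge>M. \<forall>n>m. dist (V m x) (V n x) < e" by blast
    qed
  qed
  define g where "g x = lim (\<lambda>n. V n x)" for x
  have g: "(\<lambda>n. V n x) \<longlonglongrightarrow> g x" for x
    unfolding g_def using Cauchy[of x] by (simp add: Cauchy_convergent convergent_LIMSEQ_iff[symmetric])
  have "bounded_linear g"
  proof (rule bounded_linear_intro[where K = 1])
    show "g (a + b) = g a + g b" for a b
      using tendsto_add[OF g[of a] g[of b]] g[of "a + b"]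
      by (simp add: blinfun.bilinear_simps LIMSEQ_unique)
    show "g (r *\<^sub>R a) = r *\<^sub>R g a" for r a
      using tendsto_scaleR[OF tendsto_const[of r] g[of a]] g[of "r *\<^sub>R a"]
      by (simp add: blinfun.bilinear_simps LIMSEQ_unique)
    show "norm (g a) \<le> norm a * 1" for a
      using LIMSEQ_le_const2[OF tendsto_norm[OF g[of a]], of "norm a"] pisom_norm_le[OF pisom] by auto
  qed
  then have "\<forall>x. (\<lambda>n. V n x) \<longlonglongrightarrow> Blinfun g x"
    using g by (simp add: bounded_linear_Blinfun_apply)
  then show ?thesis by blast
qed

text \<open>Taking adjoints is not strongly continuous in general. Here the adjoints form a chain of
  their own, so they converge too, and their limit is \<open>radj v\<close>; this is what makes
  \<open>v\<close> a partial isometry.\<close>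

lemma strong_limit:
  obtains v where "\<And>x. (\<lambda>n. blinfun_apply (V n) x) \<longlonglongrightarrow> blinfun_apply v x" "pisom v"
    "\<And>n. V n o\<^sub>L (radj v o\<^sub>L v) = V n" "\<And>n. (v o\<^sub>L radj v) o\<^sub>L V n = V n"
    "\<And>n. (V n o\<^sub>L radj (V n)) o\<^sub>L v = V n"
proof -
  obtain v where v: "\<And>x. (\<lambda>n. V n x) \<longlonglongrightarrow> blinfun_apply v x" using strong_limit_exists by blast
  obtain v' where v': "\<And>x. (\<lambda>n. radj (V n) x) \<longlonglongrightarrow> blinfun_apply v' x"
    using pisom_chain.strong_limit_exists[OF radj_chain] by blast
  have "radj v = v'"
  proof (rule radj_eqI)
    fix x y
    have "(\<lambda>n. inner (V n x) y) \<longlonglongrightarrow> inner (v x) y" "(\<lambda>n. inner x (radj (V n) y)) \<longlonglongrightarrow> inner x (v' y)"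
      by (intro tendsto_intros v v')+
    then show "inner (v x) y = inner x (v' y)"
      by (simp add: inner_radj LIMSEQ_unique)
  qed
  then have v': "\<And>x. (\<lambda>n. radj (V n) x) \<longlonglongrightarrow> radj v x" using v' by simp
  have lim: "u o\<^sub>L T = U" if "\<And>x. (\<lambda>n. blinfun_apply (X n) x) \<longlonglongrightarrow> blinfun_apply u x" "\<And>m. m \<ge> n \<Longrightarrow> X m o\<^sub>L T = U"
    for X and u T U :: "'h \<Rightarrow>\<^sub>L 'h" and n :: nat
  proof (rule blinfun_eqI)
    fix x
    have "eventually (\<lambda>m. X m (T x) = U x) sequentially"
      using that(2) unfolding eventually_sequentially by (metis blinfun_apply_blinfun_compose)
    then have "(\<lambda>m. X m (T x)) \<longlonglongrightarrow> U x" by (rule tendsto_eventually)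
    then show "(u o\<^sub>L T) x = U x" using that(1)[of "T x"] LIMSEQ_unique by fastforce
  qed
  have vp: "v o\<^sub>L (radj (V n) o\<^sub>L V n) = V n" for n
    by (rule lim[where X = V and n = n]) (use v extends in auto)
  have v'r: "radj v o\<^sub>L (V n o\<^sub>L radj (V n)) = radj (V n)" for n
    by (rule lim[where X = "\<lambda>m. radj (V m)" and n = n]) (use v' extends in auto)
  have rv: "(V n o\<^sub>L radj (V n)) o\<^sub>L v = V n" for n
    using arg_cong[OF v'r[of n], of radj] by simp
  have V'v: "radj (V n) o\<^sub>L v = radj (V n) o\<^sub>L V n" for n
  proof -
    have "radj (V n) = radj (V n) o\<^sub>L (V n o\<^sub>L radj (V n))"
      using pisom_radj[OF pisom[of n]] by (simp add: pisom_def blinfun_compose_assoc)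
    then show ?thesis using rv by (metis blinfun_compose_assoc)
  qed
  have pv: "pisom v"
    unfolding pisom_def
  proof (rule blinfun_eqI)
    fix x
    have "(\<lambda>n. v (radj (V n) (v x))) \<longlonglongrightarrow> v (radj v (v x))" by (intro tendsto_intros v')
    moreover have "v (radj (V n) (v x)) = V n x" for n
      using vp[of n] V'v[of n] by (metis blinfun_apply_blinfun_compose)
    ultimately show "(v o\<^sub>L radj v o\<^sub>L v) x = v x"
      using v[of x] LIMSEQ_unique by fastforce
  qed
  have 1: "V n o\<^sub>L (radj v o\<^sub>L v) = V n" for n
    using rv[of n] pv by (metis blinfun_compose_assoc pisom_def)
  have 2: "(v o\<^sub>L radj v) o\<^sub>L V n = V n" for n
    using vp[of n] pv by (metis blinfun_compose_assoc pisom_def)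
  show ?thesis by (rule that) (fact v pv 1 2 rv)+
qed

end

text \<open>This replaces the polar decomposition: with \<open>h = x\<^sup>* x\<close> and a spectral projection \<open>q\<close> of \<open>h\<close> on
  which \<open>h\<close> is bounded below, \<open>x h\<^sup>-\<^sup>1\<^sup>/\<^sup>2 q\<close> is a partial isometry.\<close>

lemma exists_pisom:
  fixes x :: "'h::{real_inner,banach} \<Rightarrow>\<^sub>L 'h"
  assumes x: "x \<noteq> 0"
  obtains k where "k \<in> rcomm (rcomm {radj x o\<^sub>L x})" "pisom (x o\<^sub>L k)" "x o\<^sub>L k \<noteq> 0"
proof -
  define h where "h = radj x o\<^sub>L x"
  \<comment> \<open>Any positive number below \<open>norm h\<close> would make the spectral
    projection of \<open>h - \<delta>\<close> nonzero.\<close>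
  define \<delta> where "\<delta> = norm h / 2"
  have h: "pos h" "radj h = h" by (simp_all add: h_def pos_adj_compose)
  have "h \<noteq> 0" using x by (simp add: h_def adj_compose_eq_0_iff)
  then have \<delta>: "\<delta> > 0" by (simp add: \<delta>_def)
  have h'': "h \<in> rcomm (rcomm {h})" using subset_rcomm_rcomm by blast
  have sub: "rcomm (rcomm {T}) \<subseteq> rcomm (rcomm {h})" if "T \<in> rcomm (rcomm {h})" for T
    using that by (metis bot.extremum insert_subset rcomm_antimono rcomm_rcomm_rcomm)
  have comm: "S o\<^sub>L T = T o\<^sub>L S" if "S \<in> rcomm (rcomm {h})" "T \<in> rcomm (rcomm {h})" for S T
  proof -
    have "rcomm (rcomm {h}) \<subseteq> rcomm {h}" by (intro rcomm_antimono) (auto simp: rcomm_def)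
    then show ?thesis using that rcommD by blast
  qed
  define b where "b = h - \<delta> *\<^sub>R id_blinfun"
  have b'': "b \<in> rcomm (rcomm {h})" using h'' unfolding b_def by (intro rcomm_intros)
  obtain q where q: "isproj q" "q \<in> rcomm (rcomm {b})" "pos (b o\<^sub>L q)" "pos (- (b o\<^sub>L (id_blinfun - q)))"
    using spectral_projection[of b] h by (auto simp: b_def)
  have q'': "q \<in> rcomm (rcomm {h})" using q(2) sub[OF b''] by blast
  have "q \<noteq> 0"
  proof
    assume "q = 0"
    then have "pos (\<delta> *\<^sub>R id_blinfun - h)" using q(4) by (simp add: b_def)
    then have "inner (h v) v \<le> \<delta> * (norm v)\<^sup>2" for v
      using pos_inner by (fastforce simp: blinfun.bilinear_simps inner_diff_left power2_norm_eq_inner)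
    then have "norm h \<le> \<delta>" using h \<delta> by (intro norm_selfadjoint_le) (auto simp: pos_inner)
    then show False using \<delta> by (simp add: \<delta>_def)
  qed
  \<comment> \<open>Equal to \<open>h\<close> on the range of \<open>q\<close> and to
    \<open>\<delta>\<close> on the complement: bounded below everywhere, hence invertible, with
    \<open>g q = h q\<close>.\<close>
  define g where "g = (h o\<^sub>L q) + \<delta> *\<^sub>R (id_blinfun - q)"
  have g'': "g \<in> rcomm (rcomm {h})" using h'' q'' unfolding g_def by (intro rcomm_intros)
  have "g - \<delta> *\<^sub>R id_blinfun = b o\<^sub>L q"
    by (simp add: g_def b_def compose_simps algebra_simps)
  then have g\<delta>: "pos (g - \<delta> *\<^sub>R id_blinfun)" using q by simp
  then have "pos (g - \<delta> *\<^sub>R id_blinfun + \<delta> *\<^sub>R id_blinfun)" using \<delta> by (intro pos_add pos_scaleR) auto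
  then have "pos g" by simp
  then obtain u where u: "pos u" "g o\<^sub>L u = id_blinfun" "u \<in> rcomm (rcomm {g})"
    using pos_inverse[OF _ \<delta> g\<delta>] by blast
  have u'': "u \<in> rcomm (rcomm {h})" using u(3) sub[OF g''] by blast
  obtain s where s: "pos s" "s o\<^sub>L s = u" "s \<in> rcomm (rcomm {u})"
    using pos_sqrt[OF u(1)] by blast
  have s'': "s \<in> rcomm (rcomm {h})" using s(3) sub[OF u''] by blast
  have gq: "g o\<^sub>L q = h o\<^sub>L q"
    using isproj_idem[OF q(1)] by (simp add: g_def compose_simps blinfun_compose_assoc)
  let ?k = "s o\<^sub>L q"
  have "radj (x o\<^sub>L ?k) o\<^sub>L (x o\<^sub>L ?k) = q o\<^sub>L (s o\<^sub>L (h o\<^sub>L (s o\<^sub>L q)))"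
    using q s by (simp add: isproj_radj pos_radj h_def blinfun_compose_assoc)
  also have "\<dots> = s o\<^sub>L (s o\<^sub>L (h o\<^sub>L q))"
    using applyI[OF comm[OF q'' s'']] applyI[OF comm[OF q'' h'']] applyI[OF comm[OF h'' s'']]
      applyI[OF isproj_idem[OF q(1)]]
    by (intro blinfun_eqI) simp
  also have "\<dots> = q"
    using applyI[OF s(2)] applyI[OF gq[symmetric]] applyI[OF u(2)] applyI[OF comm[OF u'' g'']]
    by (intro blinfun_eqI) simp
  finally have wq: "radj (x o\<^sub>L ?k) o\<^sub>L (x o\<^sub>L ?k) = q" .
  show ?thesis
  proof (rule that)
    show "?k \<in> rcomm (rcomm {radj x o\<^sub>L x})" using s'' q'' by (simp add: h_def rcomm_compose)
    show "pisom (x o\<^sub>L ?k)" using wq q(1) by (simp add: pisom_if_initial)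
    show "x o\<^sub>L ?k \<noteq> 0" using wq \<open>q \<noteq> 0\<close> by auto
  qed
qed

section \<open>A masa in a finite factor\<close>

text \<open>\<open>J\<close> is multiplication by the imaginary unit, and \<open>t\<close> is the real part of the trace.\<close>

locale masa_in_factor =
  fixes M A :: "('h::{real_inner,banach} \<Rightarrow>\<^sub>L 'h) set"
    and J :: "'h \<Rightarrow>\<^sub>L 'h"
    and t :: "('h \<Rightarrow>\<^sub>L 'h) \<Rightarrow> real"
  assumes M_bicomm: "rcomm (rcomm M) = M"
    and M_radj: "T \<in> M \<Longrightarrow> radj T \<in> M"
    and A_sub: "A \<subseteq> M"
    and A_bicomm: "rcomm (rcomm A) = A"
    and A_radj: "T \<in> A \<Longrightarrow> radj T \<in> A"
    and A_comm: "S \<in> A \<Longrightarrow> T \<in> A \<Longrightarrow> S o\<^sub>L T = T o\<^sub>L S"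
    and A_max: "x \<in> M \<Longrightarrow> radj x = x \<or> radj x = - x \<Longrightarrow> (\<And>b. b \<in> A \<Longrightarrow> b o\<^sub>L x = x o\<^sub>L b) \<Longrightarrow> x \<in> A"
    and J: "J \<in> A" "radj J = - J" "J o\<^sub>L J = - id_blinfun"
    and J_comm: "T \<in> M \<Longrightarrow> J o\<^sub>L T = T o\<^sub>L J"
    and no_abelian: "isproj e \<Longrightarrow> e \<in> M \<Longrightarrow> e \<noteq> 0 \<Longrightarrow>
      \<exists>x\<in>M. \<exists>y\<in>M. (e o\<^sub>L x o\<^sub>L e) o\<^sub>L (e o\<^sub>L y o\<^sub>L e) \<noteq> (e o\<^sub>L y o\<^sub>L e) o\<^sub>L (e o\<^sub>L x o\<^sub>L e)"
    and center: "isproj z \<Longrightarrow> z \<in> M \<Longrightarrow> z \<in> rcomm M \<Longrightarrow> z = 0 \<or> z = id_blinfun"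
    and t_add: "S \<in> M \<Longrightarrow> T \<in> M \<Longrightarrow> t (S + T) = t S + t T"
    and t_scaleR: "T \<in> M \<Longrightarrow> t (c *\<^sub>R T) = c * t T"
    and t_pos: "T \<in> M \<Longrightarrow> pos T \<Longrightarrow> t T \<ge> 0"
    and t_id: "t id_blinfun = 1"
    and t_trace: "S \<in> M \<Longrightarrow> T \<in> M \<Longrightarrow> t (S o\<^sub>L T) = t (T o\<^sub>L S)"
    and t_faithful: "T \<in> M \<Longrightarrow> pos T \<Longrightarrow> t T = 0 \<Longrightarrow> T = 0"
    and t_normal: "(\<And>n::nat. isproj (p n) \<and> p n \<in> M) \<Longrightarrow> (\<And>n. p n o\<^sub>L p (Suc n) = p n) \<Longrightarrow>
      (\<And>v. (\<lambda>n. blinfun_apply (p n) v) \<longlonglongrightarrow> blinfun_apply q v) \<Longrightarrow> isproj q \<Longrightarrow> q \<in> M \<Longrightarrow>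
      (\<And>n. t (p n) \<le> c) \<Longrightarrow> t q \<le> c"
begin

section \<open>Closure of the two algebras, and traces of projections\<close>

lemmas M_intros = rcomm_intros[where S = "rcomm M", unfolded M_bicomm] M_radj
lemmas A_intros = rcomm_intros[where S = "rcomm A", unfolded A_bicomm] A_radj

lemma AM: "T \<in> A \<Longrightarrow> T \<in> M"
  using A_sub by blast

lemma bicommutant_subset_M: "T \<in> M \<Longrightarrow> rcomm (rcomm {T}) \<subseteq> M"
  using rcomm_antimono[OF rcomm_antimono[of "{T}" M]] by (simp add: M_bicomm)

lemma bicommutant_subset_A: "T \<in> A \<Longrightarrow> rcomm (rcomm {T}) \<subseteq> A"
  using rcomm_antimono[OF rcomm_antimono[of "{T}" A]] by (simp add: A_bicomm)

lemma t_diff: "S \<in> M \<Longrightarrow> T \<in> M \<Longrightarrow> t (S - T) = t S - t T"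
  using t_add[of S "(-1) *\<^sub>R T"] t_scaleR[of T "-1"] by (simp add: M_intros)

lemma t_0: "t 0 = 0"
  using t_scaleR[of 0 0] by (simp add: M_intros)

lemma t_isproj_mono:
  assumes "isproj e" "isproj f" "e o\<^sub>L f = e" "e \<in> M" "f \<in> M"
  shows "t e \<le> t f"
  using t_pos[of "f - e"] assms by (simp add: t_diff M_intros pos_isproj isproj_diff)

lemma t_isproj_le_1: "isproj e \<Longrightarrow> e \<in> M \<Longrightarrow> t e \<le> 1"
  using t_isproj_mono[of e id_blinfun] by (simp add: M_intros t_id)

lemma t_isproj_pos:
  assumes "isproj e" "e \<in> M" "e \<noteq> 0"
  shows "t e > 0"
  using t_pos[of e] t_faithful[of e] assms by (auto simp: pos_isproj less_le)

text \<open>Subtract the spectral projection \<open>q\<close> of \<open>a\<close> for values above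
  \<open>1\<close>. Where \<open>q\<close> acts, \<open>a\<close> drops by one and stays
  nonnegative; elsewhere \<open>a\<close> is at most \<open>1\<close> already. The bound thus falls
  by one in each step and the last remainder lies between \<open>0\<close> and
  \<open>1\<close>.\<close>

lemma sum_of_projections:
  assumes "a \<in> A" "pos a" "pos (real (Suc m) *\<^sub>R id_blinfun - a)"
  shows "\<exists>q. (\<forall>k<m. isproj (q k) \<and> q k \<in> A) \<and> pos (a - (\<Sum>k<m. q k)) \<and>
    pos (id_blinfun - (a - (\<Sum>k<m. q k)))"
  using assms
proof (induction m arbitrary: a)
  case 0
  then show ?case by simp
next
  case (Suc m)
  define b where "b = a - id_blinfun"
  have a_eq: "a = b + id_blinfun" by (simp add: b_def)
  have bA: "b \<in> A" using Suc.prems unfolding b_def by (intro A_intros)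
  obtain q where q: "isproj q" "q \<in> rcomm (rcomm {b})" "pos (b o\<^sub>L q)" "pos (- (b o\<^sub>L (id_blinfun - q)))"
    using spectral_projection[of b] Suc.prems(2) by (auto simp: b_def pos_radj)
  have qA: "q \<in> A" using q(2) bicommutant_subset_A[OF bA] by blast
  have bq: "q o\<^sub>L b = b o\<^sub>L q" using A_comm qA bA by blast
  have [simp]: "q o\<^sub>L (b o\<^sub>L q) = b o\<^sub>L q"
    using bq isproj_idem[OF q(1)] by (metis blinfun_compose_assoc)
  let ?r = "id_blinfun - q"
  have r: "isproj ?r" using q(1) by (rule isproj_compl)
  have p1: "pos (radj ?r o\<^sub>L a o\<^sub>L ?r)" by (intro pos_conj Suc.prems)
  have e1: "a - q = (b o\<^sub>L q) + (radj ?r o\<^sub>L a o\<^sub>L ?r)"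
    unfolding isproj_radj[OF r] a_eq
    by (simp add: compose_simps bq isproj_idem[OF q(1)] blinfun_compose_assoc)
  have p2: "pos (radj q o\<^sub>L (real (Suc (Suc m)) *\<^sub>R id_blinfun - a) o\<^sub>L q)"
    by (intro pos_conj Suc.prems)
  have p3: "pos (real m *\<^sub>R ?r)" using r by (intro pos_scaleR pos_isproj) auto
  have e2: "real (Suc m) *\<^sub>R id_blinfun - (a - q) =
    - (b o\<^sub>L ?r) + (radj q o\<^sub>L (real (Suc (Suc m)) *\<^sub>R id_blinfun - a) o\<^sub>L q) + real m *\<^sub>R ?r"
    unfolding isproj_radj[OF q(1)] a_eq
    by (simp add: compose_simps bq isproj_idem[OF q(1)] blinfun_compose_assoc algebra_simps scaleR_2)
  have "pos (a - q)" unfolding e1 by (intro pos_add q p1)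
  moreover have "pos (real (Suc m) *\<^sub>R id_blinfun - (a - q))"
    unfolding e2 by (intro pos_add q p2 p3)
  moreover have "a - q \<in> A" using Suc.prems qA by (intro A_intros)
  ultimately obtain Q where Q: "\<forall>k<m. isproj (Q k) \<and> Q k \<in> A" "pos (a - q - (\<Sum>k<m. Q k))"
    "pos (id_blinfun - (a - q - (\<Sum>k<m. Q k)))"
    using Suc.IH[of "a - q"] by blast
  have "(\<Sum>k<Suc m. (Q(m := q)) k) = q + (\<Sum>k<m. Q k)" by simp
  then have eq: "a - (\<Sum>k<Suc m. (Q(m := q)) k) = a - q - (\<Sum>k<m. Q k)" by simp
  show ?case
  proof (intro exI conjI)
    show "\<forall>k<Suc m. isproj ((Q(m := q)) k) \<and> (Q(m := q)) k \<in> A"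
      using Q(1) q(1) qA by (simp add: less_Suc_eq)
  qed (simp_all only: eq Q)
qed

text \<open>The bound \<open>1\<close> does not grow with \<open>m\<close>. This gives both the
  approximation with error \<open>1 / (m + 1)\<close> after division and the reduction of
  commutation with \<open>A\<close> to commutation with its projections.\<close>

lemma norm_sum_of_projections:
  assumes "a \<in> A" "pos a" "norm a \<le> 1"
  obtains q where "\<And>k. k < m \<Longrightarrow> isproj (q k) \<and> q k \<in> A"
    "norm (real (Suc m) *\<^sub>R a - (\<Sum>k<m. q k)) \<le> 1"
proof -
  have "real (Suc m) *\<^sub>R id_blinfun - real (Suc m) *\<^sub>R a = real (Suc m) *\<^sub>R (1 *\<^sub>R id_blinfun - a)"
    by (simp add: scaleR_diff_right)
  also have "pos \<dots>" using assms by (intro pos_scaleR pos_norm_diff) (auto simp: pos_radj)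
  finally have "pos (real (Suc m) *\<^sub>R id_blinfun - real (Suc m) *\<^sub>R a)" .
  moreover have "real (Suc m) *\<^sub>R a \<in> A" using assms by (intro A_intros)
  moreover have "pos (real (Suc m) *\<^sub>R a)" using assms by (intro pos_scaleR) auto
  ultimately obtain q where q: "\<forall>k<m. isproj (q k) \<and> q k \<in> A"
    "pos (real (Suc m) *\<^sub>R a - (\<Sum>k<m. q k))"
    "pos (id_blinfun - (real (Suc m) *\<^sub>R a - (\<Sum>k<m. q k)))"
    using sum_of_projections[of "real (Suc m) *\<^sub>R a" m] by blast
  show ?thesis
  proof (rule that[of q])
    show "norm (real (Suc m) *\<^sub>R a - (\<Sum>k<m. q k)) \<le> 1" by (rule norm_le_1_if_pos) (fact q)+
    show "isproj (q k) \<and> q k \<in> A" if "k < m" for k using q(1) that by simp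
  qed
qed

text \<open>For a positive contraction \<open>a\<close>, the multiple \<open>k a\<close> differs by
  norm at most \<open>1\<close> from a sum of projections commuting with \<open>x\<close>. Its
  commutator with \<open>x\<close> is therefore bounded by \<open>2 * norm x\<close> for every
  \<open>k\<close>, so it vanishes. General elements are reduced to this case by self-adjoint and
  skew-adjoint parts.\<close>

lemma commutes_A_if_commutes_projections:
  assumes x: "x \<in> M" and q: "\<And>q. q \<in> A \<Longrightarrow> isproj q \<Longrightarrow> q o\<^sub>L x = x o\<^sub>L q"
    and b: "b \<in> A"
  shows "b o\<^sub>L x = x o\<^sub>L b"
proof -
  have contraction: "a o\<^sub>L x = x o\<^sub>L a" if a: "a \<in> A" "pos a" "norm a \<le> 1" for a
  proof -
    let ?D = "(a o\<^sub>L x) - (x o\<^sub>L a)"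
    have "real k * norm ?D \<le> 2 * norm x" if "k > 0" for k
    proof -
      obtain m where k: "k = Suc m" using \<open>k > 0\<close> by (cases k) auto
      obtain Q where Q: "\<And>k. k < m \<Longrightarrow> isproj (Q k) \<and> Q k \<in> A"
        "norm (real (Suc m) *\<^sub>R a - (\<Sum>k<m. Q k)) \<le> 1"
        using norm_sum_of_projections[OF a] by blast
      define r where "r = real k *\<^sub>R a - (\<Sum>k<m. Q k)"
      have "(\<Sum>k<m. Q k o\<^sub>L x) = (\<Sum>k<m. x o\<^sub>L Q k)" using Q q by (intro sum.cong) auto
      then have "real k *\<^sub>R ?D = (r o\<^sub>L x) - (x o\<^sub>L r)"
        by (simp add: r_def compose_simps scaleR_diff_right)
      then have "real k * norm ?D = norm ((r o\<^sub>L x) - (x o\<^sub>L r))"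
        by (metis abs_of_nat norm_scaleR)
      also have "\<dots> \<le> norm (r o\<^sub>L x) + norm (x o\<^sub>L r)" by (rule norm_triangle_ineq4)
      also have "\<dots> \<le> 1 * norm x + norm x * 1"
        using Q(2) unfolding k[symmetric] r_def[symmetric]
        by (intro add_mono order_trans[OF norm_blinfun_compose] mult_mono) auto
      finally show ?thesis by simp
    qed
    then have "norm ?D = 0" by (intro real_archimedian_rdiv_eq_0[of _ "2 * norm x"]) auto
    then show ?thesis by simp
  qed
  have selfadjoint: "b o\<^sub>L x = x o\<^sub>L b" if b: "b \<in> A" "radj b = b" for b
  proof -
    define c where "c = norm b + 1"
    have c: "c > 0" by (simp add: c_def add_nonneg_pos)
    \<comment> \<open>An affine image of \<open>b\<close> lying between \<open>0\<close> and
      \<open>1\<close>, as \<open>b\<close> lies between \<open>- c\<close> and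
      \<open>c\<close>.\<close>
    define a where "a = (1 / (2 * c)) *\<^sub>R (c *\<^sub>R id_blinfun - b)"
    have "pos a" using b c unfolding a_def by (intro pos_scaleR pos_norm_diff) (auto simp: c_def)
    moreover have "id_blinfun - a = (1 / (2 * c)) *\<^sub>R (c *\<^sub>R id_blinfun - (- b))"
    proof -
      have "(2 * c) *\<^sub>R id_blinfun = c *\<^sub>R id_blinfun + c *\<^sub>R (id_blinfun :: 'h \<Rightarrow>\<^sub>L 'h)"
        unfolding mult_2 by (rule scaleR_add_left)
      then have eq: "c *\<^sub>R id_blinfun - (- b) = (2 * c) *\<^sub>R id_blinfun - (c *\<^sub>R id_blinfun - b)" by simp
      show ?thesis unfolding eq using c by (simp add: a_def scaleR_diff_right)
    qed
    moreover have "pos \<dots>" using b c by (intro pos_scaleR pos_norm_diff) (auto simp: c_def)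
    ultimately have "a o\<^sub>L x = x o\<^sub>L a"
      using b by (intro contraction norm_le_1_if_pos) (auto simp: a_def intro!: A_intros)
    moreover have "b = c *\<^sub>R id_blinfun - (2 * c) *\<^sub>R a" using c by (simp add: a_def)
    ultimately show ?thesis by (simp add: compose_simps)
  qed
  define s d where "s = b + radj b" and "d = b - radj b"
  have s: "s o\<^sub>L x = x o\<^sub>L s"
    using b unfolding s_def by (intro selfadjoint A_intros) (auto simp: add.commute)
  have dA: "d \<in> A" using b unfolding d_def by (intro A_intros)
  \<comment> \<open>The part \<open>d\<close> is skew-adjoint, so \<open>J d\<close> is
    self-adjoint; the factor \<open>J\<close> is removed again because it commutes with
    \<open>x\<close> and squares to \<open>- id_blinfun\<close>.\<close>
  have "J o\<^sub>L d \<in> A" using dA J(1) by (simp add: A_intros)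
  moreover have "radj (J o\<^sub>L d) = J o\<^sub>L d"
    using A_comm[OF J(1) dA] by (simp add: J(2) d_def compose_simps)
  ultimately have "(J o\<^sub>L d) o\<^sub>L x = x o\<^sub>L (J o\<^sub>L d)" by (rule selfadjoint)
  then have "J o\<^sub>L ((J o\<^sub>L d) o\<^sub>L x) = J o\<^sub>L (x o\<^sub>L (J o\<^sub>L d))" by simp
  moreover have "J o\<^sub>L (x o\<^sub>L (J o\<^sub>L d)) = x o\<^sub>L ((J o\<^sub>L J) o\<^sub>L d)"
    using J_comm[OF x] by (metis blinfun_compose_assoc)
  moreover have "J o\<^sub>L ((J o\<^sub>L d) o\<^sub>L x) = (J o\<^sub>L J) o\<^sub>L (d o\<^sub>L x)"
    by (simp add: blinfun_compose_assoc)
  ultimately have "d o\<^sub>L x = x o\<^sub>L d" by (simp add: J(3) compose_simps)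
  with s have "(s + d) o\<^sub>L x = x o\<^sub>L (s + d)" by (simp add: compose_simps)
  moreover have "s + d = 2 *\<^sub>R b" by (simp add: s_def d_def scaleR_2)
  ultimately show ?thesis by (simp add: compose_simps)
qed

text \<open>If \<open>e\<close> were minimal, \<open>q e\<close> would be \<open>0\<close> or
  \<open>e\<close> for each projection \<open>q\<close> in \<open>A\<close>, and in both cases
  \<open>q\<close> commutes with every compression \<open>e y e\<close>.\<close>

lemma proper_subprojection:
  assumes e: "e \<in> A" "isproj e" "e \<noteq> 0"
  obtains f where "f \<in> A" "isproj f" "f o\<^sub>L e = f" "f \<noteq> 0" "f \<noteq> e"
proof (rule ccontr)
  note witness = that
  assume "\<not> thesis"
  then have minimal: "f = 0 \<or> f = e" if "f \<in> A" "isproj f" "f o\<^sub>L e = f" for f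
    using that witness by blast
  have ee: "e o\<^sub>L e = e" using e by (simp add: isproj_idem)
  have compression_in_A: "e o\<^sub>L y o\<^sub>L e \<in> A" if y: "y \<in> M" "radj y = y \<or> radj y = - y" for y
  proof -
    let ?x = "e o\<^sub>L y o\<^sub>L e"
    have xM: "?x \<in> M" using y(1) AM[OF e(1)] by (intro M_intros)
    have "q o\<^sub>L ?x = ?x o\<^sub>L q" if q: "q \<in> A" "isproj q" for q
    proof -
      have qe: "q o\<^sub>L e = e o\<^sub>L q" using A_comm q e by blast
      then have "isproj (q o\<^sub>L e)" using q e by (intro isproj_compose)
      moreover have "q o\<^sub>L e \<in> A" using q e by (intro A_intros)
      moreover have "(q o\<^sub>L e) o\<^sub>L e = q o\<^sub>L e" by (simp add: blinfun_compose_assoc ee)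
      ultimately consider "q o\<^sub>L e = 0" | "q o\<^sub>L e = e" using minimal by blast
      moreover have "q o\<^sub>L ?x = (q o\<^sub>L e) o\<^sub>L y o\<^sub>L e" by (simp add: blinfun_compose_assoc)
      moreover have "?x o\<^sub>L q = e o\<^sub>L y o\<^sub>L (q o\<^sub>L e)" by (simp add: blinfun_compose_assoc qe)
      ultimately show ?thesis by cases simp_all
    qed
    then have "b o\<^sub>L ?x = ?x o\<^sub>L b" if "b \<in> A" for b
      using commutes_A_if_commutes_projections[OF xM] that by blast
    moreover have "radj ?x = ?x \<or> radj ?x = - ?x"
      using y(2) e(2) by (auto simp: isproj_radj blinfun_compose_assoc compose_simps)
    ultimately show ?thesis using A_max[OF xM] by blast
  qed
  \<comment> \<open>Maximality of \<open>A\<close> is available for self-adjoint and skew-adjoint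
    elements, so \<open>y\<close> is split into these two parts.\<close>
  have in_A: "e o\<^sub>L y o\<^sub>L e \<in> A" if y: "y \<in> M" for y
  proof -
    have "y + radj y \<in> M" "y - radj y \<in> M" using y by (simp_all add: M_intros)
    then have "e o\<^sub>L (y + radj y) o\<^sub>L e \<in> A" "e o\<^sub>L (y - radj y) o\<^sub>L e \<in> A"
      by (auto intro!: compression_in_A simp: add.commute)
    then have "(1/2) *\<^sub>R ((e o\<^sub>L (y + radj y) o\<^sub>L e) + (e o\<^sub>L (y - radj y) o\<^sub>L e)) \<in> A"
      by (simp only: A_intros)
    moreover have "(e o\<^sub>L (y + radj y) o\<^sub>L e) + (e o\<^sub>L (y - radj y) o\<^sub>L e) = 2 *\<^sub>R (e o\<^sub>L y o\<^sub>L e)"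
      by (simp add: compose_simps scaleR_2)
    ultimately show ?thesis by simp
  qed
  then show False using no_abelian[OF e(2) AM[OF e(1)] e(3)] A_comm by blast
qed

text \<open>A proper subprojection \<open>g\<close> of \<open>f\<close> and its complement
  \<open>f - g\<close> are both nonzero, and one of them has at most half the trace of
  \<open>f\<close>; iterate.\<close>

lemma small_subprojection:
  assumes e: "e \<in> A" "isproj e" "e \<noteq> 0" and \<delta>: "\<delta> > 0"
  obtains f where "f \<in> A" "isproj f" "f o\<^sub>L e = f" "f \<noteq> 0" "t f < \<delta>"
proof -
  have "\<exists>f. f \<in> A \<and> isproj f \<and> f o\<^sub>L e = f \<and> f \<noteq> 0 \<and> t f \<le> t e / 2 ^ n" for n
  proof (induction n)
    case 0
    show ?case using e by (intro exI[of _ e]) (simp add: isproj_idem)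
  next
    case (Suc n)
    then obtain f where f: "f \<in> A" "isproj f" "f o\<^sub>L e = f" "f \<noteq> 0" "t f \<le> t e / 2 ^ n" by blast
    obtain g where g: "g \<in> A" "isproj g" "g o\<^sub>L f = g" "g \<noteq> 0" "g \<noteq> f"
      using proper_subprojection[OF f(1,2,4)] by blast
    have "t (f - g) = t f - t g" using f g by (simp add: t_diff AM)
    then consider "t g \<le> t f / 2" | "t (f - g) \<le> t f / 2" by linarith
    then obtain h where h: "h \<in> A" "isproj h" "h o\<^sub>L f = h" "h \<noteq> 0" "t h \<le> t f / 2"
    proof cases
      case 1
      then show ?thesis using that g by blast
    next
      case 2
      then show ?thesis using that[of "f - g"] f g
        by (simp add: A_intros isproj_diff compose_simps isproj_idem)
    qed
    have "h o\<^sub>L e = h" using h(3) f(3) by (metis blinfun_compose_assoc)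
    moreover have "t h \<le> t e / 2 ^ Suc n" using h(5) f(5) by simp
    ultimately show ?case using h by blast
  qed
  moreover obtain n where "(1/2) ^ n < \<delta> / t e"
    using real_arch_pow_inv[of "\<delta> / t e" "1/2"] \<delta> t_isproj_pos[OF e(2) AM[OF e(1)] e(3)] by auto
  then have "t e / 2 ^ n < \<delta>"
    using t_isproj_pos[OF e(2) AM[OF e(1)] e(3)] by (simp add: field_simps power_divide)
  ultimately show ?thesis using that by (meson le_less_trans)
qed

text \<open>A greedy choice: in each step at least half of the largest possible trace is added.\<close>

lemma exhaustion:
  assumes P0: "P 0" and P: "\<And>V. P V \<Longrightarrow> V \<in> M \<and> pisom V"
  obtains V W where "V 0 = 0" "pisom_chain V W" "\<And>n. P (V n)"
    "\<And>w. w \<in> M \<Longrightarrow> pisom w \<Longrightarrow> (\<And>n. radj (V n) o\<^sub>L w = 0 \<and> V n o\<^sub>L radj w = 0 \<and> P (V n + w)) \<Longrightarrow> w = 0"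
proof -
  \<comment> \<open>\<open>R V w\<close> says that \<open>w\<close> may be added to
    \<open>V\<close>; \<open>\<phi> w\<close> is the trace of the initial projection of
    \<open>w\<close>.\<close>
  define R where "R V w \<longleftrightarrow> w \<in> M \<and> pisom w \<and> radj V o\<^sub>L w = 0 \<and> V o\<^sub>L radj w = 0 \<and> P (V + w)" for V w
  define \<phi> where "\<phi> w = t (radj w o\<^sub>L w)" for w
  have \<phi>0: "\<phi> w \<ge> 0" if "w \<in> M" for w
    unfolding \<phi>_def using that by (intro t_pos M_intros pos_adj_compose)
  have \<phi>1: "\<phi> w \<le> 1" if "w \<in> M" "pisom w" for w
    unfolding \<phi>_def using that by (intro t_isproj_le_1 M_intros pisom_initial)
  have "\<exists>w. P V \<longrightarrow> R V w \<and> (\<forall>w'. R V w' \<longrightarrow> \<phi> w' \<le> 2 * \<phi> w)" for V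
  proof (cases "P V \<and> (\<exists>w. R V w \<and> \<phi> w > 0)")
    case True
    let ?S = "\<phi> ` {w. R V w}"
    have bdd: "bdd_above ?S" using \<phi>1 by (intro bdd_aboveI2[where M = 1]) (auto simp: R_def)
    obtain w0 where w0: "R V w0" "\<phi> w0 > 0" using True by blast
    then have "0 < Sup ?S" using bdd by (intro less_cSUP_iff[THEN iffD2]) auto
    then have "Sup ?S / 2 < Sup ?S" by simp
    then obtain w where w: "R V w" "Sup ?S / 2 < \<phi> w"
      using less_cSUP_iff[OF _ bdd, of "Sup ?S / 2"] w0 by auto
    have "\<phi> w' \<le> 2 * \<phi> w" if "R V w'" for w'
      using cSUP_upper[OF _ bdd, of w'] that w by fastforce
    then show ?thesis using w by blast
  next
    case False
    \<comment> \<open>Either \<open>P V\<close> fails and nothing is claimed, or no increment has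
      positive trace and \<open>0\<close> is optimal.\<close>
    show ?thesis
    proof (intro exI[of _ 0] impI conjI allI)
      assume "P V"
      then show "R V 0" by (simp add: R_def M_intros)
      show "\<phi> w' \<le> 2 * \<phi> 0" if "R V w'" for w'
        using False that \<open>P V\<close> by (auto simp: \<phi>_def t_0 not_less)
    qed
  qed
  then obtain F where F: "\<And>V. P V \<Longrightarrow> R V (F V)" "\<And>V w. P V \<Longrightarrow> R V w \<Longrightarrow> \<phi> w \<le> 2 * \<phi> (F V)"
    by metis
  define V where "V = rec_nat 0 (\<lambda>_ V. V + F V)"
  have V: "V 0 = 0" "V (Suc n) = V n + F (V n)" for n by (simp_all add: V_def)
  have PV: "P (V n)" for n
    by (induction n) (use P0 F(1) in \<open>auto simp: V R_def\<close>)
  have RV: "R (V n) (F (V n))" for n using F PV by blast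
  have chain: "pisom_chain V (\<lambda>n. F (V n))"
    by unfold_locales (use PV P RV in \<open>auto simp: V R_def\<close>)
  have sum: "\<phi> (V n) = (\<Sum>k<n. \<phi> (F (V k)))" for n
  proof (induction n)
    case 0
    show ?case by (simp add: V \<phi>_def t_0)
  next
    case (Suc n)
    have o: "radj (V n) o\<^sub>L F (V n) = 0" and M: "V n \<in> M" "F (V n) \<in> M"
      using RV[of n] P[OF PV[of n]] by (auto simp: R_def)
    have "radj (F (V n)) o\<^sub>L V n = 0" using arg_cong[OF o, of radj] by simp
    with o have "radj (V (Suc n)) o\<^sub>L V (Suc n) = (radj (V n) o\<^sub>L V n) + (radj (F (V n)) o\<^sub>L F (V n))"
      by (simp add: V compose_simps)
    then have "\<phi> (V (Suc n)) = \<phi> (V n) + \<phi> (F (V n))"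
      unfolding \<phi>_def using M by (simp add: t_add M_intros)
    then show ?case using Suc by simp
  qed
  have "w = 0" if w: "w \<in> M" "pisom w" "\<And>n. R (V n) w" for w
  proof -
    \<comment> \<open>Every chosen increment has at least half the size of \<open>w\<close>, which
      was available at each stage, while the increments together have size at most
      \<open>1\<close>.\<close>
    have "real n * \<phi> w \<le> 2" for n
    proof -
      have "real n * \<phi> w = (\<Sum>k<n. \<phi> w)" by simp
      also have "\<dots> \<le> (\<Sum>k<n. 2 * \<phi> (F (V k)))" using F(2) PV w by (intro sum_mono) auto
      also have "\<dots> = 2 * \<phi> (V n)" by (simp add: sum sum_distrib_left)
      also have "\<dots> \<le> 2" using \<phi>1 P PV by simp
      finally show ?thesis .
    qed
    then have "\<phi> w = 0" using \<phi>0[OF w(1)] by (intro real_archimedian_rdiv_eq_0[of _ 2]) auto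
    then have "radj w o\<^sub>L w = 0"
      unfolding \<phi>_def using w by (intro t_faithful M_intros pos_adj_compose)
    then show ?thesis by (simp add: adj_compose_eq_0_iff)
  qed
  then show ?thesis
    using that[OF V(1) chain PV] by (simp add: R_def)
qed

text \<open>Exhaust \<open>e\<close> by projections of \<open>A\<close> of trace at most
  \<open>c\<close>. Normality bounds the trace of the limit \<open>f\<close> by \<open>c\<close>. If
  it were smaller, a small projection of \<open>A\<close> below \<open>e - f\<close> could be added
  at every stage, against maximality.\<close>

lemma subprojection_of_trace:
  assumes e: "e \<in> A" "isproj e" and c: "0 \<le> c" "c \<le> t e"
  obtains f where "f \<in> A" "isproj f" "f o\<^sub>L e = f" "t f = c"
proof -
  define P where "P V \<longleftrightarrow> V \<in> A \<and> isproj V \<and> V o\<^sub>L e = V \<and> t V \<le> c" for V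
  have "P 0" using c by (simp add: P_def A_intros t_0)
  moreover have "V \<in> M \<and> pisom V" if "P V" for V using that by (simp add: P_def AM isproj_pisom)
  ultimately obtain V W where V: "V 0 = 0" "pisom_chain V W" "\<And>n. P (V n)"
    and max: "\<And>w. w \<in> M \<Longrightarrow> pisom w \<Longrightarrow>
      (\<And>n. radj (V n) o\<^sub>L w = 0 \<and> V n o\<^sub>L radj w = 0 \<and> P (V n + w)) \<Longrightarrow> w = 0"
    using exhaustion[of P] by blast
  interpret pisom_chain V W by fact
  have Vp: "isproj (V n)" "V n \<in> A" "V n o\<^sub>L e = V n" "t (V n) \<le> c" for n
    using V(3)[of n] by (simp_all add: P_def)
  obtain f where f: "\<And>x. (\<lambda>n. blinfun_apply (V n) x) \<longlonglongrightarrow> blinfun_apply f x"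
    "pisom f" "\<And>n. V n o\<^sub>L (radj f o\<^sub>L f) = V n" "\<And>n. (f o\<^sub>L radj f) o\<^sub>L V n = V n"
    and Vf': "\<And>n. (V n o\<^sub>L radj (V n)) o\<^sub>L f = V n"
    by (rule strong_limit) (rule that)
  have Vf: "V n o\<^sub>L f = V n" for n
    using Vf'[of n] Vp(1)[of n] by (simp add: isproj_def)
  have fA: "f \<in> A"
    by (rule strong_limit_in_bicommutant[of V A f, unfolded A_bicomm, OF Vp(2) f(1)])
  have "radj f = f"
  proof (rule radj_eqI)
    fix x y
    have "(\<lambda>n. inner (V n x) y) \<longlonglongrightarrow> inner (f x) y" "(\<lambda>n. inner x (V n y)) \<longlonglongrightarrow> inner x (f y)"
      by (intro tendsto_intros f(1))+
    moreover have "inner (V n x) y = inner x (V n y)" for n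
      using inner_radj[of "V n" x y] Vp(1)[of n] by (simp add: isproj_radj)
    ultimately show "inner (f x) y = inner x (f y)" by (simp add: LIMSEQ_unique)
  qed
  moreover have lim: "f o\<^sub>L T = f" if "\<And>n. V n o\<^sub>L T = V n" for T
  proof (rule blinfun_eqI)
    fix x
    have "V n (T x) = V n x" for n using applyI[OF that] .
    then show "(f o\<^sub>L T) x = f x" using f(1)[of "T x"] f(1)[of x] by (simp add: LIMSEQ_unique)
  qed
  ultimately have fp: "isproj f" using Vf by (simp add: isproj_def)
  have fe: "f o\<^sub>L e = f" using lim Vp(3) by blast
  have "V n o\<^sub>L V (Suc n) = V n" for n
    using orth(1)[of n] Vp(1)[of n] by (simp add: Suc compose_simps isproj_def)
  then have "t f \<le> c"
    by (intro t_normal[of V f c] fp AM fA f(1)) (simp_all add: Vp AM)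
  moreover have "\<not> t f < c"
  proof
    assume lt: "t f < c"
    have "e - f \<noteq> 0" using lt c(2) by auto
    moreover have "e - f \<in> A" using e fA by (intro A_intros)
    moreover have "isproj (e - f)" using e fp fe by (simp add: isproj_diff)
    ultimately obtain g where g: "g \<in> A" "isproj g" "g o\<^sub>L (e - f) = g" "g \<noteq> 0" "t g < c - t f"
      using small_subprojection[of "e - f" "c - t f"] lt by auto
    have "(e - f) o\<^sub>L V n = 0" for n
      using isproj_le_sym[OF Vp(1) fp Vf] isproj_le_sym[OF Vp(1) e(2) Vp(3)]
      by (simp add: compose_simps)
    then have gV: "g o\<^sub>L V n = 0" for n
      using g(3) by (metis blinfun_compose_assoc blinfun_compose_zero(2))
    have Vg: "V n o\<^sub>L g = 0" for n using isproj_orth_sym[OF g(2) Vp(1) gV] .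
    have ge: "g o\<^sub>L e = g"
    proof -
      have "(e - f) o\<^sub>L e = e - f" using fe e by (simp add: compose_simps isproj_idem)
      then show ?thesis using g(3) by (metis blinfun_compose_assoc)
    qed
    have "t (V n + g) \<le> c" for n
    proof -
      have "t (V n + g) = t (V n) + t g" by (simp add: t_add AM Vp g)
      moreover have "t (V n) \<le> t f" by (intro t_isproj_mono Vp fp Vf AM fA)
      ultimately show ?thesis using g(5) by linarith
    qed
    then have "P (V n + g)" for n
      using Vp g Vg ge by (simp add: P_def A_intros isproj_add compose_simps)
    then have "g = 0"
      using g Vp(1) Vg gV by (intro max) (auto simp: AM isproj_pisom isproj_radj)
    with g show False by simp
  qed
  ultimately show ?thesis using that fA fp fe by force
qed

text \<open>The vectors annihilated by all \<open>f x\<close> with \<open>x\<close> in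
  \<open>M\<close> form a closed subspace invariant under \<open>M\<close> and under its commutant,
  so its projection \<open>z\<close> is central. If all \<open>f x e\<close> vanished, the range of
  \<open>e\<close> would lie in it and force \<open>z = id_blinfun\<close>, hence
  \<open>f = 0\<close>.\<close>

lemma exists_intertwiner:
  assumes e: "e \<noteq> 0" and f: "isproj f" "f \<in> M" "f \<noteq> 0"
  shows "\<exists>x\<in>M. f o\<^sub>L x o\<^sub>L e \<noteq> 0"
proof (rule ccontr)
  assume "\<not> ?thesis"
  then have fxe: "f o\<^sub>L x o\<^sub>L e = 0" if "x \<in> M" for x using that by blast
  define K where "K = {v. \<forall>x\<in>M. f (blinfun_apply x v) = 0}"
  have "subspace K" by (auto simp: K_def subspace_def blinfun.bilinear_simps)
  moreover have "closed K"
    unfolding K_def Collect_ball_eq by (intro closed_INT ballI closed_Collect_eq continuous_intros)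
  ultimately obtain z where z: "isproj z" "\<And>v. z v \<in> K" "\<And>v. v \<in> K \<Longrightarrow> z v = v"
    using exists_projection_onto by blast
  have MK: "T v \<in> K" if "T \<in> M" "v \<in> K" for T v
  proof -
    have "f (x (T v)) = 0" if "x \<in> M" for x
    proof -
      have "x o\<^sub>L T \<in> M" using that \<open>T \<in> M\<close> by (intro M_intros)
      then have "f ((x o\<^sub>L T) v) = 0" using \<open>v \<in> K\<close> unfolding K_def by blast
      then show ?thesis by simp
    qed
    then show ?thesis by (simp add: K_def)
  qed
  have M'K: "U v \<in> K" if "U \<in> rcomm M" "v \<in> K" for U v
  proof -
    have "f (x (U v)) = U (f (x v))" if "x \<in> M" for x
      using rcommD[OF \<open>U \<in> rcomm M\<close>] f(2) that by (metis blinfun_apply_blinfun_compose)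
    then show ?thesis using \<open>v \<in> K\<close> by (simp add: K_def blinfun.bilinear_simps)
  qed
  have "z \<in> rcomm M"
    using projection_onto_invariant_commutes[OF z] MK M_radj by (intro rcommI) metis
  moreover have "z \<in> rcomm (rcomm M)"
  proof (rule rcommI)
    fix U assume U: "U \<in> rcomm M"
    then have "radj U \<in> rcomm M" by (intro rcomm_radj) (auto simp: M_radj)
    then show "U o\<^sub>L z = z o\<^sub>L U"
      using projection_onto_invariant_commutes[OF z, of U] U M'K by simp
  qed
  ultimately have "z = 0 \<or> z = id_blinfun" using center z(1) M_bicomm by simp
  moreover have "z o\<^sub>L e = e"
  proof (rule blinfun_eqI)
    fix v
    have "f (x (e v)) = 0" if "x \<in> M" for x
      using fxe[OF that] by (metis blinfun.zero_left blinfun_apply_blinfun_compose)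
    then show "(z o\<^sub>L e) v = e v" using z(3) by (simp add: K_def)
  qed
  then have "z \<noteq> 0" using e by auto
  moreover have "z \<noteq> id_blinfun"
  proof
    assume "z = id_blinfun"
    then have "v \<in> K" for v using z(2)[of v] by simp
    then have "f (id_blinfun v) = 0" for v
      unfolding K_def using rcomm_id[of "rcomm M"] unfolding M_bicomm by blast
    then have "f = 0" by (intro blinfun_eqI) simp
    then show False using f by simp
  qed
  ultimately show False by blast
qed

text \<open>Exhaust by partial isometries from \<open>e\<close> to \<open>f\<close>. If the limit
  \<open>v\<close> misses a part of \<open>e\<close>, a nonzero partial isometry between the two
  remainders could be added at every stage, against maximality.\<close>

lemma equal_trace_imp_equivalent:
  assumes e: "isproj e" "e \<in> M" and f: "isproj f" "f \<in> M" and tef: "t e = t f"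
  obtains v where "v \<in> M" "radj v o\<^sub>L v = e" "v o\<^sub>L radj v = f"
proof -
  define P where "P V \<longleftrightarrow> V \<in> M \<and> pisom V \<and> V o\<^sub>L e = V \<and> f o\<^sub>L V = V" for V
  have "P 0" by (simp add: P_def M_intros)
  moreover have "V \<in> M \<and> pisom V" if "P V" for V using that by (simp add: P_def)
  ultimately obtain V W where V: "V 0 = 0" "pisom_chain V W" "\<And>n. P (V n)"
    and max: "\<And>w. w \<in> M \<Longrightarrow> pisom w \<Longrightarrow>
      (\<And>n. radj (V n) o\<^sub>L w = 0 \<and> V n o\<^sub>L radj w = 0 \<and> P (V n + w)) \<Longrightarrow> w = 0"
    using exhaustion[of P] by blast
  interpret pisom_chain V W by fact
  have VP: "V n \<in> M" "V n o\<^sub>L e = V n" "f o\<^sub>L V n = V n" for n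
    using V(3)[of n] by (simp_all add: P_def)
  obtain v where v: "\<And>x. (\<lambda>n. blinfun_apply (V n) x) \<longlonglongrightarrow> blinfun_apply v x" "pisom v"
    "\<And>n. V n o\<^sub>L (radj v o\<^sub>L v) = V n" "\<And>n. (v o\<^sub>L radj v) o\<^sub>L V n = V n"
    "\<And>n. (V n o\<^sub>L radj (V n)) o\<^sub>L v = V n"
    by (rule strong_limit) (rule that)
  have vM: "v \<in> M"
    by (rule strong_limit_in_bicommutant[of V M v, unfolded M_bicomm, OF VP(1) v(1)])
  define p r where "p = radj v o\<^sub>L v" and "r = v o\<^sub>L radj v"
  have pr: "isproj p" "isproj r" using v(2) by (simp_all add: p_def r_def pisom_initial pisom_final)
  have prM: "p \<in> M" "r \<in> M" using vM by (simp_all add: p_def r_def M_intros)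
  have tpr: "t p = t r" unfolding p_def r_def using vM by (intro t_trace M_intros)
  have ve: "v o\<^sub>L e = v"
  proof (rule blinfun_eqI)
    fix x
    have "V n (e x) = V n x" for n using applyI[OF VP(2)] .
    then show "(v o\<^sub>L e) x = v x" using v(1)[of "e x"] v(1)[of x] by (simp add: LIMSEQ_unique)
  qed
  have fv: "f o\<^sub>L v = v"
  proof (rule blinfun_eqI)
    fix x
    have "(\<lambda>n. f (V n x)) \<longlonglongrightarrow> f (v x)" by (intro tendsto_intros v)
    moreover have "f (V n x) = V n x" for n using applyI[OF VP(3)] .
    ultimately show "(f o\<^sub>L v) x = v x" using v(1)[of x] by (simp add: LIMSEQ_unique)
  qed
  have pe: "p o\<^sub>L e = p" using ve by (simp add: p_def blinfun_compose_assoc)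
  have "f o\<^sub>L r = r" using fv by (simp add: r_def flip: blinfun_compose_assoc)
  then have rf: "r o\<^sub>L f = r" by (metis f(1) isproj_radj pr(2) radj_compose)
  have ep: "isproj (e - p)" "e - p \<in> M" and fr: "isproj (f - r)" "f - r \<in> M"
    using pr prM e f pe rf by (simp_all add: isproj_diff M_intros)
  have p_eq: "p = e"
  proof (rule ccontr)
    assume ne: "p \<noteq> e"
    \<comment> \<open>Initial and final projection of \<open>v\<close> have equal trace, so a gap on
      the side of \<open>e\<close> leaves an equally large gap on the side of
      \<open>f\<close>.\<close>
    have "t (f - r) = t (e - p)" using tef tpr e f prM by (simp add: t_diff)
    also have "\<dots> > 0" using ep ne by (intro t_isproj_pos) auto
    finally have "f - r \<noteq> 0" using t_0 by auto
    then obtain y where y: "y \<in> M" "(f - r) o\<^sub>L y o\<^sub>L (e - p) \<noteq> 0"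
      using exists_intertwiner[of "e - p" "f - r"] ne fr by auto
    define x where "x = (f - r) o\<^sub>L y o\<^sub>L (e - p)"
    have xM: "x \<in> M" using y e f prM unfolding x_def by (intro M_intros)
    have xe: "x o\<^sub>L (e - p) = x" and fx: "(f - r) o\<^sub>L x = x"
      using isproj_idem[OF ep(1)] isproj_idem[OF fr(1)]
      unfolding x_def by (metis blinfun_compose_assoc)+
    obtain k where k: "k \<in> rcomm (rcomm {radj x o\<^sub>L x})" "pisom (x o\<^sub>L k)" "x o\<^sub>L k \<noteq> 0"
      using exists_pisom[of x] y(2) unfolding x_def by blast
    define w where "w = x o\<^sub>L k"
    have kM: "k \<in> M" using k(1) bicommutant_subset_M[of "radj x o\<^sub>L x"] xM by (auto simp: M_intros)
    have wM: "w \<in> M" unfolding w_def using xM kM by (intro M_intros)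
    have fw: "(f - r) o\<^sub>L w = w" using fx by (simp add: w_def flip: blinfun_compose_assoc)
    have ex': "(e - p) o\<^sub>L radj x = radj x"
      using arg_cong[OF xe, of radj] isproj_radj[OF ep(1)] by (simp only: radj_compose)
    \<comment> \<open>Since \<open>k\<close> lies in the bicommutant of
      \<open>radj x o\<^sub>L x\<close>, it commutes with \<open>e - p\<close>; multiplication by
      \<open>k\<close> thus keeps the initial space of \<open>x\<close> inside the gap.\<close>
    have "(e - p) o\<^sub>L (radj x o\<^sub>L x) = (radj x o\<^sub>L x) o\<^sub>L (e - p)"
      using ex' xe by (metis blinfun_compose_assoc)
    then have "(e - p) o\<^sub>L k = k o\<^sub>L (e - p)"
      by (intro rcommD[OF k(1)] rcommI) auto
    then have we: "w o\<^sub>L (e - p) = w" using xe unfolding w_def by (metis blinfun_compose_assoc)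
    have "(e - p) o\<^sub>L radj (V n) = 0" for n
    proof -
      have "V n o\<^sub>L (e - p) = 0" using VP(2)[of n] v(3)[of n] by (simp add: compose_simps p_def)
      from arg_cong[OF this, of radj] show ?thesis using isproj_radj[OF ep(1)]
        by (simp only: radj_compose radj_0)
    qed
    then have wV: "w o\<^sub>L radj (V n) = 0" for n
      using we by (metis blinfun_compose_assoc blinfun_compose_zero(2))
    have "(f - r) o\<^sub>L V n = 0" for n
      using VP(3)[of n] v(4)[of n] by (simp add: compose_simps r_def)
    moreover have "radj w o\<^sub>L (f - r) = radj w"
      using arg_cong[OF fw, of radj] isproj_radj[OF fr(1)] by (simp only: radj_compose)
    ultimately have wV': "radj w o\<^sub>L V n = 0" for n
      by (metis blinfun_compose_assoc blinfun_compose_zero(2))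
    have Vw: "radj (V n) o\<^sub>L w = 0" "V n o\<^sub>L radj w = 0" for n
      using arg_cong[OF wV[of n], of radj] arg_cong[OF wV'[of n], of radj] by simp_all
    have "(e - p) o\<^sub>L e = e - p" using pe e(1) by (simp add: compose_simps isproj_idem)
    then have we': "w o\<^sub>L e = w" using we by (metis blinfun_compose_assoc)
    have "f o\<^sub>L (f - r) = f - r" using \<open>f o\<^sub>L r = r\<close> f(1) by (simp add: compose_simps isproj_idem)
    then have fw': "f o\<^sub>L w = w" using fw by (metis blinfun_compose_assoc)
    have pw: "pisom w" using k by (simp add: w_def)
    have "P (V n + w)" for n
    proof -
      have "pisom (V n + w)"
        using pisom[of n] pw Vw[of n] wV[of n] wV'[of n]
        by (simp add: pisom_def compose_simps blinfun_compose_assoc)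
      then show ?thesis using wM VP we' fw' by (simp add: P_def M_intros compose_simps)
    qed
    then have "w = 0" using wM pw Vw by (intro max) auto
    then show False using k by (simp add: w_def)
  qed
  have "t (f - r) = 0" using tef tpr p_eq f prM by (simp add: t_diff)
  then have "f - r = 0" using fr by (intro t_faithful pos_isproj)
  then show ?thesis using that[OF vM] p_eq by (simp add: p_def r_def)
qed

end

section \<open>Projections with prescribed expectation\<close>

lemma sum_lessThan_add:
  "(\<Sum>k<a + b. f k) = (\<Sum>k<a. f k) + (\<Sum>k<b. f (a + k))" for f :: "nat \<Rightarrow> 'a::comm_monoid_add"
  by (induction b) (simp_all add: add.assoc)

text \<open>Sylvester's doubling with blocks \<open>H, H\<close> above \<open>H, -H\<close>: the
  residue modulo \<open>N\<close> selects the entry of \<open>H\<close>, and \<open>s\<close> is the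
  sign of the lower right block.\<close>

lemma hadamard_matrix:
  "\<exists>H :: nat \<Rightarrow> nat \<Rightarrow> real. (\<forall>i<2^m. \<forall>k<2^m. H i k * H i k = 1) \<and>
    (\<forall>i<2^m. \<forall>j<2^m. (\<Sum>k<2^m. H i k * H j k) = (if i = j then 2^m else 0))"
proof (induction m)
  case 0
  show ?case by (intro exI[of _ "\<lambda>_ _. 1"]) simp
next
  case (Suc m)
  define N :: nat where "N = 2 ^ m"
  have N: "2 ^ Suc m = N + N" "N > 0" by (simp_all add: N_def)
  have N': "(2::real) ^ m = real N" by (simp add: N_def)
  obtain H :: "nat \<Rightarrow> nat \<Rightarrow> real" where
    H1: "\<And>i k. i < N \<Longrightarrow> k < N \<Longrightarrow> H i k * H i k = 1" and
    H: "\<And>i j. i < N \<Longrightarrow> j < N \<Longrightarrow> (\<Sum>k<N. H i k * H j k) = (if i = j then real N else 0)"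
    using Suc.IH unfolding N_def[symmetric] N' by blast
  define s :: "nat \<Rightarrow> nat \<Rightarrow> real" where "s i k = (if N \<le> i \<and> N \<le> k then -1 else 1)" for i k
  define G where "G i k = H (i mod N) (k mod N) * s i k" for i k
  have "G i k * G i k = 1" for i k
    using H1[of "i mod N" "k mod N"] N by (simp add: G_def s_def)
  moreover have "(\<Sum>k<N + N. G i k * G j k) = (if i = j then real N + real N else 0)"
    if ij: "i < N + N" "j < N + N" for i j
  proof -
    \<comment> \<open>On the right half of the columns the signs do not depend on the column. Hence
      \<open>1 + c\<close> is \<open>2\<close> for two rows in the same half and \<open>0\<close>
      otherwise.\<close>
    define c where "c = s i N * s j N"
    have "(\<Sum>k<N + N. G i k * G j k) =
        (\<Sum>k<N. H (i mod N) k * H (j mod N) k) + (\<Sum>k<N. c * (H (i mod N) k * H (j mod N) k))"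
      unfolding sum_lessThan_add
      by (intro arg_cong2[where f = "(+)"] sum.cong) (auto simp: G_def s_def c_def)
    also have "\<dots> = (1 + c) * (if i mod N = j mod N then real N else 0)"
      using H[of "i mod N" "j mod N"] N by (simp add: sum_distrib_left[symmetric] algebra_simps)
    also have "\<dots> = (if i = j then real N + real N else 0)"
    proof -
      have "x mod N = (if x < N then x else x - N)" if "x < N + N" for x
        using that by (simp add: mod_if)
      then show ?thesis using ij by (auto simp: c_def s_def)
    qed
    finally show ?thesis .
  qed
  moreover have "(2::real) ^ Suc m = real N + real N" by (simp add: N_def)
  ultimately show ?case unfolding N by (intro exI[of _ G]) simp
qed

section \<open>Matrix units with diagonal in the masa\<close>

context masa_in_factor
begin

text \<open>Pieces of trace \<open>c\<close> are split off one at a time. When none is left to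
  split, the remainder has trace \<open>0\<close>, and faithfulness makes it
  \<open>0\<close>.\<close>

lemma equal_division:
  assumes "Q \<in> A" "isproj Q" "t Q = real N * c" "c \<ge> 0"
  shows "\<exists>e. (\<forall>k<N. e k \<in> A \<and> isproj (e k) \<and> e k o\<^sub>L Q = e k \<and> t (e k) = c) \<and>
    (\<forall>j<N. \<forall>k<N. j \<noteq> k \<longrightarrow> e j o\<^sub>L e k = 0) \<and> (\<Sum>k<N. e k) = Q"
  using assms(1-3)
proof (induction N arbitrary: Q)
  case 0
  then have "Q = 0" using t_faithful[of Q] by (simp add: AM pos_isproj)
  then show ?case by simp
next
  case (Suc N)
  have "c \<le> t Q" using Suc.prems(3) assms(4) by (simp add: algebra_simps)
  then obtain f where f: "f \<in> A" "isproj f" "f o\<^sub>L Q = f" "t f = c"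
    using subprojection_of_trace[of Q c] Suc.prems assms(4) by blast
  let ?R = "Q - f"
  have Qf: "Q o\<^sub>L f = f" using f Suc.prems by (simp add: isproj_le_sym)
  have "?R \<in> A" "isproj ?R" "t ?R = real N * c"
    using f Suc.prems by (simp_all add: A_intros isproj_diff t_diff AM algebra_simps)
  then obtain e where e: "\<And>k. k < N \<Longrightarrow> e k \<in> A \<and> isproj (e k) \<and> e k o\<^sub>L ?R = e k \<and> t (e k) = c"
    "\<And>j k. j < N \<Longrightarrow> k < N \<Longrightarrow> j \<noteq> k \<Longrightarrow> e j o\<^sub>L e k = 0" "(\<Sum>k<N. e k) = ?R"
    using Suc.IH[of ?R] by blast
  have R: "?R o\<^sub>L f = 0" "?R o\<^sub>L Q = ?R"
    using Qf f Suc.prems by (simp_all add: compose_simps isproj_idem)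
  have ef: "e k o\<^sub>L f = 0" "e k o\<^sub>L Q = e k" if "k < N" for k
    using e(1)[OF that] R by (metis blinfun_compose_assoc blinfun_compose_zero(2))+
  have fe: "f o\<^sub>L e k = 0" if "k < N" for k
    using ef(1)[OF that] e(1)[OF that] f(2) by (simp add: isproj_orth_sym)
  show ?case
  proof (intro exI[of _ "e(N := f)"] conjI)
    show "\<forall>k<Suc N. (e(N := f)) k \<in> A \<and> isproj ((e(N := f)) k) \<and> (e(N := f)) k o\<^sub>L Q = (e(N := f)) k \<and>
      t ((e(N := f)) k) = c"
      using e(1) f ef(2) by (simp add: less_Suc_eq)
    show "\<forall>j<Suc N. \<forall>k<Suc N. j \<noteq> k \<longrightarrow> (e(N := f)) j o\<^sub>L (e(N := f)) k = 0"
      using e(2) ef(1) fe by (auto simp: less_Suc_eq)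
    show "(\<Sum>k<Suc N. (e(N := f)) k) = Q" using e(3) by simp
  qed
qed

text \<open>The first column of a system of matrix units with diagonal in \<open>A\<close>, commuting with \<open>B\<close>.\<close>

definition units :: "('h \<Rightarrow>\<^sub>L 'h) set \<Rightarrow> nat \<Rightarrow> ('h \<Rightarrow>\<^sub>L 'h) \<Rightarrow> (nat \<Rightarrow> 'h \<Rightarrow>\<^sub>L 'h) \<Rightarrow> (nat \<Rightarrow> 'h \<Rightarrow>\<^sub>L 'h) \<Rightarrow> bool"
  where "units B N Q e v \<longleftrightarrow>
    (\<forall>k<N. e k \<in> A \<and> v k \<in> M \<and> radj (v k) o\<^sub>L v k = e 0 \<and> v k o\<^sub>L radj (v k) = e k \<and>
      v k o\<^sub>L Q = v k \<and> Q o\<^sub>L v k = v k \<and> (\<forall>q\<in>B. q o\<^sub>L v k = v k o\<^sub>L q)) \<and>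
    (\<forall>j<N. \<forall>k<N. j \<noteq> k \<longrightarrow> e j o\<^sub>L e k = 0) \<and> (\<Sum>k<N. e k) = Q"

text \<open>Equal traces make the diagonal pieces equivalent, and \<open>v k = e k v k e 0\<close>
  places the partial isometries under \<open>Q\<close>. The matrix unit in position
  \<open>(j, k)\<close> is \<open>v j o\<^sub>L radj (v k)\<close>; nothing forces
  \<open>v 0\<close> to be \<open>e 0\<close>.\<close>

lemma units_empty:
  assumes Q: "Q \<in> A" "isproj Q" and N: "N > 0"
  shows "\<exists>e v. units {} N Q e v"
proof -
  have "t Q \<ge> 0" using Q by (intro t_pos) (auto simp: AM pos_isproj)
  then obtain e where e: "\<And>k. k < N \<Longrightarrow> e k \<in> A \<and> isproj (e k) \<and> e k o\<^sub>L Q = e k \<and> t (e k) = t Q / N"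
    "\<forall>j<N. \<forall>k<N. j \<noteq> k \<longrightarrow> e j o\<^sub>L e k = 0" "(\<Sum>k<N. e k) = Q"
    using equal_division[OF Q, of N "t Q / N"] N by auto
  have "\<exists>v. v \<in> M \<and> radj v o\<^sub>L v = e 0 \<and> v o\<^sub>L radj v = e k" if k: "k < N" for k
    using equal_trace_imp_equivalent[of "e 0" "e k"] e(1)[OF k] e(1)[OF N] AM by metis
  then obtain v where v: "\<And>k. k < N \<Longrightarrow> v k \<in> M \<and> radj (v k) o\<^sub>L v k = e 0 \<and> v k o\<^sub>L radj (v k) = e k"
    by metis
  have "v k o\<^sub>L Q = v k \<and> Q o\<^sub>L v k = v k" if k: "k < N" for k
  proof -
    have "pisom (v k)" using v[OF k] e(1)[OF N] by (intro pisom_if_initial) simp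
    then have "v k = v k o\<^sub>L e 0" "v k = e k o\<^sub>L v k"
      using v[OF k] by (metis pisom_def blinfun_compose_assoc)+
    moreover have "e 0 o\<^sub>L Q = e 0" "Q o\<^sub>L e k = e k"
      using e(1)[OF N] e(1)[OF k] Q by (auto simp: isproj_le_sym)
    ultimately show ?thesis by (metis blinfun_compose_assoc)
  qed
  then show ?thesis unfolding units_def using e v by (intro exI[of _ e] exI[of _ v]) auto
qed

text \<open>All mixed products vanish through \<open>Q1 o\<^sub>L Q2 = 0\<close>. As
  \<open>q\<close> is the identity on the first corner and zero on the second, it commutes with the
  sums of units.\<close>

lemma units_add:
  assumes u1: "units B N Q1 e1 v1" and u2: "units B N Q2 e2 v2"
    and Q: "isproj Q1" "isproj Q2" "Q1 o\<^sub>L Q2 = 0"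
    and q: "q o\<^sub>L Q1 = Q1" "Q1 o\<^sub>L q = Q1" "q o\<^sub>L Q2 = 0" "Q2 o\<^sub>L q = 0"
  shows "units (insert q B) N (Q1 + Q2) (\<lambda>k. e1 k + e2 k) (\<lambda>k. v1 k + v2 k)"
proof -
  have Q': "Q2 o\<^sub>L Q1 = 0" using Q by (simp add: isproj_orth_sym)
  have 1: "e1 k \<in> A \<and> v1 k \<in> M \<and> radj (v1 k) o\<^sub>L v1 k = e1 0 \<and> v1 k o\<^sub>L radj (v1 k) = e1 k \<and>
      v1 k o\<^sub>L Q1 = v1 k \<and> Q1 o\<^sub>L v1 k = v1 k \<and> (\<forall>q\<in>B. q o\<^sub>L v1 k = v1 k o\<^sub>L q)" if "k < N" for k
    using u1 that by (simp add: units_def)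
  have 2: "e2 k \<in> A \<and> v2 k \<in> M \<and> radj (v2 k) o\<^sub>L v2 k = e2 0 \<and> v2 k o\<^sub>L radj (v2 k) = e2 k \<and>
      v2 k o\<^sub>L Q2 = v2 k \<and> Q2 o\<^sub>L v2 k = v2 k \<and> (\<forall>q\<in>B. q o\<^sub>L v2 k = v2 k o\<^sub>L q)" if "k < N" for k
    using u2 that by (simp add: units_def)
  have r1: "radj (v1 k) o\<^sub>L Q1 = radj (v1 k)" "Q1 o\<^sub>L radj (v1 k) = radj (v1 k)" if "k < N" for k
    using 1[OF that] isproj_radj[OF Q(1)] by (metis radj_compose)+
  have r2: "radj (v2 k) o\<^sub>L Q2 = radj (v2 k)" "Q2 o\<^sub>L radj (v2 k) = radj (v2 k)" if "k < N" for k
    using 2[OF that] isproj_radj[OF Q(2)] by (metis radj_compose)+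
  have zero: "S o\<^sub>L T = 0" if "S o\<^sub>L P = S" "R o\<^sub>L T = T" "P o\<^sub>L R = 0" for S T P R :: "'h \<Rightarrow>\<^sub>L 'h"
    using that by (metis blinfun_compose_assoc blinfun_compose_zero)
  have ee: "e1 k o\<^sub>L Q1 = e1 k" "Q1 o\<^sub>L e1 k = e1 k" "e2 k o\<^sub>L Q2 = e2 k" "Q2 o\<^sub>L e2 k = e2 k" if "k < N" for k
    using 1[OF that] 2[OF that] r1[OF that] r2[OF that] by (metis blinfun_compose_assoc)+
  have z: "radj (v1 k) o\<^sub>L v2 k = 0" "radj (v2 k) o\<^sub>L v1 k = 0"
    "v1 k o\<^sub>L radj (v2 k) = 0" "v2 k o\<^sub>L radj (v1 k) = 0"
    "v1 k o\<^sub>L Q2 = 0" "v2 k o\<^sub>L Q1 = 0" "Q1 o\<^sub>L v2 k = 0" "Q2 o\<^sub>L v1 k = 0" if "k < N" for k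
    using zero r1[OF that] r2[OF that] 1[OF that] 2[OF that] Q(3) Q' isproj_idem[OF Q(1)] isproj_idem[OF Q(2)]
    by metis+
  have qv: "q o\<^sub>L v1 k = v1 k" "v1 k o\<^sub>L q = v1 k" "q o\<^sub>L v2 k = 0" "v2 k o\<^sub>L q = 0" if "k < N" for k
    using 1[OF that] 2[OF that] q by (metis blinfun_compose_assoc blinfun_compose_zero)+
  have oe: "e1 j o\<^sub>L e2 k = 0" "e2 j o\<^sub>L e1 k = 0" if "j < N" "k < N" for j k
    using zero ee[OF that(1)] ee[OF that(2)] Q(3) Q' by metis+
  show ?thesis
    unfolding units_def
  proof (intro conjI allI impI)
    fix k assume k: "k < N"
    show "e1 k + e2 k \<in> A" "v1 k + v2 k \<in> M"
      using 1[OF k] 2[OF k] by (simp_all add: A_intros M_intros)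
    show "radj (v1 k + v2 k) o\<^sub>L (v1 k + v2 k) = e1 0 + e2 0"
      "(v1 k + v2 k) o\<^sub>L radj (v1 k + v2 k) = e1 k + e2 k"
      "(v1 k + v2 k) o\<^sub>L (Q1 + Q2) = v1 k + v2 k" "(Q1 + Q2) o\<^sub>L (v1 k + v2 k) = v1 k + v2 k"
      using 1[OF k] 2[OF k] z[OF k] by (simp_all add: compose_simps)
    show "\<forall>q\<in>insert q B. q o\<^sub>L (v1 k + v2 k) = (v1 k + v2 k) o\<^sub>L q"
      using 1[OF k] 2[OF k] qv[OF k] by (simp add: compose_simps)
  next
    fix j k assume jk: "j < N" "k < N" "j \<noteq> k"
    then show "(e1 j + e2 j) o\<^sub>L (e1 k + e2 k) = 0"
      using u1 u2 oe[OF jk(1,2)] by (simp add: compose_simps units_def)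
  next
    show "(\<Sum>k<N. e1 k + e2 k) = Q1 + Q2"
      using u1 u2 by (simp add: sum.distrib units_def)
  qed
qed

text \<open>Cutting \<open>Q\<close> by \<open>q\<close> gives two corners, each with its own units
  for the smaller set, and their sum commutes with \<open>q\<close> as well. The induction therefore
  ranges over all corners \<open>Q\<close>.\<close>

lemma units_exist:
  assumes "finite B" "\<And>q. q \<in> B \<Longrightarrow> q \<in> A \<and> isproj q" "Q \<in> A" "isproj Q" "N > 0"
  shows "\<exists>e v. units B N Q e v"
  using assms(1-4)
proof (induction B arbitrary: Q rule: finite_induct)
  case empty
  then show ?case using units_empty assms(5) by blast
next
  case (insert q B)
  have q: "q \<in> A" "isproj q" using insert.prems by auto
  have qQ: "q o\<^sub>L Q = Q o\<^sub>L q" using A_comm q insert.prems by blast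
  have qq: "q o\<^sub>L q = q" and QQ: "Q o\<^sub>L Q = Q" using q insert.prems by (simp_all add: isproj_idem)
  have qqQ: "q o\<^sub>L (Q o\<^sub>L q) = Q o\<^sub>L q" using qQ qq by (metis blinfun_compose_assoc)
  have QQq: "Q o\<^sub>L (Q o\<^sub>L q) = Q o\<^sub>L q" using QQ by (metis blinfun_compose_assoc)
  define Q1 Q2 where "Q1 = Q o\<^sub>L q" and "Q2 = Q - Q1"
  have Q1: "Q1 \<in> A" "isproj Q1" and Q2A: "Q2 \<in> A"
    using q insert.prems qQ by (simp_all add: Q1_def Q2_def A_intros isproj_compose)
  have "Q1 o\<^sub>L Q = Q1" using qQ QQq by (simp add: Q1_def blinfun_compose_assoc)
  then have Q2: "isproj Q2" using Q1 insert.prems by (simp add: Q2_def isproj_diff)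
  obtain e1 v1 e2 v2 where u: "units B N Q1 e1 v1" "units B N Q2 e2 v2"
    using insert.IH[OF _ Q1] insert.IH[OF _ Q2A Q2] insert.prems(1) by blast
  have "units (insert q B) N (Q1 + Q2) (\<lambda>k. e1 k + e2 k) (\<lambda>k. v1 k + v2 k)"
  proof (rule units_add[OF u Q1(2) Q2])
    show "Q1 o\<^sub>L Q2 = 0" using isproj_idem[OF Q1(2)] \<open>Q1 o\<^sub>L Q = Q1\<close>
      by (simp add: Q2_def compose_simps)
    show "q o\<^sub>L Q1 = Q1" "Q1 o\<^sub>L q = Q1"
      by (simp_all add: Q1_def qqQ blinfun_compose_assoc qq)
    then show "q o\<^sub>L Q2 = 0" "Q2 o\<^sub>L q = 0"
      by (simp_all add: Q2_def compose_simps qQ) (simp_all add: Q1_def)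
  qed
  moreover have "Q1 + Q2 = Q" by (simp add: Q2_def)
  ultimately show ?case by auto
qed

end

section \<open>The conditional expectation and the final construction\<close>

locale masa_expectation = masa_in_factor +
  fixes E :: "('a \<Rightarrow>\<^sub>L 'a) \<Rightarrow> ('a \<Rightarrow>\<^sub>L 'a)"
  assumes E_A: "T \<in> M \<Longrightarrow> E T \<in> A"
    and E_add: "S \<in> M \<Longrightarrow> T \<in> M \<Longrightarrow> E (S + T) = E S + E T"
    and E_scaleR: "T \<in> M \<Longrightarrow> E (c *\<^sub>R T) = c *\<^sub>R E T"
    and E_fix: "T \<in> A \<Longrightarrow> E T = T"
    and E_module: "R \<in> A \<Longrightarrow> T \<in> M \<Longrightarrow> S \<in> A \<Longrightarrow> E (R o\<^sub>L T o\<^sub>L S) = R o\<^sub>L E T o\<^sub>L S"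
begin

lemma E_0: "E 0 = 0"
  by (simp add: E_fix A_intros)

lemma E_sum: "(\<And>i. i \<in> I \<Longrightarrow> f i \<in> M) \<Longrightarrow> E (sum f I) = (\<Sum>i\<in>I. E (f i))"
  by (induction I rule: infinite_finite_induct) (simp_all add: E_0 E_add M_intros)

text \<open>The projections are rank one in the matrix algebra of the units, onto the rows of a Hadamard matrix; the
  off-diagonal matrix units have expectation \<open>0\<close>.\<close>

lemma equidistributed_projections:
  assumes B: "finite B" "\<And>q. q \<in> B \<Longrightarrow> q \<in> A \<and> isproj q"
  obtains p :: "nat \<Rightarrow> 'a \<Rightarrow>\<^sub>L 'a" where "\<And>j. j < 2 ^ m \<Longrightarrow> p j \<in> M \<and> isproj (p j) \<and> E (p j) = (1 / 2 ^ m) *\<^sub>R id_blinfun"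
    "\<And>i j. i < 2 ^ m \<Longrightarrow> j < 2 ^ m \<Longrightarrow> i \<noteq> j \<Longrightarrow> p i o\<^sub>L p j = 0"
    "\<And>j q. j < 2 ^ m \<Longrightarrow> q \<in> B \<Longrightarrow> q o\<^sub>L p j = p j o\<^sub>L q"
proof -
  define N :: nat where "N = 2 ^ m"
  have N: "N > 0" by (simp add: N_def)
  have N': "(2::real) ^ m = real N" by (simp add: N_def)
  obtain H :: "nat \<Rightarrow> nat \<Rightarrow> real" where
    H1: "\<And>i k. i < N \<Longrightarrow> k < N \<Longrightarrow> H i k * H i k = 1" and
    H: "\<And>i j. i < N \<Longrightarrow> j < N \<Longrightarrow> (\<Sum>k<N. H i k * H j k) = (if i = j then real N else 0)"
    using hadamard_matrix[of m] unfolding N_def[symmetric] N' by blast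
  obtain e v where u: "units B N id_blinfun e v"
    using units_exist[OF B, of id_blinfun N] N by (auto simp: A_intros)
  have e: "e k \<in> A" and v: "v k \<in> M" "radj (v k) o\<^sub>L v k = e 0" "v k o\<^sub>L radj (v k) = e k"
    and vq: "\<And>q. q \<in> B \<Longrightarrow> q o\<^sub>L v k = v k o\<^sub>L q" if "k < N" for k
    using u that by (simp_all add: units_def)
  have orth: "e j o\<^sub>L e k = 0" if "j < N" "k < N" "j \<noteq> k" for j k
    using u that by (simp add: units_def)
  have sum_e: "(\<Sum>k<N. e k) = id_blinfun" using u by (simp add: units_def)
  have ep: "isproj (e k)" if "k < N" for k
  proof -
    \<comment> \<open>Idempotence follows from orthogonality and total sum \<open>1\<close>.\<close>
    have "e k = e k o\<^sub>L (\<Sum>l<N. e l)" by (simp add: sum_e)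
    also have "\<dots> = (\<Sum>l<N. if l = k then e k o\<^sub>L e k else 0)"
      unfolding blinfun_compose.sum_right using orth[OF that] by (intro sum.cong) auto
    also have "\<dots> = e k o\<^sub>L e k" using that by simp
    finally show ?thesis using v(3)[OF that] by (metis isproj_def radj_compose radj_radj)
  qed
  have pv: "pisom (v k)" if "k < N" for k
    using v(2)[OF that] ep[OF N] by (intro pisom_if_initial) simp
  have ve: "v k o\<^sub>L e 0 = v k" "e k o\<^sub>L v k = v k" "radj (v k) o\<^sub>L e k = radj (v k)" if "k < N" for k
  proof -
    show 1: "v k o\<^sub>L e 0 = v k" "e k o\<^sub>L v k = v k"
      using pv[OF that] v(2,3)[OF that] by (metis pisom_def blinfun_compose_assoc)+
    show "radj (v k) o\<^sub>L e k = radj (v k)"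
      using arg_cong[OF 1(2), of radj] ep[OF that] by (simp add: isproj_radj)
  qed
  have vv: "radj (v k) o\<^sub>L v l = (if k = l then e 0 else 0)" if "k < N" "l < N" for k l
    using v(2) ve(3)[OF that(1)] ve(2)[OF that(2)] orth[OF that]
    by (metis blinfun_compose_assoc blinfun_compose_zero(1,2) that(1))
  have Evv: "E (v k o\<^sub>L radj (v l)) = (if k = l then e k else 0)" if "k < N" "l < N" for k l
  proof (cases "k = l")
    case True
    then show ?thesis using v(3)[OF that(1)] e[OF that(1)] by (simp add: E_fix)
  next
    case False
    let ?w = "v k o\<^sub>L radj (v l)"
    have wM: "?w \<in> M" using v that by (simp add: M_intros)
    \<comment> \<open>By the module property \<open>E\<close> respects the factors
      \<open>e k\<close> and \<open>e l\<close>; as \<open>E ?w\<close> commutes with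
      \<open>e l\<close>, the product \<open>e k o\<^sub>L e l = 0\<close> appears.\<close>
    have "?w = e k o\<^sub>L ?w o\<^sub>L e l"
      using ve[OF that(1)] ve[OF that(2)] by (metis blinfun_compose_assoc)
    then have "E ?w = e k o\<^sub>L E ?w o\<^sub>L e l" using E_module[OF e wM e] that by metis
    also have "\<dots> = (e k o\<^sub>L e l) o\<^sub>L E ?w"
      using A_comm[OF E_A[OF wM] e[OF that(2)]] by (simp add: blinfun_compose_assoc)
    finally show ?thesis using orth that False by simp
  qed
  define c where "c = 1 / sqrt (real N)"
  have cc: "c * c = 1 / real N" by (simp add: c_def)
  \<comment> \<open>Row \<open>j\<close> of the matrix, normalised and expressed in the units.
    Orthonormality of the rows makes \<open>s j\<close> a partial isometry with initial projection
    \<open>e 0\<close>, and distinct rows have orthogonal ranges.\<close>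
  define s where "s j = c *\<^sub>R (\<Sum>k<N. H j k *\<^sub>R v k)" for j
  have sM: "s j \<in> M" for j unfolding s_def using v by (intro M_intros) simp
  have ss: "radj (s i) o\<^sub>L s j = (if i = j then e 0 else 0)" if "i < N" "j < N" for i j
  proof -
    have "radj (s i) o\<^sub>L s j = (c * c) *\<^sub>R (\<Sum>l<N. \<Sum>k<N. (H i k * H j l) *\<^sub>R (radj (v k) o\<^sub>L v l))"
      by (simp add: s_def compose_simps scaleR_sum_right mult_ac)
    also have "(\<Sum>l<N. \<Sum>k<N. (H i k * H j l) *\<^sub>R (radj (v k) o\<^sub>L v l)) =
        (\<Sum>l<N. \<Sum>k<N. if k = l then (H i l * H j l) *\<^sub>R e 0 else 0)"
      using vv by (intro sum.cong) auto
    also have "\<dots> = (\<Sum>l<N. (H i l * H j l) *\<^sub>R e 0)" by simp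
    also have "\<dots> = (if i = j then real N else 0) *\<^sub>R e 0"
      by (simp only: scaleR_sum_left[symmetric] H[OF that])
    finally show ?thesis using N by (simp add: cc)
  qed
  have se: "s j o\<^sub>L e 0 = s j" for j
  proof -
    have "(\<Sum>k<N. H j k *\<^sub>R (v k o\<^sub>L e 0)) = (\<Sum>k<N. H j k *\<^sub>R v k)"
      using ve(1) by (intro sum.cong) auto
    then show ?thesis by (simp add: s_def compose_simps)
  qed
  define p where "p j = s j o\<^sub>L radj (s j)" for j
  have pp: "p i o\<^sub>L p j = (if i = j then p i else 0)" if "i < N" "j < N" for i j
  proof -
    have "p i o\<^sub>L p j = s i o\<^sub>L (radj (s i) o\<^sub>L s j) o\<^sub>L radj (s j)"
      by (simp add: p_def blinfun_compose_assoc)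
    then show ?thesis unfolding ss[OF that] by (simp add: se p_def)
  qed
  have Ep: "E (p j) = (1 / real N) *\<^sub>R id_blinfun" if j: "j < N" for j
  proof -
    define T where "T k l = (H j k * H j l) *\<^sub>R (v k o\<^sub>L radj (v l))" for k l
    have T: "T k l \<in> M" "E (T k l) = (H j k * H j l) *\<^sub>R E (v k o\<^sub>L radj (v l))"
      if "k < N" "l < N" for k l
      using v that by (simp_all add: T_def M_intros E_scaleR)
    have T': "(\<Sum>k<N. T k l) \<in> M" if "l < N" for l
      by (intro M_intros) (use T that in simp)
    have "p j = (c * c) *\<^sub>R (\<Sum>l<N. \<Sum>k<N. T k l)"
      by (simp add: p_def s_def T_def compose_simps scaleR_sum_right mult_ac)
    also have "E \<dots> = (c * c) *\<^sub>R E (\<Sum>l<N. \<Sum>k<N. T k l)"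
      by (intro E_scaleR rcomm_sum[where S = "rcomm M", unfolded M_bicomm]) (use T in simp)
    also have "E (\<Sum>l<N. \<Sum>k<N. T k l) = (\<Sum>l<N. E (\<Sum>k<N. T k l))"
      by (intro E_sum) (use T' in simp)
    also have "\<dots> = (\<Sum>l<N. \<Sum>k<N. E (T k l))"
      by (intro sum.cong refl E_sum) (use T in simp)
    also have "\<dots> = (\<Sum>l<N. \<Sum>k<N. (H j k * H j l) *\<^sub>R E (v k o\<^sub>L radj (v l)))"
      using T by (intro sum.cong) auto
    \<comment> \<open>Only diagonal terms survive \<open>E\<close>, and each has coefficient
      \<open>1\<close> because the entries of the matrix square to \<open>1\<close>.\<close>
    also have "(\<Sum>l<N. \<Sum>k<N. (H j k * H j l) *\<^sub>R E (v k o\<^sub>L radj (v l))) =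
        (\<Sum>l<N. \<Sum>k<N. if k = l then e l else 0)"
      using Evv H1[OF j] by (intro sum.cong) auto
    also have "\<dots> = id_blinfun" by (simp add: sum_e)
    finally show ?thesis by (simp add: cc)
  qed
  have commutes: "q o\<^sub>L p j = p j o\<^sub>L q" if "q \<in> B" for j q
  proof -
    have "(\<Sum>k<N. H j k *\<^sub>R (q o\<^sub>L v k)) = (\<Sum>k<N. H j k *\<^sub>R (v k o\<^sub>L q))"
      using vq that by (intro sum.cong) auto
    then have qs: "q o\<^sub>L s j = s j o\<^sub>L q" by (simp add: s_def compose_simps)
    have "radj (s j) o\<^sub>L q = q o\<^sub>L radj (s j)"
      using arg_cong[OF qs, of radj] B(2)[OF that] by (simp add: isproj_radj)
    then show ?thesis using qs unfolding p_def by (metis blinfun_compose_assoc)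
  qed
  show ?thesis
  proof (rule that[of p], unfold N_def[symmetric] N')
    show "p j \<in> M \<and> isproj (p j) \<and> E (p j) = (1 / real N) *\<^sub>R id_blinfun" if "j < N" for j
      using pp[OF that that] Ep[OF that] sM by (simp add: isproj_def) (simp add: p_def M_intros)
  qed (use pp commutes in auto)
qed

text \<open>Orthogonality of the \<open>p k\<close> and their commutation with the
  \<open>q i k\<close> reduce a product of two sums to terms \<open>p k (q i k) (q j k)\<close>.
  These are symmetric in \<open>i\<close> and \<open>j\<close> since \<open>A\<close> is abelian;
  the case \<open>i = j\<close> gives idempotence.\<close>

theorem commuting_projections_with_expectation:
  assumes I: "finite I" and a: "\<And>i. i \<in> I \<Longrightarrow> a i \<in> A \<and> pos (a i) \<and> norm (a i) \<le> 1"
    and \<epsilon>: "\<epsilon> > 0"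
  shows "\<exists>P. (\<forall>i\<in>I. P i \<in> M \<and> isproj (P i) \<and> norm (E (P i) - a i) \<le> \<epsilon>) \<and>
    (\<forall>i\<in>I. \<forall>j\<in>I. P i o\<^sub>L P j = P j o\<^sub>L P i)"
proof -
  obtain m where m: "(1/2) ^ m < \<epsilon>" using real_arch_pow_inv[OF \<epsilon>, of "1/2"] by auto
  \<comment> \<open>One less than the order of the matrix: with \<open>n\<close> projections the
    remainder of \<open>Suc n\<close> times an entry has norm at most \<open>1\<close>, and division
    by \<open>Suc n = 2 ^ m\<close> leaves \<open>(1/2) ^ m\<close>.\<close>
  define n :: nat where "n = 2 ^ m - 1"
  have n: "Suc n = 2 ^ m" by (simp add: n_def)
  have "\<exists>q. (\<forall>k<n. isproj (q k) \<and> q k \<in> A) \<and> norm (real (Suc n) *\<^sub>R a i - (\<Sum>k<n. q k)) \<le> 1"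
    if "i \<in> I" for i
    using norm_sum_of_projections[of "a i" n] a[OF that] by metis
  then obtain q where q: "\<And>i k. i \<in> I \<Longrightarrow> k < n \<Longrightarrow> isproj (q i k) \<and> q i k \<in> A"
    "\<And>i. i \<in> I \<Longrightarrow> norm (real (Suc n) *\<^sub>R a i - (\<Sum>k<n. q i k)) \<le> 1"
    by metis
  \<comment> \<open>The projections of all entries together, so that one family \<open>p\<close>
    serves the whole tuple.\<close>
  define B where "B = (\<lambda>(i, k). q i k) ` (I \<times> {..<n})"
  have B: "finite B" "\<And>q'. q' \<in> B \<Longrightarrow> q' \<in> A \<and> isproj q'"
    using I q(1) by (auto simp: B_def)
  obtain p :: "nat \<Rightarrow> 'a \<Rightarrow>\<^sub>L 'a" where p: "\<And>j. j < 2 ^ m \<Longrightarrow> p j \<in> M \<and> isproj (p j) \<and> E (p j) = (1 / 2 ^ m) *\<^sub>R id_blinfun"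
    "\<And>i j. i < 2 ^ m \<Longrightarrow> j < 2 ^ m \<Longrightarrow> i \<noteq> j \<Longrightarrow> p i o\<^sub>L p j = 0"
    "\<And>j q. j < 2 ^ m \<Longrightarrow> q \<in> B \<Longrightarrow> q o\<^sub>L p j = p j o\<^sub>L q"
    by (rule equidistributed_projections[OF B, of m], assumption, rule that)
  have pq: "q i k o\<^sub>L p j = p j o\<^sub>L q i k" if "i \<in> I" "k < n" "j < n" for i j k
    using p(3)[of j "q i k"] that n by (auto simp: B_def)
  have pp: "p k o\<^sub>L p l = (if k = l then p k else 0)" if "k < n" "l < n" for k l
    using p(1)[of k] p(2)[of k l] that n by (auto simp: isproj_idem)
  define P where "P i = (\<Sum>k<n. p k o\<^sub>L q i k)" for i
  have PP: "P i o\<^sub>L P j = (\<Sum>k<n. p k o\<^sub>L (q i k o\<^sub>L q j k))" if ij: "i \<in> I" "j \<in> I" for i j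
  proof -
    have "(p k o\<^sub>L q i k) o\<^sub>L (p l o\<^sub>L q j l) = (if k = l then p k o\<^sub>L (q i k o\<^sub>L q j k) else 0)"
      if "k < n" "l < n" for k l
    proof -
      have "(p k o\<^sub>L q i k) o\<^sub>L (p l o\<^sub>L q j l) = (p k o\<^sub>L p l) o\<^sub>L (q i k o\<^sub>L q j l)"
        using pq[OF ij(1) that] by (metis blinfun_compose_assoc)
      then show ?thesis unfolding pp[OF that] by simp
    qed
    then have "(\<Sum>l<n. \<Sum>k<n. (p k o\<^sub>L q i k) o\<^sub>L (p l o\<^sub>L q j l)) =
        (\<Sum>l<n. \<Sum>k<n. if k = l then p l o\<^sub>L (q i l o\<^sub>L q j l) else 0)"
      by (intro sum.cong) auto
    then show ?thesis by (simp add: P_def compose_simps)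
  qed
  have "P i \<in> M" if "i \<in> I" for i
    unfolding P_def using p(1) q(1) that n by (intro M_intros) (auto intro: AM)
  moreover have "isproj (P i)" if i: "i \<in> I" for i
  proof -
    have "P i o\<^sub>L P i = P i"
      unfolding PP[OF i i] unfolding P_def using q(1)[OF i] by (intro sum.cong) (auto simp: isproj_idem)
    moreover have "radj (P i) = P i"
      unfolding P_def radj_sum using p(1) q(1)[OF i] pq[OF i] n
      by (intro sum.cong) (auto simp: isproj_radj)
    ultimately show ?thesis by (simp add: isproj_def)
  qed
  moreover have "P i o\<^sub>L P j = P j o\<^sub>L P i" if "i \<in> I" "j \<in> I" for i j
    unfolding PP[OF that] PP[OF that(2,1)] using q(1) that A_comm by (intro sum.cong) auto
  moreover have "norm (E (P i) - a i) \<le> \<epsilon>" if i: "i \<in> I" for i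
  proof -
    have "E (p k o\<^sub>L q i k) = (1 / real (Suc n)) *\<^sub>R q i k" if "k < n" for k
    proof -
      have "E (id_blinfun o\<^sub>L p k o\<^sub>L q i k) = id_blinfun o\<^sub>L E (p k) o\<^sub>L q i k"
        using that n p(1)[of k] q(1)[OF i that] by (intro E_module) (auto simp: A_intros)
      then show ?thesis using p(1)[of k] that n by (simp add: compose_simps)
    qed
    then have "E (P i) = (1 / real (Suc n)) *\<^sub>R (\<Sum>k<n. q i k)"
      unfolding P_def using p(1) q(1)[OF i] n
      by (subst E_sum) (auto simp: scaleR_sum_right AM M_intros)
    then have "E (P i) - a i = - ((1 / real (Suc n)) *\<^sub>R (real (Suc n) *\<^sub>R a i - (\<Sum>k<n. q i k)))"
      by (simp add: scaleR_diff_right del: of_nat_Suc)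
    then have "norm (E (P i) - a i) = norm (real (Suc n) *\<^sub>R a i - (\<Sum>k<n. q i k)) / real (Suc n)"
      by (simp del: of_nat_Suc)
    also have "\<dots> \<le> 1 / real (Suc n)" using q(2)[OF i] by (intro divide_right_mono) auto
    also have "\<dots> = (1/2) ^ m" unfolding n by (simp add: power_one_over)
    finally show ?thesis using m by simp
  qed
  ultimately show ?thesis by blast
qed

end

section \<open>The complex structure\<close>

definition imult :: "'h::complex_hilbert_space \<Rightarrow>\<^sub>L 'h" where
  "imult = scaleC_op \<i> id_blinfun"

lemma imult_apply [simp]: "blinfun_apply imult x = scaleC \<i> x"
  by (simp add: imult_def scaleC_op.rep_eq)

lemma scaleC_eq: "scaleC c x = Re c *\<^sub>R x + Im c *\<^sub>R scaleC \<i> (x :: 'h::complex_hilbert_space)"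
proof -
  have "scaleC c x = scaleC (complex_of_real (Re c) + complex_of_real (Im c) * \<i>) x"
    by (metis complex_eq mult.commute)
  then show ?thesis by (simp only: scaleC_add_left scaleC_scaleC[symmetric] scaleC_of_real)
qed

lemma imult_imult: "imult o\<^sub>L imult = - id_blinfun"
proof (rule blinfun_eqI)
  fix x :: 'a
  have "scaleC (complex_of_real (-1)) x = (-1) *\<^sub>R x" by (rule scaleC_of_real)
  then show "(imult o\<^sub>L imult) x = (- id_blinfun) x"
    by (simp add: scaleC_scaleC blinfun.bilinear_simps)
qed

lemma inner_scaleC_i: "inner (scaleC \<i> x) (scaleC \<i> y) = inner x (y :: 'h::complex_hilbert_space)"
  by (simp add: Re_cinner[symmetric] cinner_scaleC_left cinner_scaleC_right)

lemma scaleC_i_i: "scaleC \<i> (scaleC \<i> x) = - (x :: 'h::complex_hilbert_space)"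
  using applyI[OF imult_imult, of x] by (simp add: blinfun.bilinear_simps)

lemma radj_imult: "radj imult = - (imult :: 'h::complex_hilbert_space \<Rightarrow>\<^sub>L 'h)"
proof (rule radj_eqI)
  fix x y :: 'h
  have "inner (scaleC \<i> x) y = inner (scaleC \<i> (scaleC \<i> x)) (scaleC \<i> y)"
    by (simp only: inner_scaleC_i)
  then show "inner (imult x) y = inner x ((- imult) y)"
    by (simp add: scaleC_i_i blinfun.bilinear_simps)
qed

lemma bounded_operators_eq: "bounded_operators = rcomm {imult}"
proof (intro subset_antisym subsetI)
  fix T :: "'a \<Rightarrow>\<^sub>L 'a" assume "T \<in> bounded_operators"
  then show "T \<in> rcomm {imult}"
    by (auto simp: bounded_operators_def rcomm_def intro!: blinfun_eqI)
next
  fix T :: "'a \<Rightarrow>\<^sub>L 'a" assume "T \<in> rcomm {imult}"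
  then have "imult o\<^sub>L T = T o\<^sub>L imult" by (simp add: rcomm_def)
  then have "scaleC \<i> (T x) = T (scaleC \<i> x)" for x by (metis applyI blinfun_apply_blinfun_compose imult_apply)
  then have "T (scaleC c x) = scaleC c (T x)" for c x
    unfolding scaleC_eq[of c] by (simp add: blinfun.bilinear_simps)
  then show "T \<in> bounded_operators" by (simp add: bounded_operators_def)
qed

lemma scaleC_op_eq: "scaleC_op c T = (Re c *\<^sub>R id_blinfun + Im c *\<^sub>R imult) o\<^sub>L T"
  by (rule blinfun_eqI) (simp add: scaleC_op.rep_eq blinfun.bilinear_simps scaleC_eq[of c])

lemma scaleC_op_of_real: "scaleC_op (complex_of_real c) T = c *\<^sub>R T"
  by (simp add: scaleC_op_eq compose_simps)

lemma adj_eq_radj: "T \<in> bounded_operators \<Longrightarrow> adj T = radj T"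
  by (rule radj_eqI[symmetric]) (metis Re_cinner cinner_adj)

lemma projection_op_iff: "projection_op P \<longleftrightarrow> P \<in> bounded_operators \<and> isproj P"
  by (auto simp: projection_op_def isproj_def adj_eq_radj)

lemma Im_cinner: "Im (cinner x y) = - inner (scaleC \<i> x) (y :: 'h::complex_hilbert_space)"
  by (simp add: Re_cinner[symmetric] cinner_scaleC_left)

text \<open>Values in the nonnegative reals mean that the imaginary part of the form vanishes.
  Polarising this, with one vector multiplied by the imaginary unit, yields self-adjointness;
  conversely self-adjointness makes the imaginary part vanish.\<close>

lemma positive_op_iff: "positive_op T \<longleftrightarrow> T \<in> bounded_operators \<and> pos T"
proof (cases "T \<in> bounded_operators")
  case True
  then have T: "T (scaleC \<i> x) = scaleC \<i> (T x)" for x by (simp add: bounded_operators_def)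
  have nonneg: "cinner (T x) x \<in> \<real>\<^sub>\<ge>\<^sub>0 \<longleftrightarrow> inner (T x) x \<ge> 0 \<and> inner (scaleC \<i> (T x)) x = 0" for x
    by (simp add: complex_nonneg_Reals_iff Re_cinner Im_cinner)
  have "radj T = T" if "\<And>x. inner (scaleC \<i> (T x)) x = 0"
  proof (rule radj_eqI)
    have pol: "inner (scaleC \<i> (T x)) y = - inner (scaleC \<i> (T y)) x" for x y
      using that[of "x + y"] that[of x] that[of y]
      by (simp add: blinfun.bilinear_simps scaleC_add_right inner_add_left inner_add_right)
    show "inner (T x) y = inner x (T y)" for x y
      using pol[of x "scaleC \<i> y"] by (simp add: T inner_scaleC_i scaleC_i_i inner_commute)
  qed
  moreover have "inner (scaleC \<i> (T x)) x = 0" if "radj T = T" for x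
  proof -
    have "inner (T (scaleC \<i> x)) x = inner (scaleC \<i> x) (T x)" using that by (simp add: inner_radj)
    moreover have "inner (scaleC \<i> x) (T x) = inner (scaleC \<i> (scaleC \<i> x)) (scaleC \<i> (T x))"
      by (simp only: inner_scaleC_i)
    ultimately show ?thesis by (simp add: T scaleC_i_i inner_commute)
  qed
  ultimately show ?thesis
    using True unfolding positive_op_def pos_def nonneg by blast
qed (simp add: positive_op_def)

lemma commutant_eq: "imult \<in> S \<Longrightarrow> commutant S = rcomm S"
  by (auto simp: commutant_def bounded_operators_eq rcomm_def)

text \<open>This is the passage from the complex hypotheses to the real setting. Maximality is
  transferred for self-adjoint and skew-adjoint elements, whose adjunction keeps a set closed under
  adjoints up to sign; normality is transferred for increasing sequences of projections.\<close>

lemma masa_expectation_if_masa: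
  fixes M A :: "('h::complex_hilbert_space \<Rightarrow>\<^sub>L 'h) set"
  assumes II1: "type_II1_factor M"
    and masa: "masa A M"
    and \<tau>: "faithful_normal_tracial_state M \<tau>"
    and E: "conditional_expectation M A E"
  shows "masa_expectation M A imult (\<lambda>T. Re (\<tau> T)) E"
proof -
  have vN: "von_neumann_algebra M" and id0: "id_blinfun \<noteq> (0 :: 'h \<Rightarrow>\<^sub>L 'h)"
    and cen: "M \<inter> commutant M = range (\<lambda>c. scaleC_op c id_blinfun)"
    and noab: "\<And>P. abelian_projection M P \<Longrightarrow> P = 0"
    using II1 by (auto simp: type_II1_factor_def factor_def)
  have star: "star_subalgebra M" and MM: "commutant (commutant M) = M"
    using vN by (auto simp: von_neumann_algebra_def)
  have Mb: "T \<in> bounded_operators" if "T \<in> M" for T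
    using star that by (auto simp: star_subalgebra_def)
  \<comment> \<open>As a scalar, multiplication by the imaginary unit lies in the centre; from here
    on complex and real commutants coincide.\<close>
  have "imult \<in> M \<inter> commutant M" unfolding cen imult_def by blast
  then have JM: "imult \<in> M" and JM': "imult \<in> commutant M" by auto
  have comm: "commutant M = rcomm M" using JM by (rule commutant_eq)
  have M'': "rcomm (rcomm M) = M"
    using MM JM' commutant_eq[of "commutant M"] by (simp add: comm)
  have adjM: "radj T \<in> M" if "T \<in> M" for T
    using star that adj_eq_radj[OF Mb[OF that]] by (auto simp: star_subalgebra_def)
  have Astar: "star_subalgebra A" and Aab: "abelian A" and AM: "A \<subseteq> M"
    and Amax: "\<And>B. star_subalgebra B \<Longrightarrow> abelian B \<Longrightarrow> A \<subseteq> B \<Longrightarrow> B \<subseteq> M \<Longrightarrow> B = A"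
    using masa by (auto simp: masa_def)
  have adjA: "radj T \<in> A" if "T \<in> A" for T
  proof -
    have "adj T \<in> A" using Astar that by (simp add: star_subalgebra_def)
    then show ?thesis using adj_eq_radj Mb AM that by (metis subsetD)
  qed
  \<comment> \<open>The bicommutant of a commutative set between \<open>A\<close> and
    \<open>M\<close> is an abelian star subalgebra of \<open>M\<close> containing \<open>A\<close>,
    so maximality collapses it to \<open>A\<close>.\<close>
  have maximal: "rcomm (rcomm S) = A"
    if S: "A \<subseteq> S" "S \<subseteq> M" "imult \<in> S" "\<And>U. U \<in> S \<Longrightarrow> radj U \<in> S \<or> radj U = - U"
      "\<And>U V. U \<in> S \<Longrightarrow> V \<in> S \<Longrightarrow> U o\<^sub>L V = V o\<^sub>L U" for S
  proof (rule Amax)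
    let ?B = "rcomm (rcomm S)"
    show BM: "?B \<subseteq> M" using rcomm_antimono[OF rcomm_antimono[OF S(2)]] by (simp add: M'')
    have SB: "S \<subseteq> ?B" by (rule subset_rcomm_rcomm)
    then show "A \<subseteq> ?B" using S(1) by blast
    have "S \<subseteq> rcomm S" using S(5) by (auto simp: rcomm_def)
    then have "?B \<subseteq> rcomm S" by (rule rcomm_antimono)
    then show "abelian ?B" unfolding abelian_def by (metis rcommD subsetD)
    have adjB: "radj T \<in> ?B" if "T \<in> ?B" for T
      using that S(4) by (intro rcomm_radj) (auto intro: rcomm_radj)
    show "star_subalgebra ?B"
      unfolding star_subalgebra_def
    proof (intro conjI ballI allI)
      show "?B \<subseteq> bounded_operators" using BM Mb by blast
      show "scaleC_op c T \<in> ?B" if "T \<in> ?B" for c T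
        using that SB S(3) unfolding scaleC_op_eq by (intro rcomm_intros) auto
      show "adj T \<in> ?B" if "T \<in> ?B" for T
        using adjB[OF that] adj_eq_radj BM Mb that by (metis subsetD)
    qed (auto intro: rcomm_intros)
  qed
  have AA: "U o\<^sub>L V = V o\<^sub>L U" if "U \<in> A" "V \<in> A" for U V
    using Aab that by (simp add: abelian_def)
  have JU: "imult o\<^sub>L U = U o\<^sub>L imult" if "U \<in> M" for U
    using Mb[OF that] by (simp add: bounded_operators_eq rcomm_def)
  \<comment> \<open>A masa is not unital by definition, so \<open>imult\<close> is adjoined before
    \<open>A\<close> itself can be identified with its bicommutant.\<close>
  have "rcomm (rcomm (insert imult A)) = A"
    by (rule maximal) (use AM JM adjA AA JU radj_imult in auto)
  then have JA: "imult \<in> A" using subset_rcomm_rcomm[of "insert imult A"] by auto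
  have A'': "rcomm (rcomm A) = A"
    by (rule maximal) (use AM JA adjA AA in auto)
  have lin: "\<And>S T. S \<in> M \<Longrightarrow> T \<in> M \<Longrightarrow> \<tau> (S + T) = \<tau> S + \<tau> T"
      "\<And>c T. T \<in> M \<Longrightarrow> \<tau> (scaleC_op c T) = c * \<tau> T"
    and tpos: "\<And>T. T \<in> M \<Longrightarrow> positive_op T \<Longrightarrow> \<tau> T \<in> \<real>\<^sub>\<ge>\<^sub>0" and tid: "\<tau> id_blinfun = 1"
    and ttr: "\<And>S T. S \<in> M \<Longrightarrow> T \<in> M \<Longrightarrow> \<tau> (S o\<^sub>L T) = \<tau> (T o\<^sub>L S)"
    and tfa: "\<And>T. T \<in> M \<Longrightarrow> positive_op T \<Longrightarrow> \<tau> T = 0 \<Longrightarrow> T = 0"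
    and tno: "normal_functional_on M \<tau>"
    using \<tau> by (auto simp: faithful_normal_tracial_state_def linear_functional_on_def)
  show ?thesis
  proof
    show "rcomm (rcomm M) = M" by (rule M'')
    show "rcomm (rcomm A) = A" by (rule A'')
    show "A \<subseteq> M" by (rule AM)
    show "imult \<in> A" by (rule JA)
    show "radj imult = - (imult :: 'h \<Rightarrow>\<^sub>L 'h)" by (rule radj_imult)
    show "imult o\<^sub>L imult = - (id_blinfun :: 'h \<Rightarrow>\<^sub>L 'h)" by (rule imult_imult)
    show "Re (\<tau> id_blinfun) = 1" by (simp add: tid)
  next
    fix T assume T: "T \<in> M"
    show "radj T \<in> M" using T by (rule adjM)
    show "imult o\<^sub>L T = T o\<^sub>L imult" using T by (rule JU)
    show "Re (\<tau> (c *\<^sub>R T)) = c * Re (\<tau> T)" for c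
      using lin(2)[OF T, of "complex_of_real c"] by (simp add: scaleC_op_of_real)
    show "E T \<in> A" using E T by (simp add: conditional_expectation_def)
    have "E (scaleC_op (complex_of_real c) T) = scaleC_op (complex_of_real c) (E T)" for c
      using E T unfolding conditional_expectation_def by blast
    then show "E (c *\<^sub>R T) = c *\<^sub>R E T" for c by (simp add: scaleC_op_of_real)
    assume "pos T"
    then have pT: "positive_op T" using Mb[OF T] by (simp add: positive_op_iff)
    show "0 \<le> Re (\<tau> T)" using tpos[OF T pT] by (simp add: complex_nonneg_Reals_iff)
    assume "Re (\<tau> T) = 0"
    then have "\<tau> T = 0" using tpos[OF T pT] by (simp add: complex_nonneg_Reals_iff complex_eq_iff)
    then show "T = 0" using tfa T pT by blast
  next
    fix S T assume ST: "S \<in> M" "T \<in> M"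
    show "Re (\<tau> (S + T)) = Re (\<tau> S) + Re (\<tau> T)" using lin(1) ST by simp
    show "Re (\<tau> (S o\<^sub>L T)) = Re (\<tau> (T o\<^sub>L S))" using ttr ST by simp
    show "E (S + T) = E S + E T" using E ST by (simp add: conditional_expectation_def)
  next
    show "radj T \<in> A" if "T \<in> A" for T using that by (rule adjA)
    show "S o\<^sub>L T = T o\<^sub>L S" if "S \<in> A" "T \<in> A" for S T using that by (rule AA)
    show "E T = T" if "T \<in> A" for T using E that by (simp add: conditional_expectation_def)
    show "E (R o\<^sub>L T o\<^sub>L S) = R o\<^sub>L E T o\<^sub>L S" if "R \<in> A" "T \<in> M" "S \<in> A" for R T S
      using E that by (simp add: conditional_expectation_def)
  next
    fix x assume x: "x \<in> M" "radj x = x \<or> radj x = - x" "\<And>b. b \<in> A \<Longrightarrow> b o\<^sub>L x = x o\<^sub>L b"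
    have "rcomm (rcomm (insert x A)) = A"
      by (rule maximal) (use AM JA adjA AA x in \<open>auto simp: x(3)\<close>)
    then show "x \<in> A" using subset_rcomm_rcomm[of "insert x A"] by auto
  next
    fix e assume e: "isproj e" "e \<in> M" "e \<noteq> 0"
    then have "\<not> abelian ((\<lambda>T. e o\<^sub>L T o\<^sub>L e) ` M)"
      using noab[of e] Mb[of e] by (auto simp: abelian_projection_def projection_op_iff)
    then show "\<exists>x\<in>M. \<exists>y\<in>M. (e o\<^sub>L x o\<^sub>L e) o\<^sub>L (e o\<^sub>L y o\<^sub>L e) \<noteq> (e o\<^sub>L y o\<^sub>L e) o\<^sub>L (e o\<^sub>L x o\<^sub>L e)"
      unfolding abelian_def by blast
  next
    fix z assume z: "isproj z" "z \<in> M" "z \<in> rcomm M"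
    then obtain c where c: "z = scaleC_op c id_blinfun" using cen comm by blast
    obtain x :: 'h where x: "x \<noteq> 0" using id0 by (metis blinfun.zero_left blinfun_eqI)
    have "scaleC (c * c) x = scaleC c x"
      using applyI[OF isproj_idem[OF z(1)], of x] by (simp add: c scaleC_op.rep_eq scaleC_scaleC)
    moreover have "scaleC (c * c) x = scaleC (c * c - c) x + scaleC c x"
      by (simp flip: scaleC_add_left)
    ultimately have "norm (scaleC (c * c - c) x) = 0" by simp
    then have "c * c - c = 0" using x by (simp only: norm_scaleC) simp
    then have "c = 0 \<or> c = 1" by (simp add: algebra_simps)
    then show "z = 0 \<or> z = id_blinfun" by (auto simp: c scaleC_op_eq)
  next
    fix p :: "nat \<Rightarrow> 'h \<Rightarrow>\<^sub>L 'h" and q :: "'h \<Rightarrow>\<^sub>L 'h" and c :: real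
    assume p: "\<And>n. isproj (p n) \<and> p n \<in> M" and inc: "\<And>n. p n o\<^sub>L p (Suc n) = p n"
      and lim: "\<And>v. (\<lambda>n. p n v) \<longlonglongrightarrow> q v" and q: "isproj q" "q \<in> M"
      and c: "\<And>n. Re (\<tau> (p n)) \<le> c"
    have sub: "S - T \<in> bounded_operators" if "S \<in> M" "T \<in> M" for S T
      using Mb[OF that(1)] Mb[OF that(2)] unfolding bounded_operators_eq by (rule rcomm_diff)
    have le: "p n o\<^sub>L p m = p n" if "n \<le> m" for m n
      using that
    proof (induction m rule: dec_induct)
      case base
      then show ?case using p by (simp add: isproj_idem)
    next
      case (step m)
      then show ?case using inc[of m] by (metis blinfun_compose_assoc)
    qed
    have leq: "p n o\<^sub>L q = p n" for n
    proof (rule blinfun_eqI)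
      fix x
      have "(\<lambda>m. p n (p m x)) \<longlonglongrightarrow> p n (q x)" by (intro tendsto_intros lim)
      moreover have "(\<lambda>m. p n (p m x)) \<longlonglongrightarrow> p n x"
        using applyI[OF le] by (intro tendsto_eventually) (auto simp: eventually_sequentially)
      ultimately show "(p n o\<^sub>L q) x = p n x" by (simp add: LIMSEQ_unique)
    qed
    have pp: "positive_op (p m - p n)" if "n \<le> m" for m n
      using p[of n] p[of m] le[OF that] sub by (simp add: positive_op_iff pos_isproj isproj_diff)
    have qp: "positive_op (q - p n)" for n
      using p[of n] q leq sub by (simp add: positive_op_iff pos_isproj isproj_diff)
    have adj: "adj S = S" if "isproj S" "S \<in> M" for S
      using that adj_eq_radj[OF Mb] by (simp add: isproj_radj)
    \<comment> \<open>The range of an increasing sequence is directed, and its strong limit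
      \<open>q\<close> is the least upper bound because the quadratic forms converge.\<close>
    have "Re (\<tau> q) = (SUP S\<in>range p. Re (\<tau> S))"
    proof (rule tno[unfolded normal_functional_on_def, THEN spec[of _ "range p"], THEN spec[of _ q], THEN mp])
      show "range p \<noteq> {} \<and> range p \<subseteq> {S\<in>M. adj S = S} \<and>
        (\<forall>R\<in>range p. \<forall>S\<in>range p. \<exists>U\<in>range p. positive_op (U - R) \<and> positive_op (U - S)) \<and>
        q \<in> M \<and> adj q = q \<and> (\<forall>S\<in>range p. positive_op (q - S)) \<and>
        (\<forall>U\<in>M. adj U = U \<and> (\<forall>S\<in>range p. positive_op (U - S)) \<longrightarrow> positive_op (U - q))"
      proof (intro conjI ballI impI)
        show "range p \<subseteq> {S\<in>M. adj S = S}" using p adj by auto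
        show "adj q = q" using q adj by simp
        show "positive_op (q - S)" if "S \<in> range p" for S using that qp by auto
        show "\<exists>U\<in>range p. positive_op (U - R) \<and> positive_op (U - S)"
          if RS: "R \<in> range p" "S \<in> range p" for R S
        proof -
          obtain m n where "R = p m" "S = p n" using RS by auto
          then show ?thesis using pp[of m "max m n"] pp[of n "max m n"] by auto
        qed
        show "positive_op (U - q)" if U: "U \<in> M" "adj U = U \<and> (\<forall>S\<in>range p. positive_op (U - S))" for U
        proof -
          have "inner ((U - q) x) x \<ge> 0" for x
          proof (rule LIMSEQ_le_const)
            show "(\<lambda>n. inner ((U - p n) x) x) \<longlonglongrightarrow> inner ((U - q) x) x"
              unfolding blinfun.diff_left by (intro tendsto_intros lim)
            show "\<exists>N. \<forall>n\<ge>N. 0 \<le> inner ((U - p n) x) x"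
              using U(2) by (auto simp: positive_op_iff pos_inner)
          qed
          moreover have "radj (U - q) = U - q"
            using U adj_eq_radj[OF Mb[OF U(1)]] q by (simp add: isproj_radj)
          ultimately show ?thesis using sub[OF U(1) q(2)] by (simp add: positive_op_iff pos_def)
        qed
      qed (use q in auto)
    qed
    also have "\<dots> \<le> c" using c by (intro cSUP_least) auto
    finally show "Re (\<tau> q) \<le> c" .
  qed
qed

theorem theorem10:
  fixes M A :: "('h::complex_hilbert_space \<Rightarrow>\<^sub>L 'h) set"
    and \<tau> :: "('h \<Rightarrow>\<^sub>L 'h) \<Rightarrow> complex"
    and E :: "('h \<Rightarrow>\<^sub>L 'h) \<Rightarrow> ('h \<Rightarrow>\<^sub>L 'h)"
    and n :: nat
    and a :: "nat \<Rightarrow> ('h \<Rightarrow>\<^sub>L 'h)"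
    and \<epsilon> :: real
  assumes "type_II1_factor M"
    and "masa A M"
    and "faithful_normal_tracial_state M \<tau>"
    and "conditional_expectation M A E"
    and "trace_preserving M \<tau> E"
    and "n \<ge> 1"
    and "\<forall>i\<in>{1..n}. a i \<in> A \<and> positive_op (a i) \<and> norm (a i) \<le> 1"
    and "\<epsilon> > 0"
  shows "\<exists>P. (\<forall>i\<in>{1..n}. P i \<in> M \<and> projection_op (P i)) \<and> commuting_tuple n P \<and>
           tuple_norm n (\<lambda>i. E (P i) - a i) \<le> \<epsilon>"
proof -
  interpret masa_expectation M A imult "\<lambda>T. Re (\<tau> T)" E
    using assms(1-4) by (rule masa_expectation_if_masa)
  obtain P where P: "\<forall>i\<in>{1..n}. P i \<in> M \<and> isproj (P i) \<and> norm (E (P i) - a i) \<le> \<epsilon>"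
    "\<forall>i\<in>{1..n}. \<forall>j\<in>{1..n}. P i o\<^sub>L P j = P j o\<^sub>L P i"
    using commuting_projections_with_expectation[of "{1..n}" a \<epsilon>] assms(7,8)
    by (auto simp: positive_op_iff)
  have "P i \<in> bounded_operators" if "i \<in> {1..n}" for i
    using J_comm P(1) that by (auto simp: bounded_operators_eq rcomm_def)
  \<comment> \<open>The hypothesis \<open>n \<ge> 1\<close> makes the maximum range over a nonempty
    set.\<close>
  moreover have "tuple_norm n (\<lambda>i. E (P i) - a i) \<le> \<epsilon>"
    using P(1) assms(6) by (auto simp: tuple_norm_def)
  ultimately show ?thesis
    using P by (intro exI[of _ P]) (auto simp: projection_op_iff commuting_tuple_def)
qed

end
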